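(* Every $\pm$ isothermic timelike surface with harmonic inverse mean curvature in $\mathbf{E}^3_1$ is dual to a $\pm$ isothermic timelike Bonnet surface in $\mathbf{E}^3_1$, and vice versa.
   Context: $\mathbf{E}^3_1$ is Minkowski 3-space. A timelike surface is an immersion $F:M\to\mathbf{E}^3_1$ with Lorentzian induced metric $I$, unit normal $N$, mean curvature $H=\frac12\mathrm{tr}(-dN)$. A null coordinate system $(u,v)$ satisfies $I=e^\omega du\,dv$ (after possibly replacing $u$ by $-u$ in case the coefficient is negative); $Q=\langle F_{uu},N\rangle$, $R=\langle F_{vv},N\rangle$. The surface has harmonic inverse mean curvature if $H\neq0$ and $(1/H)_{uv}=0$. It is isothermic (sign $+$), respectively anti isothermic (sign $-$), if around every point there are null coordinates with $Q=\frac12\mathfrak{q}(u,v)\varrho(u)$, $R=\pm\frac12\mathfrak{q}(u,v)\sigma(v)$, $\varrho>0$, $\sigma>0$, with $\mathfrak{q}$ a real smooth function; "$\pm$ isothermic" refers to these two alternatives together. On a simply connected region with such coordinates, the dual (Christoffel transform) of $F$ is the timelike immersion $F^*$ into $\mathbf{E}^3_1$ defined by $F^*_u=e^{-\omega}\varrho F_v$, $F^*_v=\pm e^{-\omega}\sigma F_u$, $N^*=N$. A timelike Bonnet surface is a timelike surface which admits a nontrivial isometric deformation preserving the mean curvature.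
   Formalization: The dual of a surface with harmonic inverse mean curvature is shown to be Bonnet near each point, since a deformation of the whole region can fail to exist; in the converse the Bonnet surface is assumed free of umbilics, where the dual would have zero mean curvature. *)

theory Defs
  imports "HOL-Analysis.Analysis"
begin

section \<open>Smooth maps and smooth surfaces\<close>

text \<open>\<open>S\<close> is always an open set.\<close>

primrec Ck_on ::
  "nat \<Rightarrow> ('a::euclidean_space \<Rightarrow> 'b::real_normed_vector) \<Rightarrow> 'a set \<Rightarrow> bool" where
  "Ck_on 0 f S \<longleftrightarrow> continuous_on S f"
| "Ck_on (Suc k) f S \<longleftrightarrow> (\<forall>x\<in>S. f differentiable (at x)) \<and>
     (\<forall>v. Ck_on k (\<lambda>x. frechet_derivative f (at x) v) S)"

definition smooth_on ::
  "('a::euclidean_space \<Rightarrow> 'b::real_normed_vector) \<Rightarrow> 'a set \<Rightarrow> bool" where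
  "smooth_on f S \<longleftrightarrow> (\<forall>k. Ck_on k f S)"

text \<open>A chart is a pair of a coordinate region and the coordinate map on it; the value of the
  coordinate map outside the region is irrelevant.\<close>

type_synonym 'm chart = "'m set \<times> ('m \<Rightarrow> real \<times> real)"

definition coord_dom :: "'m chart \<Rightarrow> (real \<times> real) set" where
  "coord_dom c = snd c ` fst c"

definition param :: "'m chart \<Rightarrow> real \<times> real \<Rightarrow> 'm" where
  "param c = inv_into (fst c) (snd c)"

definition is_chart :: "'m::topological_space set \<Rightarrow> 'm chart \<Rightarrow> bool" where
  "is_chart M c \<longleftrightarrow> openin (top_of_set M) (fst c) \<and> open (coord_dom c) \<and>
     homeomorphism (fst c) (coord_dom c) (snd c) (param c)"

definition compatible :: "'m chart \<Rightarrow> 'm chart \<Rightarrow> bool" where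
  "compatible c d \<longleftrightarrow>
     smooth_on (snd d \<circ> param c) (snd c ` (fst c \<inter> fst d)) \<and>
     smooth_on (snd c \<circ> param d) (snd d ` (fst c \<inter> fst d))"

text \<open>A connected smooth 2-manifold with underlying space \<open>M\<close> (a subspace of the Hausdorff
  space \<open>'m\<close>) and atlas \<open>A\<close>. Second countability is not imposed; for surfaces
  immersed in a 3-space it is automatic.\<close>

definition smooth_2manifold :: "'m::t2_space set \<Rightarrow> 'm chart set \<Rightarrow> bool" where
  "smooth_2manifold M A \<longleftrightarrow> connected M \<and> \<Union> (fst ` A) = M \<and>
     (\<forall>c\<in>A. is_chart M c) \<and> (\<forall>c\<in>A. \<forall>d\<in>A. compatible c d)"

text \<open>Membership in the maximal atlas determined by \<open>A\<close>.\<close>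

definition coordinate_system :: "'m::t2_space set \<Rightarrow> 'm chart set \<Rightarrow> 'm chart \<Rightarrow> bool" where
  "coordinate_system M A c \<longleftrightarrow> is_chart M c \<and> (\<forall>d\<in>A. compatible c d)"

section \<open>Timelike surfaces in Minkowski 3-space\<close>

text \<open>Minkowski 3-space is \<open>real^3\<close> with the scalar product of signature \<open>(-,+,+)\<close>.\<close>

definition mink :: "real^3 \<Rightarrow> real^3 \<Rightarrow> real" where
  "mink x y = - (x$1 * y$1) + x$2 * y$2 + x$3 * y$3"

text \<open>In the following local notions \<open>f\<close> and \<open>n\<close> are the coordinate expressions of the
  immersion and of its unit normal.\<close>

definition D1 :: "(real \<times> real \<Rightarrow> 'b::real_normed_vector) \<Rightarrow> real \<times> real \<Rightarrow> 'b" where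
  "D1 f x = frechet_derivative f (at x) (1, 0)"

definition D2 :: "(real \<times> real \<Rightarrow> 'b::real_normed_vector) \<Rightarrow> real \<times> real \<Rightarrow> 'b" where
  "D2 f x = frechet_derivative f (at x) (0, 1)"

definition first_form ::
  "(real \<times> real \<Rightarrow> real^3) \<Rightarrow> real \<times> real \<Rightarrow> real \<times> real \<Rightarrow> real \<times> real \<Rightarrow> real" where
  "first_form f x X Y =
     mink (frechet_derivative f (at x) X) (frechet_derivative f (at x) Y)"

definition lorentzian :: "(real \<times> real \<Rightarrow> real \<times> real \<Rightarrow> real) \<Rightarrow> bool" where
  "lorentzian B \<longleftrightarrow> (\<exists>e1 e2. B e1 e1 = -1 \<and> B e2 e2 = 1 \<and> B e1 e2 = 0)"

text \<open>The shape operator \<open>- dN\<close>, tangent vectors being identified with their images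
  under the differential of the immersion.\<close>

definition shape_operator ::
  "(real \<times> real \<Rightarrow> real^3) \<Rightarrow> (real \<times> real \<Rightarrow> real^3) \<Rightarrow> real \<times> real \<Rightarrow> real \<times> real \<Rightarrow> real \<times> real" where
  "shape_operator f n x = (THE S. linear S \<and>
     (\<forall>X. frechet_derivative f (at x) (S X) = - frechet_derivative n (at x) X))"

definition mean_curvature ::
  "(real \<times> real \<Rightarrow> real^3) \<Rightarrow> (real \<times> real \<Rightarrow> real^3) \<Rightarrow> real \<times> real \<Rightarrow> real" where
  "mean_curvature f n x = (1/2) * (\<Sum>b\<in>Basis. shape_operator f n x b \<bullet> b)"

text \<open>The surface is the pair of the immersion \<open>F\<close> and the choice \<open>N\<close> of unit normal.\<close>

definition timelike_surface ::
  "'m::t2_space set \<Rightarrow> 'm chart set \<Rightarrow> ('m \<Rightarrow> real^3) \<Rightarrow> ('m \<Rightarrow> real^3) \<Rightarrow> bool" where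
  "timelike_surface M A F N \<longleftrightarrow> smooth_2manifold M A \<and>
     (\<forall>c\<in>A. smooth_on (F \<circ> param c) (coord_dom c) \<and> smooth_on (N \<circ> param c) (coord_dom c) \<and>
       (\<forall>x\<in>coord_dom c.
          inj (frechet_derivative (F \<circ> param c) (at x)) \<and>
          lorentzian (first_form (F \<circ> param c) x) \<and>
          mink ((N \<circ> param c) x) ((N \<circ> param c) x) = 1 \<and>
          (\<forall>X. mink (frechet_derivative (F \<circ> param c) (at x) X) ((N \<circ> param c) x) = 0)))"

definition umbilic_free ::
  "'m chart set \<Rightarrow> ('m \<Rightarrow> real^3) \<Rightarrow> ('m \<Rightarrow> real^3) \<Rightarrow> bool" where
  "umbilic_free A F N \<longleftrightarrow> (\<forall>c\<in>A. \<forall>x\<in>coord_dom c.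
     \<not> (\<exists>k. \<forall>X. shape_operator (F \<circ> param c) (N \<circ> param c) x X = k *\<^sub>R X))"

section \<open>Null coordinates, harmonic inverse mean curvature, isothermic surfaces\<close>

text \<open>\<open>I = e\<^sup>\<omega> du dv\<close> means that the coordinate fields are null and that their
  product is \<open>e\<^sup>\<omega> / 2\<close>.\<close>

definition null_coordinates ::
  "'m::t2_space set \<Rightarrow> 'm chart set \<Rightarrow> ('m \<Rightarrow> real^3) \<Rightarrow> 'm chart \<Rightarrow> bool" where
  "null_coordinates M A F c \<longleftrightarrow> coordinate_system M A c \<and>
     (\<forall>x\<in>coord_dom c. first_form (F \<circ> param c) x (1, 0) (1, 0) = 0 \<and>
        first_form (F \<circ> param c) x (0, 1) (0, 1) = 0 \<and>
        first_form (F \<circ> param c) x (1, 0) (0, 1) > 0)"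

definition omega :: "(real \<times> real \<Rightarrow> real^3) \<Rightarrow> real \<times> real \<Rightarrow> real" where
  "omega f x = ln (2 * first_form f x (1, 0) (0, 1))"

definition Q_coeff ::
  "(real \<times> real \<Rightarrow> real^3) \<Rightarrow> (real \<times> real \<Rightarrow> real^3) \<Rightarrow> real \<times> real \<Rightarrow> real" where
  "Q_coeff f n x = mink (D1 (D1 f) x) (n x)"

definition R_coeff ::
  "(real \<times> real \<Rightarrow> real^3) \<Rightarrow> (real \<times> real \<Rightarrow> real^3) \<Rightarrow> real \<times> real \<Rightarrow> real" where
  "R_coeff f n x = mink (D2 (D2 f) x) (n x)"

definition harmonic_inverse_mean_curvature ::
  "'m::t2_space set \<Rightarrow> 'm chart set \<Rightarrow> ('m \<Rightarrow> real^3) \<Rightarrow> ('m \<Rightarrow> real^3) \<Rightarrow> bool" where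
  "harmonic_inverse_mean_curvature M A F N \<longleftrightarrow> timelike_surface M A F N \<and>
     (\<forall>c\<in>A. \<forall>x\<in>coord_dom c. mean_curvature (F \<circ> param c) (N \<circ> param c) x \<noteq> 0) \<and>
     (\<forall>c. null_coordinates M A F c \<longrightarrow> (\<forall>x\<in>coord_dom c.
        D2 (D1 (\<lambda>y. 1 / mean_curvature (F \<circ> param c) (N \<circ> param c) y)) x = 0))"

text \<open>The sign \<open>s\<close> is \<open>1\<close> for isothermic and \<open>-1\<close> for anti isothermic surfaces.\<close>

definition isothermic_coordinates ::
  "real \<Rightarrow> 'm::t2_space set \<Rightarrow> 'm chart set \<Rightarrow> ('m \<Rightarrow> real^3) \<Rightarrow> ('m \<Rightarrow> real^3) \<Rightarrow> 'm chart \<Rightarrow>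
   (real \<times> real \<Rightarrow> real) \<Rightarrow> (real \<Rightarrow> real) \<Rightarrow> (real \<Rightarrow> real) \<Rightarrow> bool" where
  "isothermic_coordinates s M A F N c q \<rho> \<sigma> \<longleftrightarrow> null_coordinates M A F c \<and>
     smooth_on q (coord_dom c) \<and>
     smooth_on \<rho> (fst ` coord_dom c) \<and> smooth_on \<sigma> (snd ` coord_dom c) \<and>
     (\<forall>(u, v)\<in>coord_dom c. \<rho> u > 0 \<and> \<sigma> v > 0 \<and>
        Q_coeff (F \<circ> param c) (N \<circ> param c) (u, v) = (1/2) * q (u, v) * \<rho> u \<and>
        R_coeff (F \<circ> param c) (N \<circ> param c) (u, v) = s * ((1/2) * q (u, v) * \<sigma> v))"

definition isothermic_surface ::
  "real \<Rightarrow> 'm::t2_space set \<Rightarrow> 'm chart set \<Rightarrow> ('m \<Rightarrow> real^3) \<Rightarrow> ('m \<Rightarrow> real^3) \<Rightarrow> bool" where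
  "isothermic_surface s M A F N \<longleftrightarrow> timelike_surface M A F N \<and>
     (\<forall>p\<in>M. \<exists>c q \<rho> \<sigma>. p \<in> fst c \<and> isothermic_coordinates s M A F N c q \<rho> \<sigma>)"

text \<open>\<open>G\<close> is the Christoffel transform of \<open>F\<close> on the region of \<open>c\<close>; the normal
  of the dual surface is \<open>N\<close> itself. If \<open>s = -1\<close>, then \<open>G\<^sub>u\<close> and \<open>G\<^sub>v\<close> have negative
  product, so that \<open>(-u, v)\<close> are null coordinates for \<open>G\<close>.\<close>

definition christoffel_dual ::
  "real \<Rightarrow> 'm::t2_space chart \<Rightarrow> (real \<Rightarrow> real) \<Rightarrow> (real \<Rightarrow> real) \<Rightarrow>
   ('m \<Rightarrow> real^3) \<Rightarrow> ('m \<Rightarrow> real^3) \<Rightarrow> ('m \<Rightarrow> real^3) \<Rightarrow> bool" where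
  "christoffel_dual s c \<rho> \<sigma> F N G \<longleftrightarrow> timelike_surface (fst c) {c} G N \<and>
     (\<forall>(u, v)\<in>coord_dom c.
        D1 (G \<circ> param c) (u, v) =
          (exp (- omega (F \<circ> param c) (u, v)) * \<rho> u) *\<^sub>R D2 (F \<circ> param c) (u, v) \<and>
        D2 (G \<circ> param c) (u, v) =
          (s * exp (- omega (F \<circ> param c) (u, v)) * \<sigma> v) *\<^sub>R D1 (F \<circ> param c) (u, v))"

section \<open>Timelike Bonnet surfaces\<close>

definition congruent_on :: "'m set \<Rightarrow> ('m \<Rightarrow> real^3) \<Rightarrow> ('m \<Rightarrow> real^3) \<Rightarrow> bool" where
  "congruent_on M F G \<longleftrightarrow> (\<exists>L b. linear L \<and> (\<forall>x y. mink (L x) (L y) = mink x y) \<and>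
     (\<forall>p\<in>M. G p = L (F p) + b))"

text \<open>The deformation \<open>(Ft t, Nt t)\<close>, \<open>\<bar>t\<bar> < \<epsilon>\<close>, is smooth in \<open>t\<close> and the point jointly.
  It is nontrivial if its members are not all congruent to the given surface.\<close>

definition timelike_bonnet ::
  "'m::t2_space set \<Rightarrow> 'm chart set \<Rightarrow> ('m \<Rightarrow> real^3) \<Rightarrow> ('m \<Rightarrow> real^3) \<Rightarrow> bool" where
  "timelike_bonnet M A F N \<longleftrightarrow> timelike_surface M A F N \<and>
     (\<exists>\<epsilon>::real. \<epsilon> > 0 \<and> (\<exists>Ft Nt.
        (\<forall>p\<in>M. Ft 0 p = F p \<and> Nt 0 p = N p) \<and>
        (\<forall>c\<in>A. smooth_on (\<lambda>(t, x). (Ft t \<circ> param c) x) ({-\<epsilon><..<\<epsilon>} \<times> coord_dom c) \<and>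
                smooth_on (\<lambda>(t, x). (Nt t \<circ> param c) x) ({-\<epsilon><..<\<epsilon>} \<times> coord_dom c)) \<and>
        (\<forall>t\<in>{-\<epsilon><..<\<epsilon>}. timelike_surface M A (Ft t) (Nt t) \<and>
           (\<forall>c\<in>A. \<forall>x\<in>coord_dom c.
              first_form (Ft t \<circ> param c) x = first_form (F \<circ> param c) x \<and>
              mean_curvature (Ft t \<circ> param c) (Nt t \<circ> param c) x =
                mean_curvature (F \<circ> param c) (N \<circ> param c) x)) \<and>
        (\<exists>t\<in>{-\<epsilon><..<\<epsilon>}. \<not> congruent_on M F (Ft t))))"

end

theory Submission
  imports Defs "HOL-Complex_Analysis.Riemann_Mapping"
begin

text \<open>Write \<open>h = \<langle>F\<^sub>u, F\<^sub>v\<rangle>\<close>. Codazzi's equations \<open>Q\<^sub>v = h H\<^sub>u\<close>, \<open>R\<^sub>u = h H\<^sub>v\<close> make the system for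
  \<open>F\<^sup>*\<close> integrable, and \<open>F\<^sup>*\<close> has the mean curvature \<open>q\<close> and the Hopf differentials \<open>H \<rho> / 2\<close> and
  \<open>\<plusminus> H \<sigma> / 2\<close>: duality exchanges \<open>q\<close> and \<open>H\<close>. So both directions relate Bonnet deformations of a
  \<open>\<plusminus>\<close> isothermic surface to the equation \<open>(1 / q)\<^sub>u\<^sub>v = 0\<close>.

  If \<open>1 / q = \<alpha>(u) + \<beta>(v)\<close>, put \<open>\<lambda> = (1 - t \<beta>) / (1 + t \<alpha>)\<close>. The data \<open>h\<close>, \<open>H\<close>, \<open>\<lambda> Q\<close>, \<open>R / \<lambda>\<close> still
  satisfy the Gauss and Codazzi equations, because \<open>\<lambda> Q - Q\<close> depends on \<open>u\<close> only and \<open>R / \<lambda> - R\<close> on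
  \<open>v\<close> only; integrating the Gauss-Weingarten equations gives a deformation, which is nontrivial since
  a congruence preserves \<open>\<bar>Q\<bar>\<close>.

  Conversely, let \<open>a(u)\<close> and \<open>b(v)\<close> be the differences of the Hopf differentials of the given surface
  and of a noncongruent one with the same metric and mean curvature. The Gauss equation yields
  \<open>a b + a R + b Q = 0\<close>. As there are no umbilics, a common zero of \<open>a\<close> and \<open>b\<close> would spread over the
  surface and force congruence; so neither vanishes, and dividing by \<open>a b q\<close> gives
  \<open>1 / q = - \<rho> / (2 a) \<minusplus> \<sigma> / (2 b)\<close>.\<close>

subsection \<open>Calculus of smooth maps\<close>

text \<open>The splitting 1 / q = \<alpha> + \<beta> is unique only up to moving a constant from one
  summand to the other, and this freedom is the deformation parameter. The last formula of the
  overview, read backwards for the splitting (\<alpha> + 1/t) + (\<beta> - 1/t), gives a = - t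
  \<rho> / (2 (1 + t \<alpha>)) and b = s t \<sigma> / (2 (1 - t \<beta>)), hence the \<lambda> used
  there.

  The splitting and the bounds on its denominators hold only on small rectangles, so the Bonnet
  deformation of a dual is local; it must be smooth in t and the point together, hence the linear
  differential equations with smooth dependence on parameters. In the other direction one chart need
  not cover the surface, and Q and R depend on the chart; agreement is carried over the surface by
  the shape operator instead. The dual lives on a whole simply connected coordinate region, which
  need not be convex; hence the Riemann map.

  For s = -1 the metric coefficient of the dual is negative in the coordinates of the original, so
  the local theory asks only that it be nonzero.\<close>

lemma frechet_derivative_cong_open:
  assumes "open S" "x \<in> S" "\<And>y. y \<in> S \<Longrightarrow> f y = g y"
  shows "frechet_derivative f (at x) = frechet_derivative g (at x)"
proof -
  have "(f has_derivative D) (at x) \<longleftrightarrow> (g has_derivative D) (at x)" for D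
    using has_derivative_transform_within_open[OF _ assms(1,2)] assms(3) by metis
  then show ?thesis by (simp add: frechet_derivative_def)
qed

lemma differentiable_cong_open:
  assumes "open S" "x \<in> S" "\<And>y. y \<in> S \<Longrightarrow> f y = g y" "f differentiable (at x)"
  shows "g differentiable (at x)"
  using assms has_derivative_transform_within_open[OF _ assms(1,2)] unfolding differentiable_def
  by metis

lemma Ck_on_cong:
  assumes "open S" "\<And>x. x \<in> S \<Longrightarrow> f x = g x" "Ck_on k f S"
  shows "Ck_on k g S"
  using assms(2,3)
proof (induction k arbitrary: f g)
  case 0
  then show ?case by (metis Ck_on.simps(1) continuous_on_cong)
next
  case (Suc k)
  have "frechet_derivative f (at x) = frechet_derivative g (at x)" if "x \<in> S" for x
    using frechet_derivative_cong_open[OF assms(1) that] Suc.prems(1) by blast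
  moreover have "g differentiable (at x)" if "x \<in> S" for x
    using differentiable_cong_open[OF assms(1) that] Suc.prems that by (metis Ck_on.simps(2))
  ultimately show ?case
    using Suc.prems(2) Suc.IH[of "\<lambda>x. frechet_derivative f (at x) v" "\<lambda>x. frechet_derivative g (at x) v" for v]
    by simp
qed

lemma Ck_on_SucI:
  assumes "open S" "\<And>x. x \<in> S \<Longrightarrow> (f has_derivative f' x) (at x)" "\<And>v. Ck_on k (\<lambda>x. f' x v) S"
  shows "Ck_on (Suc k) f S"
proof -
  have "f' x v = frechet_derivative f (at x) v" if "x \<in> S" for x v
    using frechet_derivative_at[OF assms(2)[OF that]] by simp
  then have "Ck_on k (\<lambda>x. frechet_derivative f (at x) v) S" for v
    by (rule Ck_on_cong[OF assms(1) _ assms(3)])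
  then show ?thesis
    using assms(2) by (auto simp: differentiable_def)
qed

lemma Ck_on_Suc_has_derivative:
  "Ck_on (Suc k) f S \<Longrightarrow> x \<in> S \<Longrightarrow> (f has_derivative frechet_derivative f (at x)) (at x)"
  by (simp add: frechet_derivative_works[symmetric])

lemma Ck_on_SucD: "Ck_on (Suc k) f S \<Longrightarrow> Ck_on k f S"
proof (induction k arbitrary: f)
  case 0
  then show ?case
    by (simp add: continuous_at_imp_continuous_on differentiable_imp_continuous_within)
next
  case (Suc k)
  then show ?case by (metis Ck_on.simps(2))
qed

lemma Ck_on_subset: "Ck_on k f S \<Longrightarrow> T \<subseteq> S \<Longrightarrow> Ck_on k f T"
proof (induction k arbitrary: f)
  case 0
  then show ?case by (auto intro: continuous_on_subset)
next
  case (Suc k)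
  then show ?case by (auto)
qed

lemma Ck_on_local:
  assumes "\<And>x. x \<in> S \<Longrightarrow> \<exists>T. open T \<and> x \<in> T \<and> Ck_on k f T"
  shows "Ck_on k f S"
  using assms
proof (induction k arbitrary: f)
  case 0
  then show ?case
    unfolding Ck_on.simps(1)
    by (metis continuous_at_imp_continuous_on continuous_on_eq_continuous_at)
next
  case (Suc k)
  have "\<forall>x\<in>S. f differentiable (at x)"
    using Suc.prems by (metis Ck_on.simps(2))
  moreover have "Ck_on k (\<lambda>x. frechet_derivative f (at x) v) S" for v
  proof (rule Suc.IH)
    fix x assume "x \<in> S"
    then obtain T where "open T" "x \<in> T" "Ck_on (Suc k) f T"
      using Suc.prems by blast
    then show "\<exists>T. open T \<and> x \<in> T \<and> Ck_on k (\<lambda>x. frechet_derivative f (at x) v) T"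
      by auto
  qed
  ultimately show ?case by simp
qed

lemma Ck_on_const: "Ck_on k (\<lambda>x. c) S"
  by (induction k arbitrary: c) auto

lemma Ck_on_bounded_linear:
  assumes "bounded_linear h" "open S" "Ck_on k f S"
  shows "Ck_on k (\<lambda>x. h (f x)) S"
  using assms(3)
proof (induction k arbitrary: f)
  case 0
  then show ?case
    using linear_continuous_on_compose assms(1) bounded_linear.continuous_on by auto
next
  case (Suc k)
  show ?case
  proof (rule Ck_on_SucI[OF assms(2)])
    show "((\<lambda>x. h (f x)) has_derivative (\<lambda>v. h (frechet_derivative f (at x) v))) (at x)" if "x \<in> S" for x
      using bounded_linear.has_derivative[OF assms(1) Ck_on_Suc_has_derivative[OF Suc.prems that]] .
    show "Ck_on k (\<lambda>x. h (frechet_derivative f (at x) v)) S" for v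
      using Suc by simp
  qed
qed

lemma Ck_on_add:
  assumes "open S" "Ck_on k f S" "Ck_on k g S"
  shows "Ck_on k (\<lambda>x. f x + g x) S"
  using assms(2,3)
proof (induction k arbitrary: f g)
  case 0
  then show ?case by (auto intro: continuous_intros)
next
  case (Suc k)
  show ?case
  proof (rule Ck_on_SucI[OF assms(1)])
    show "((\<lambda>x. f x + g x) has_derivative
       (\<lambda>v. frechet_derivative f (at x) v + frechet_derivative g (at x) v)) (at x)" if "x \<in> S" for x
      using Ck_on_Suc_has_derivative[OF Suc.prems(1) that] Ck_on_Suc_has_derivative[OF Suc.prems(2) that]
      by (rule has_derivative_add)
  qed (use Suc in simp)
qed

lemma Ck_on_sum:
  assumes "open S" "\<And>i. i \<in> I \<Longrightarrow> Ck_on k (f i) S"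
  shows "Ck_on k (\<lambda>x. \<Sum>i\<in>I. f i x) S"
  using assms(2)
  by (induction I rule: infinite_finite_induct) (auto simp: Ck_on_const intro: Ck_on_add[OF assms(1)])

lemma (in bounded_bilinear) Ck_on:
  assumes "open S" "Ck_on k f S" "Ck_on k g S"
  shows "Ck_on k (\<lambda>x. prod (f x) (g x)) S"
  using assms(2,3)
proof (induction k arbitrary: f g)
  case 0
  then show ?case by (auto intro: continuous_on)
next
  case (Suc k)
  show ?case
  proof (rule Ck_on_SucI[OF assms(1)])
    show "((\<lambda>x. prod (f x) (g x)) has_derivative
       (\<lambda>v. prod (f x) (frechet_derivative g (at x) v) + prod (frechet_derivative f (at x) v) (g x))) (at x)"
      if "x \<in> S" for x
      using Ck_on_Suc_has_derivative[OF Suc.prems(1) that] Ck_on_Suc_has_derivative[OF Suc.prems(2) that]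
      by (rule FDERIV)
    show "Ck_on k (\<lambda>x. prod (f x) (frechet_derivative g (at x) v) + prod (frechet_derivative f (at x) v) (g x)) S" for v
      using Suc.prems Ck_on_SucD[OF Suc.prems(1)] Ck_on_SucD[OF Suc.prems(2)]
      by (intro Ck_on_add[OF assms(1)] Suc.IH) auto
  qed
qed

text \<open>The chain rule evaluates the derivative of \<open>f\<close> in a direction that varies
  with \<open>x\<close>, whereas \<open>Ck_on\<close> controls fixed directions only. Expanding the
  varying direction in \<open>Basis\<close> gives a finite sum of products, to which the induction
  applies.\<close>

lemma Ck_on_compose:
  fixes g :: "'a::euclidean_space \<Rightarrow> 'b::euclidean_space" and f :: "'b \<Rightarrow> 'c::real_normed_vector"
  assumes "open S" "open T" "g ` S \<subseteq> T" "Ck_on k g S" "Ck_on k f T"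
  shows "Ck_on k (\<lambda>x. f (g x)) S"
  using assms(4,5)
proof (induction k arbitrary: f)
  case 0
  then show ?case using assms(3) by (auto intro: continuous_on_compose2)
next
  case (Suc k)
  have df: "(f has_derivative frechet_derivative f (at (g x))) (at (g x))" if "x \<in> S" for x
    using Ck_on_Suc_has_derivative[OF Suc.prems(2)] assms(3) that by blast
  show ?case
  proof (rule Ck_on_SucI[OF assms(1)])
    fix x assume x: "x \<in> S"
    have d: "((\<lambda>x. f (g x)) has_derivative
       (\<lambda>v. frechet_derivative f (at (g x)) (frechet_derivative g (at x) v))) (at x)"
      using has_derivative_compose[OF Ck_on_Suc_has_derivative[OF Suc.prems(1) x] df[OF x]] .
    have e: "frechet_derivative f (at (g x)) w =
       (\<Sum>b\<in>Basis. (w \<bullet> b) *\<^sub>R frechet_derivative f (at (g x)) b)" for w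
    proof -
      have "frechet_derivative f (at (g x)) (\<Sum>b\<in>Basis. (w \<bullet> b) *\<^sub>R b) =
         (\<Sum>b\<in>Basis. (w \<bullet> b) *\<^sub>R frechet_derivative f (at (g x)) b)"
        unfolding linear_sum[OF has_derivative_linear[OF df[OF x]]]
        by (intro sum.cong refl linear_cmul[OF has_derivative_linear[OF df[OF x]]])
      then show ?thesis unfolding euclidean_representation .
    qed
    show "((\<lambda>x. f (g x)) has_derivative (\<lambda>v. \<Sum>b\<in>Basis. (frechet_derivative g (at x) v \<bullet> b) *\<^sub>R
        frechet_derivative f (at (g x)) b)) (at x)"
      by (rule has_derivative_eq_rhs[OF d]) (rule ext, rule e)
  next
    have "Ck_on k (\<lambda>x. frechet_derivative g (at x) v \<bullet> b) S" for v and b :: 'b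
      using Suc.prems(1) by (intro Ck_on_bounded_linear[OF bounded_linear_inner_left assms(1)]) auto
    moreover have "Ck_on k (\<lambda>x. frechet_derivative f (at (g x)) b) S" for b
      using Suc.prems Ck_on_SucD[OF Suc.prems(1)] by (intro Suc.IH) auto
    ultimately show "Ck_on k (\<lambda>x. \<Sum>b\<in>Basis. (frechet_derivative g (at x) v \<bullet> b) *\<^sub>R
        frechet_derivative f (at (g x)) b) S" for v
      by (intro Ck_on_sum[OF assms(1)] bounded_bilinear.Ck_on[OF bounded_bilinear_scaleR assms(1)])
  qed
qed

text \<open>The induction closes because the derivative of the inverse is a polynomial in the
  inverse itself and the derivative of \<open>f\<close>.\<close>

lemma Ck_on_inverse:
  fixes f :: "'a::euclidean_space \<Rightarrow> real"
  assumes "open S" "\<And>x. x \<in> S \<Longrightarrow> f x \<noteq> 0" "Ck_on k f S"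
  shows "Ck_on k (\<lambda>x. inverse (f x)) S"
  using assms(3)
proof (induction k)
  case 0
  then show ?case using assms(2) by (auto intro: continuous_intros)
next
  case (Suc k)
  have inv: "Ck_on k (\<lambda>x. inverse (f x)) S"
    using Suc Ck_on_SucD by blast
  show ?case
  proof (rule Ck_on_SucI[OF assms(1)])
    show "((\<lambda>x. inverse (f x)) has_derivative
       (\<lambda>v. - (inverse (f x) * frechet_derivative f (at x) v * inverse (f x)))) (at x)" if "x \<in> S" for x
      using Deriv.has_derivative_inverse[OF assms(2)[OF that] Ck_on_Suc_has_derivative[OF Suc.prems that]] .
    have "Ck_on k (\<lambda>x. (-1) * (inverse (f x) * frechet_derivative f (at x) v * inverse (f x))) S" for v
      using Suc.prems inv
      by (intro bounded_bilinear.Ck_on[OF bounded_bilinear_mult assms(1)] Ck_on_const) auto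
    then show "Ck_on k (\<lambda>x. - (inverse (f x) * frechet_derivative f (at x) v * inverse (f x))) S" for v
      by simp
  qed
qed

section \<open>Closure properties of smooth maps\<close>

named_theorems smooth_intros

lemma smooth_on_cong:
  "open S \<Longrightarrow> (\<And>x. x \<in> S \<Longrightarrow> f x = g x) \<Longrightarrow> smooth_on f S \<Longrightarrow> smooth_on g S"
  unfolding smooth_on_def by (rule allI, rule Ck_on_cong[of S f g]) auto

lemma smooth_on_subset: "smooth_on f S \<Longrightarrow> T \<subseteq> S \<Longrightarrow> smooth_on f T"
  unfolding smooth_on_def using Ck_on_subset by blast

lemma smooth_on_local:
  "(\<And>x. x \<in> S \<Longrightarrow> \<exists>T. open T \<and> x \<in> T \<and> smooth_on f T) \<Longrightarrow> smooth_on f S"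
  unfolding smooth_on_def by (intro allI Ck_on_local) blast

lemma smooth_on_const [smooth_intros]: "smooth_on (\<lambda>x. c) S"
  by (simp add: smooth_on_def Ck_on_const)

lemma smooth_on_bounded_linear:
  "bounded_linear h \<Longrightarrow> open S \<Longrightarrow> smooth_on f S \<Longrightarrow> smooth_on (\<lambda>x. h (f x)) S"
  unfolding smooth_on_def by (rule allI, rule Ck_on_bounded_linear[of h S _ f]) auto

lemma smooth_on_linear:
  assumes "bounded_linear h" "open S" shows "smooth_on h S"
proof -
  have "Ck_on k (\<lambda>x. x) S" for k
  proof (cases k)
    case (Suc k)
    show ?thesis
      unfolding Suc by (rule Ck_on_SucI[OF assms(2) has_derivative_ident]) (rule Ck_on_const)
  qed (simp add: continuous_on_id)
  then show ?thesis
    using Ck_on_bounded_linear[OF assms, of _ "\<lambda>x. x"] by (auto simp: smooth_on_def)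
qed

lemma smooth_on_ident [smooth_intros]: "open S \<Longrightarrow> smooth_on (\<lambda>x. x) S"
  by (rule smooth_on_linear[OF bounded_linear_ident])

lemma smooth_on_fst [smooth_intros]: "open S \<Longrightarrow> smooth_on f S \<Longrightarrow> smooth_on (\<lambda>x. fst (f x)) S"
  by (rule smooth_on_bounded_linear[OF bounded_linear_fst])

lemma smooth_on_snd [smooth_intros]: "open S \<Longrightarrow> smooth_on f S \<Longrightarrow> smooth_on (\<lambda>x. snd (f x)) S"
  by (rule smooth_on_bounded_linear[OF bounded_linear_snd])

lemma smooth_on_nth [smooth_intros]:
  "open S \<Longrightarrow> smooth_on f S \<Longrightarrow> smooth_on (\<lambda>x. f x $ i) S"
  by (rule smooth_on_bounded_linear[OF bounded_linear_vec_nth])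

lemma smooth_on_bilinear:
  "bounded_bilinear b \<Longrightarrow> open S \<Longrightarrow> smooth_on f S \<Longrightarrow> smooth_on g S \<Longrightarrow>
     smooth_on (\<lambda>x. b (f x) (g x)) S"
  unfolding smooth_on_def by (rule allI, rule bounded_bilinear.Ck_on[of b S _ f g]) auto

lemmas smooth_on_scaleR [smooth_intros] = smooth_on_bilinear[OF bounded_bilinear_scaleR]
lemmas smooth_on_mult [smooth_intros] = smooth_on_bilinear[OF bounded_bilinear_mult]

lemma smooth_on_add [smooth_intros]:
  "open S \<Longrightarrow> smooth_on f S \<Longrightarrow> smooth_on g S \<Longrightarrow> smooth_on (\<lambda>x. f x + g x) S"
  unfolding smooth_on_def by (rule allI, rule Ck_on_add[of S _ f g]) auto

lemma smooth_on_minus [smooth_intros]: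
  "open S \<Longrightarrow> smooth_on f S \<Longrightarrow> smooth_on (\<lambda>x. - f x) S"
  by (rule smooth_on_bounded_linear[OF bounded_linear_minus[OF bounded_linear_ident]])

lemma smooth_on_diff [smooth_intros]:
  "open S \<Longrightarrow> smooth_on f S \<Longrightarrow> smooth_on g S \<Longrightarrow> smooth_on (\<lambda>x. f x - g x) S"
  using smooth_on_add[of S f "\<lambda>x. - g x"] smooth_on_minus[of S g] by simp

lemma smooth_on_sum [smooth_intros]:
  "open S \<Longrightarrow> (\<And>i. i \<in> I \<Longrightarrow> smooth_on (f i) S) \<Longrightarrow> smooth_on (\<lambda>x. \<Sum>i\<in>I. f i x) S"
  unfolding smooth_on_def by (rule allI, rule Ck_on_sum) auto

lemma smooth_on_inverse [smooth_intros]: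
  fixes f :: "'a::euclidean_space \<Rightarrow> real"
  shows "open S \<Longrightarrow> smooth_on f S \<Longrightarrow> (\<And>x. x \<in> S \<Longrightarrow> f x \<noteq> 0) \<Longrightarrow> smooth_on (\<lambda>x. inverse (f x)) S"
  unfolding smooth_on_def by (rule allI, rule Ck_on_inverse) auto

lemma smooth_on_divide [smooth_intros]:
  fixes f :: "'a::euclidean_space \<Rightarrow> real"
  shows "open S \<Longrightarrow> smooth_on f S \<Longrightarrow> smooth_on g S \<Longrightarrow> (\<And>x. x \<in> S \<Longrightarrow> g x \<noteq> 0) \<Longrightarrow>
    smooth_on (\<lambda>x. f x / g x) S"
  unfolding divide_inverse by (intro smooth_intros)

lemma smooth_on_Pair [smooth_intros]:
  assumes "open S" "smooth_on f S" "smooth_on g S"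
  shows "smooth_on (\<lambda>x. (f x, g x)) S"
proof -
  have l: "bounded_linear (\<lambda>a. (a, 0))" "bounded_linear (\<lambda>b. (0, b))"
    by (intro bounded_linear_Pair bounded_linear_ident bounded_linear_zero)+
  have "smooth_on (\<lambda>x. (f x, 0) + (0, g x)) S"
    using assms smooth_on_bounded_linear[OF l(1)] smooth_on_bounded_linear[OF l(2)]
    by (intro smooth_on_add) auto
  then show ?thesis by simp
qed

lemma smooth_on_vec:
  fixes f :: "'a::euclidean_space \<Rightarrow> 'b::euclidean_space ^ 'n"
  assumes "open S" "\<And>i. smooth_on (\<lambda>x. f x $ i) S"
  shows "smooth_on f S"
proof -
  have l: "bounded_linear (axis i :: 'b \<Rightarrow> 'b ^ 'n)" for i
    by (rule linear_conv_bounded_linear[THEN iffD1], rule linearI) (auto simp: vec_eq_iff axis_def)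
  have "smooth_on (\<lambda>x. \<Sum>i\<in>UNIV. axis i (f x $ i)) S"
    using assms smooth_on_bounded_linear[OF l] by (intro smooth_on_sum) auto
  moreover have "(\<Sum>i\<in>UNIV. axis i (f x $ i)) = f x" for x
    by (simp add: vec_eq_iff axis_def)
  ultimately show ?thesis by simp
qed

lemma smooth_on_compose:
  fixes g :: "'a::euclidean_space \<Rightarrow> 'b::euclidean_space" and f :: "'b \<Rightarrow> 'c::real_normed_vector"
  shows "open S \<Longrightarrow> open T \<Longrightarrow> g ` S \<subseteq> T \<Longrightarrow> smooth_on g S \<Longrightarrow> smooth_on f T \<Longrightarrow> smooth_on (\<lambda>x. f (g x)) S"
  unfolding smooth_on_def by (rule allI, rule Ck_on_compose[of S T g]) auto

lemma smooth_on_has_derivative: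
  "smooth_on f S \<Longrightarrow> x \<in> S \<Longrightarrow> (f has_derivative frechet_derivative f (at x)) (at x)"
  unfolding smooth_on_def using Ck_on_Suc_has_derivative by blast

lemma smooth_on_continuous: "smooth_on f S \<Longrightarrow> continuous_on S f"
  unfolding smooth_on_def using Ck_on.simps(1) by blast

lemma smooth_on_frechet_derivative [smooth_intros]:
  "smooth_on f S \<Longrightarrow> smooth_on (\<lambda>x. frechet_derivative f (at x) v) S"
  unfolding smooth_on_def using Ck_on.simps(2) by blast

lemma smooth_on_D1 [smooth_intros]: "smooth_on f S \<Longrightarrow> smooth_on (\<lambda>x. D1 f x) S"
  unfolding D1_def by (rule smooth_on_frechet_derivative)

lemma smooth_on_D2 [smooth_intros]: "smooth_on f S \<Longrightarrow> smooth_on (\<lambda>x. D2 f x) S"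
  unfolding D2_def by (rule smooth_on_frechet_derivative)

lemma bounded_bilinear_mink: "bounded_bilinear mink"
proof -
  have "bilinear mink"
    by (auto simp: bilinear_def mink_def algebra_simps intro!: linearI)
  then show ?thesis by (simp add: bilinear_conv_bounded_bilinear)
qed

lemmas smooth_on_mink [smooth_intros] = smooth_on_bilinear[OF bounded_bilinear_mink]

lemma smooth_on_if_derivative_smooth:
  assumes "open S" "\<And>x. x \<in> S \<Longrightarrow> (f has_derivative f' x) (at x)" "\<And>v. smooth_on (\<lambda>x. f' x v) S"
  shows "smooth_on f S"
  unfolding smooth_on_def
proof
  fix k
  have "Ck_on (Suc k) f S"
    using assms by (intro Ck_on_SucI) (auto simp: smooth_on_def)
  then show "Ck_on k f S" by (rule Ck_on_SucD)
qed

subsection \<open>Partial derivatives\<close>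

lemma frechet_derivative_D1_D2:
  assumes "f differentiable (at x)"
  shows "frechet_derivative f (at x) w = fst w *\<^sub>R D1 f x + snd w *\<^sub>R D2 f x"
proof -
  have l: "linear (frechet_derivative f (at x))"
    using assms by (rule linear_frechet_derivative)
  have "w = fst w *\<^sub>R (1, 0) + snd w *\<^sub>R (0, 1)"
    by (simp add: prod_eq_iff)
  then have "frechet_derivative f (at x) w = frechet_derivative f (at x) (fst w *\<^sub>R (1, 0) + snd w *\<^sub>R (0, 1))"
    by (rule arg_cong)
  then show ?thesis
    unfolding D1_def D2_def linear_add[OF l] linear_cmul[OF l] .
qed

lemma has_derivative_D1: "(f has_derivative f') (at x) \<Longrightarrow> D1 f x = f' (1, 0)"
  and has_derivative_D2: "(f has_derivative f') (at x) \<Longrightarrow> D2 f x = f' (0, 1)"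
  unfolding D1_def D2_def by (simp_all add: frechet_derivative_at[symmetric])

lemma has_derivative_imp_partials:
  assumes "(f has_derivative f') (at (u, v))"
  shows "((\<lambda>s. f (s, v)) has_vector_derivative f' (1, 0)) (at u)"
    and "((\<lambda>s. f (u, s)) has_vector_derivative f' (0, 1)) (at v)"
proof -
  have l: "linear f'"
    using assms by (rule has_derivative_linear)
  have d: "((\<lambda>s. (s, v)) has_derivative (\<lambda>h. (h, 0))) (at u)"
    "((\<lambda>s. (u, s)) has_derivative (\<lambda>h. (0, h))) (at v)"
    by (auto intro!: derivative_eq_intros)
  have D: "((\<lambda>s. f (s, v)) has_derivative (\<lambda>h. f' (h, 0))) (at u)"
    and D':  "((\<lambda>s. f (u, s)) has_derivative (\<lambda>h. f' (0, h))) (at v)"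
    using has_derivative_compose[OF d(1) assms] has_derivative_compose[OF d(2) assms] by simp_all
  have E: "f' (h, 0) = h *\<^sub>R f' (1, 0)" and E': "f' (0, h) = h *\<^sub>R f' (0, 1)" for h
    using linear_cmul[OF l, of h "(1, 0)"] linear_cmul[OF l, of h "(0, 1)"] by simp_all
  show "((\<lambda>s. f (s, v)) has_vector_derivative f' (1, 0)) (at u)"
    unfolding has_vector_derivative_def by (rule has_derivative_eq_rhs[OF D]) (rule ext, rule E)
  show "((\<lambda>s. f (u, s)) has_vector_derivative f' (0, 1)) (at v)"
    unfolding has_vector_derivative_def by (rule has_derivative_eq_rhs[OF D']) (rule ext, rule E')
qed

lemma smooth_on_partials:
  assumes "smooth_on f S" "(u, v) \<in> S"
  shows "((\<lambda>s. f (s, v)) has_vector_derivative D1 f (u, v)) (at u)"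
    and "((\<lambda>s. f (u, s)) has_vector_derivative D2 f (u, v)) (at v)"
  unfolding D1_def D2_def by (rule has_derivative_imp_partials[OF smooth_on_has_derivative[OF assms]])+

lemma open_contains_rectangle:
  fixes S :: "(real \<times> real) set"
  assumes "open S" "(u, v) \<in> S"
  obtains e where "e > 0" "{u-e..u+e} \<times> {v-e..v+e} \<subseteq> S"
proof -
  obtain A B where AB: "open A" "open B" "(u, v) \<in> A \<times> B" "A \<times> B \<subseteq> S"
    using open_prod_elim[OF assms] by blast
  obtain a where a: "a > 0" "cball u a \<subseteq> A"
    using AB(1,3) unfolding open_contains_cball by blast
  obtain b where b: "b > 0" "cball v b \<subseteq> B"
    using AB(2,3) unfolding open_contains_cball by blast
  have "{u-min a b..u+min a b} \<times> {v-min a b..v+min a b} \<subseteq> cball u a \<times> cball v b"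
    by (auto simp: cball_eq_atLeastAtMost)
  also have "\<dots> \<subseteq> S"
    using a(2) b(2) AB(4) by blast
  finally show ?thesis
    using a(1) b(1) by (intro that[of "min a b"]) auto
qed

text \<open>Differentiating \<open>f (u, t) - f (u, v - e) = \<integral> D2 f (u, s) ds\<close> under the integral sign.\<close>

lemma D1_D2_commute:
  fixes f :: "real \<times> real \<Rightarrow> 'b::euclidean_space"
  assumes "open S" "smooth_on f S" "x \<in> S"
  shows "D1 (D2 f) x = D2 (D1 f) x"
proof -
  obtain u v where x: "x = (u, v)" by (cases x)
  obtain e where e: "e > 0" "{u-e..u+e} \<times> {v-e..v+e} \<subseteq> S"
    using open_contains_rectangle assms(1,3) x by metis
  have inS: "(a, b) \<in> S" if "a \<in> {u-e..u+e}" "b \<in> {v-e..v+e}" for a b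
    using e(2) that by blast
  note sm = smooth_on_D2[OF assms(2)] smooth_on_D1[OF assms(2)]
  have c: "continuous_on ({u-e..u+e} \<times> {v-e..v+e}) (D1 (D2 f))"
    using smooth_on_continuous[OF smooth_on_D1[OF sm(1)]] e(2) by (rule continuous_on_subset)
  have eq: "integral {v-e..t} (\<lambda>s. D1 (D2 f) (u, s)) = D1 f (u, t) - D1 f (u, v-e)"
    if t: "t \<in> {v-e..v+e}" for t
  proof -
    have "((\<lambda>u'. integral (cbox (v-e) t) (\<lambda>s. D2 f (u', s))) has_vector_derivative
        integral (cbox (v-e) t) (\<lambda>s. D1 (D2 f) (u, s))) (at u within {u-e..u+e})"
    proof (rule leibniz_rule_vector_derivative[where f = "\<lambda>u' s. D2 f (u', s)" and fx = "\<lambda>u' s. D1 (D2 f) (u', s)"])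
      show "((\<lambda>x. D2 f (x, s)) has_vector_derivative D1 (D2 f) (u', s)) (at u' within {u-e..u+e})"
        if "u' \<in> {u-e..u+e}" "s \<in> cbox (v-e) t" for u' s
        using that t by (intro has_vector_derivative_at_within[OF smooth_on_partials(1)[OF sm(1)]] inS) auto
      show "(\<lambda>s. D2 f (u', s)) integrable_on cbox (v-e) t" if "u' \<in> {u-e..u+e}" for u'
        using that t inS
        by (intro integrable_continuous continuous_on_compose2[OF smooth_on_continuous[OF sm(1)]] continuous_intros) auto
      show "continuous_on ({u-e..u+e} \<times> cbox (v-e) t) (\<lambda>(x, s). D1 (D2 f) (x, s))"
        using t by (auto intro: continuous_on_subset[OF c])
    qed (use e in auto)
    moreover have "((\<lambda>u'. integral (cbox (v-e) t) (\<lambda>s. D2 f (u', s))) has_vector_derivative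
        D1 f (u, t) - D1 f (u, v-e)) (at u within {u-e..u+e})"
    proof (rule has_vector_derivative_transform)
      show "((\<lambda>u'. f (u', t) - f (u', v-e)) has_vector_derivative D1 f (u, t) - D1 f (u, v-e)) (at u within {u-e..u+e})"
        using e(1) t
        by (intro has_vector_derivative_diff has_vector_derivative_at_within[OF smooth_on_partials(1)[OF assms(2)]] inS) auto
      show "integral (cbox (v-e) t) (\<lambda>s. D2 f (u', s)) = f (u', t) - f (u', v-e)" if "u' \<in> {u-e..u+e}" for u'
        unfolding cbox_interval using e(1) t that
        by (intro integral_unique fundamental_theorem_of_calculus
            has_vector_derivative_at_within[OF smooth_on_partials(2)[OF assms(2)]] inS) auto
    qed (use e in auto)
    ultimately have "integral (cbox (v-e) t) (\<lambda>s. D1 (D2 f) (u, s)) = D1 f (u, t) - D1 f (u, v-e)"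
      using e by (intro vector_derivative_unique_within_closed_interval[of "u-e" "u+e"]) auto
    then show ?thesis by simp
  qed
  have "((\<lambda>t. integral {v-e..t} (\<lambda>s. D1 (D2 f) (u, s))) has_vector_derivative D1 (D2 f) (u, v))
      (at v within {v-e..v+e})"
    using e by (intro integral_has_vector_derivative continuous_on_compose2[OF c] continuous_intros) auto
  moreover have "((\<lambda>t. integral {v-e..t} (\<lambda>s. D1 (D2 f) (u, s))) has_vector_derivative D2 (D1 f) (u, v))
      (at v within {v-e..v+e})"
  proof (rule has_vector_derivative_transform)
    show "((\<lambda>t. D1 f (u, t) - D1 f (u, v-e)) has_vector_derivative D2 (D1 f) (u, v)) (at v within {v-e..v+e})"
      by (rule has_vector_derivative_eq_rhs, rule has_vector_derivative_diff,
          rule has_vector_derivative_at_within[OF smooth_on_partials(2)[OF sm(2)]],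
          use assms(3) x in simp, rule has_vector_derivative_const, simp)
  next
    show "integral {v-e..t} (\<lambda>s. D1 (D2 f) (u, s)) = D1 f (u, t) - D1 f (u, v-e)" if "t \<in> {v-e..v+e}" for t
      using that by (rule eq)
  qed (use e in auto)
  ultimately show ?thesis
    using e x by (intro vector_derivative_unique_within_closed_interval[of "v-e" "v+e"]) auto
qed

subsection \<open>Linear ordinary differential equations\<close>

text \<open>A Gronwall estimate without exponentials. At the point of the interval where the norm is
  largest, the mean value inequality bounds this maximum by the initial norm plus \<open>d\<close>
  times (\<open>L\<close> times the maximum plus \<open>\<beta>\<close>). Solving for the maximum
  needs \<open>L * d < 1\<close>, which is why all intervals below are short. It works on both sides
  of \<open>t0\<close>.\<close>

lemma ode_bound:
  fixes x :: "real \<Rightarrow> 'a::real_normed_vector"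
  assumes deriv: "\<And>t. \<bar>t - t0\<bar> \<le> d \<Longrightarrow> (x has_vector_derivative x' t) (at t)"
    and bound: "\<And>t. \<bar>t - t0\<bar> \<le> d \<Longrightarrow> norm (x' t) \<le> L * norm (x t) + \<beta>"
    and L: "0 \<le> L" "L * d < 1" and "0 \<le> \<beta>" and t: "\<bar>t - t0\<bar> \<le> d"
  shows "norm (x t) \<le> (norm (x t0) + d * \<beta>) / (1 - L * d)"
proof -
  let ?J = "{t0-d..t0+d}"
  have d: "0 \<le> d" using t by linarith
  have J: "s \<in> ?J \<longleftrightarrow> \<bar>s - t0\<bar> \<le> d" for s by auto
  have "continuous_on ?J x"
    using deriv unfolding J[symmetric]
    by (meson continuous_at_imp_continuous_on has_vector_derivative_continuous)
  then obtain s where s: "s \<in> ?J" "\<And>r. r \<in> ?J \<Longrightarrow> norm (x r) \<le> norm (x s)"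
    using continuous_attains_sup[of ?J "\<lambda>r. norm (x r)"] d continuous_on_norm[of ?J x] by fastforce
  have "norm (x s - x t0) \<le> (L * norm (x s) + \<beta>) * norm (s - t0)"
  proof (rule differentiable_bound[of ?J x "\<lambda>t h. h *\<^sub>R x' t"])
    show "(x has_derivative (\<lambda>h. h *\<^sub>R x' r)) (at r within ?J)" if "r \<in> ?J" for r
      using deriv that J has_derivative_at_withinI unfolding has_vector_derivative_def by blast
    show "onorm (\<lambda>h. h *\<^sub>R x' r) \<le> L * norm (x s) + \<beta>" if r: "r \<in> ?J" for r
    proof (rule onorm_le)
      fix h :: real
      have "norm (x' r) \<le> L * norm (x s) + \<beta>"
        using bound[of r] r J mult_left_mono[OF s(2)[OF r] L(1)] by force
      then show "norm (h *\<^sub>R x' r) \<le> (L * norm (x s) + \<beta>) * norm h"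
        by (simp add: mult.commute mult_left_mono)
    qed
  qed (use s d in auto)
  also have "\<dots> \<le> (L * norm (x s) + \<beta>) * d"
    using s(1) J assms by (intro mult_left_mono) auto
  finally have "norm (x s) - norm (x t0) \<le> (L * norm (x s) + \<beta>) * d"
    using norm_triangle_ineq2[of "x s" "x t0"] by linarith
  then have "norm (x s) * (1 - L * d) \<le> norm (x t0) + d * \<beta>"
    by (simp add: algebra_simps)
  then have "norm (x s) \<le> (norm (x t0) + d * \<beta>) / (1 - L * d)"
    using L by (simp add: pos_le_divide_eq)
  then show ?thesis
    using s(2)[of t] t J by force
qed

text \<open>Along a short segment \<open>Z\<close> satisfies a differential inequality whose growth
  is bounded by the norm of \<open>Z\<close> itself, so \<open>ode_bound\<close>, started at a zero,
  yields zero again. Zeros therefore fill small balls, and connectedness does the rest.\<close>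

lemma zero_propagation:
  fixes Z :: "'a::real_normed_vector \<Rightarrow> 'b::real_normed_vector"
  assumes "connected W" "x0 \<in> W" "Z x0 = 0" "x1 \<in> W"
    and loc: "\<And>x. x \<in> W \<Longrightarrow> \<exists>r>0. \<exists>L. ball x r \<subseteq> W \<and>
      (\<forall>y\<in>ball x r. (Z has_derivative Z' y) (at y) \<and> (\<forall>w. norm (Z' y w) \<le> L * norm w * norm (Z y)))"
  shows "Z x1 = 0"
proof (rule connected_induction_simple[where P = "\<lambda>x. Z x = 0", OF assms(1,2,4,3)])
  fix x assume "x \<in> W"
  then obtain r L0 where r: "r > 0" "ball x r \<subseteq> W"
    and Z: "\<And>y. y \<in> ball x r \<Longrightarrow> (Z has_derivative Z' y) (at y)"
    and L0: "\<And>y w. y \<in> ball x r \<Longrightarrow> norm (Z' y w) \<le> L0 * norm w * norm (Z y)"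
    using loc by metis
  define L where "L = max L0 1"
  have L: "norm (Z' y w) \<le> L * norm w * norm (Z y)" if "y \<in> ball x r" for y w
    using L0[OF that, of w] mult_right_mono[of L0 L "norm w * norm (Z y)"] by (simp add: L_def mult.assoc)
  have Lpos: "L > 0" by (simp add: L_def)
  \<comment> \<open>The segment between two points of \<open>ball x e\<close>, run over parameters
    from -1 to 1 because \<open>ode_bound\<close> is two-sided, stays within 3 e <= r of
    \<open>x\<close>. Its velocity is at most 2 e, so the growth rate along it is at most 2 e L <=
    1/2.\<close>
  define e where "e = min (r/3) (1 / (4 * L))"
  have e: "e > 0" "e \<le> r/3" "e * L \<le> 1/4"
    using r(1) Lpos by (auto simp: e_def min_def field_simps)
  have "Z z = 0" if yz: "y \<in> ball x e" "z \<in> ball x e" "Z y = 0" for y z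
  proof -
    define p where "p t = y + t *\<^sub>R (z - y)" for t :: real
    have n: "norm (z - y) \<le> 2 * e"
      using yz(1,2) norm_triangle_ineq4[of "z - x" "y - x"] by (simp add: dist_norm norm_minus_commute)
    have p: "p t \<in> ball x r" if "\<bar>t\<bar> \<le> 1" for t
    proof -
      have "dist x (p t) \<le> dist x y + \<bar>t\<bar> * norm (z - y)"
        unfolding p_def dist_norm using norm_triangle_ineq4[of "x - y" "t *\<^sub>R (z - y)"]
        by (simp add: diff_diff_eq)
      also have "\<bar>t\<bar> * norm (z - y) \<le> 2 * e"
        using mult_mono[OF that n] e by simp
      finally show ?thesis using yz(1) e by simp
    qed
    have dp: "(p has_vector_derivative (z - y)) (at t)" for t
      unfolding p_def by (auto intro!: derivative_eq_intros)
    have "norm ((Z \<circ> p) 1) \<le> (norm ((Z \<circ> p) 0) + 1 * 0) / (1 - (1/2) * 1)"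
    proof (rule ode_bound[where x' = "\<lambda>t. Z' (p t) (z - y)"])
      fix t :: real assume "\<bar>t - 0\<bar> \<le> 1"
      then have pt: "p t \<in> ball x r" using p by simp
      show "((Z \<circ> p) has_vector_derivative Z' (p t) (z - y)) (at t)"
        using vector_derivative_diff_chain_within[OF dp[of t] has_derivative_at_withinI[OF Z[OF pt]]] by simp
      have "L * norm (z - y) \<le> L * (2 * e)"
        using Lpos by (intro mult_left_mono n) simp
      then have "L * norm (z - y) \<le> 1/2"
        using e(3) by (simp add: algebra_simps)
      then have "L * norm (z - y) * norm (Z (p t)) \<le> 1/2 * norm (Z (p t))"
        by (rule mult_right_mono) simp
      then show "norm (Z' (p t) (z - y)) \<le> 1/2 * norm ((Z \<circ> p) t) + 0"
        using L[OF pt, of "z - y"] by simp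
    qed auto
    then show ?thesis using yz(3) by (simp add: p_def)
  qed
  moreover have "ball x e \<subseteq> W"
    using r(2) e(1,2) by (auto simp: subset_iff)
  ultimately show "\<exists>T. openin (top_of_set W) T \<and> x \<in> T \<and> (\<forall>y\<in>T. \<forall>z\<in>T. Z y = 0 \<longrightarrow> Z z = 0)"
    using e(1) by (intro exI[of _ "ball x e"] conjI open_subset ballI impI) (simp, simp, simp, blast)
qed

lemma zero_propagation_partials:
  fixes Z :: "real \<times> real \<Rightarrow> 'b::real_normed_vector"
  assumes "open W" "connected W" "x0 \<in> W" "Z x0 = 0" "x1 \<in> W"
    and Z: "\<And>x. x \<in> W \<Longrightarrow> Z differentiable (at x)"
    and L: "continuous_on W L"
    and b: "\<And>x. x \<in> W \<Longrightarrow> norm (D1 Z x) \<le> L x * norm (Z x)" "\<And>x. x \<in> W \<Longrightarrow> norm (D2 Z x) \<le> L x * norm (Z x)"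
  shows "Z x1 = 0"
proof (rule zero_propagation[of W x0 Z x1 "\<lambda>x. frechet_derivative Z (at x)"])
  fix x assume x: "x \<in> W"
  have "\<exists>d>0. \<forall>y\<in>W. dist y x < d \<longrightarrow> dist (L y) (L x) < 1"
    using L x unfolding continuous_on_iff by (meson zero_less_one)
  then obtain d where d: "d > 0" "\<And>y. y \<in> W \<Longrightarrow> dist y x < d \<Longrightarrow> dist (L y) (L x) < 1" by blast
  obtain e where e: "e > 0" "ball x e \<subseteq> W"
    using assms(1) x by (meson openE)
  \<comment> \<open>By continuity \<open>L\<close> exceeds its value at \<open>x\<close> by less
    than 1 nearby; the factor 2 counts the two partial derivatives.\<close>
  have "norm (frechet_derivative Z (at y) w) \<le> (2 * (\<bar>L x\<bar> + 1)) * norm w * norm (Z y)"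
    if y: "y \<in> ball x (min d e)" for y w
  proof -
    have yW: "y \<in> W" using y e by auto
    have "L y \<le> \<bar>L x\<bar> + 1"
      using d(2)[OF yW] y by (auto simp: dist_commute dist_real_def)
    then have "L y * norm (Z y) \<le> (\<bar>L x\<bar> + 1) * norm (Z y)"
      by (rule mult_right_mono) simp
    then have D: "norm (D1 Z y) \<le> (\<bar>L x\<bar> + 1) * norm (Z y)" "norm (D2 Z y) \<le> (\<bar>L x\<bar> + 1) * norm (Z y)"
      using b[OF yW] by linarith+
    have "norm (frechet_derivative Z (at y) w) \<le> \<bar>fst w\<bar> * norm (D1 Z y) + \<bar>snd w\<bar> * norm (D2 Z y)"
      unfolding frechet_derivative_D1_D2[OF Z[OF yW]] using norm_triangle_ineq by (metis norm_scaleR real_norm_def)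
    also have "\<dots> \<le> norm w * ((\<bar>L x\<bar> + 1) * norm (Z y)) + norm w * ((\<bar>L x\<bar> + 1) * norm (Z y))"
      using D norm_fst_le[of "fst w" "snd w"] norm_snd_le[of "snd w" "fst w"] by (intro add_mono mult_mono) auto
    finally show ?thesis by (simp add: algebra_simps)
  qed
  then show "\<exists>r>0. \<exists>L. ball x r \<subseteq> W \<and>
      (\<forall>y\<in>ball x r. (Z has_derivative frechet_derivative Z (at y)) (at y) \<and>
        (\<forall>w. norm (frechet_derivative Z (at y) w) \<le> L * norm w * norm (Z y)))"
    using d(1) e Z
    by (intro exI[of _ "min d e"] conjI exI[of _ "2 * (\<bar>L x\<bar> + 1)"])
       (auto simp: subset_iff frechet_derivative_works[symmetric])
qed (use assms in auto)

lemma antiderivative_ball: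
  fixes f :: "real \<Rightarrow> 'a::banach"
  assumes f: "continuous_on (ball t0 d) f"
  shows "\<exists>F. F t0 = 0 \<and> (\<forall>t\<in>ball t0 d. (F has_vector_derivative f t) (at t))"
proof -
  \<comment> \<open>An oriented integral: on either side of \<open>t0\<close> one of the two
    intervals is empty, so the corresponding integral is 0.\<close>
  define F where "F t = integral {t0..t} f - integral {t..t0} f" for t
  have "F t0 = 0" by (simp add: F_def)
  moreover have "(F has_vector_derivative f t) (at t)" if t: "t \<in> ball t0 d" for t
  proof -
    define r where "r = (dist t0 t + d) / 2"
    have r: "dist t0 t < r" "r < d" using t by (auto simp: r_def)
    have "continuous_on {t0-r..t0+r} f"
      using f by (rule continuous_on_subset) (use r in \<open>auto simp: dist_real_def\<close>)
    then have int: "f integrable_on {a..b}" if "{a..b} \<subseteq> {t0-r..t0+r}" for a b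
      using that continuous_on_subset integrable_continuous_real by blast
    have F: "F s = integral {t0-r..s} f - integral {t0-r..t0} f" if "s \<in> {t0-r..t0+r}" for s
    proof (cases "t0 \<le> s")
      case True
      then have "integral {s..t0} f = 0" by (cases "s = t0") auto
      then show ?thesis
        using Henstock_Kurzweil_Integration.integral_combine[of "t0-r" t0 s f] int[of "t0-r" s] that True r zero_le_dist[of t0 t]
        by (simp add: F_def algebra_simps)
    next
      case False
      then have "integral {t0..s} f = 0" by auto
      then show ?thesis
        using Henstock_Kurzweil_Integration.integral_combine[of "t0-r" s t0 f] int[of "t0-r" t0] that False r
        by (simp add: F_def algebra_simps)
    qed
    have tr: "t \<in> {t0-r<..<t0+r}" using r by (auto simp: dist_real_def)
    have "((\<lambda>s. integral {t0-r..s} f - integral {t0-r..t0} f) has_vector_derivative f t - 0) (at t within {t0-r..t0+r})"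
      using tr by (intro has_vector_derivative_diff integral_has_vector_derivative has_vector_derivative_const
          \<open>continuous_on {t0-r..t0+r} f\<close>) auto
    then have "(F has_vector_derivative f t) (at t within {t0-r..t0+r})"
      using F tr by (intro has_vector_derivative_transform[of t _ F]) auto
    then show ?thesis
      using at_within_interior[of t "{t0-r..t0+r}"] tr by simp
  qed
  ultimately show ?thesis by blast
qed

text \<open>Picard iteration. As \<open>L * d < 1\<close>, successive differences shrink
  geometrically on each compact subinterval, so that the iterates and their derivatives converge
  uniformly there.\<close>

lemma linear_ode_exists:
  fixes m :: "'c::real_normed_vector \<Rightarrow> 'x::banach \<Rightarrow> 'x"
  assumes m: "bounded_bilinear m"
    and A: "continuous_on (ball t0 d) A" and b: "continuous_on (ball t0 d) b"
    and bound: "\<And>t x. t \<in> ball t0 d \<Longrightarrow> norm (m (A t) x) \<le> L * norm x"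
    and L: "0 \<le> L" "L * d < 1"
  shows "\<exists>x. x t0 = x0 \<and> (\<forall>t\<in>ball t0 d. (x has_vector_derivative m (A t) (x t) + b t) (at t))"
proof -
  interpret m: bounded_bilinear m by (rule m)
  obtain Anti where Anti: "\<And>f :: real \<Rightarrow> 'x. continuous_on (ball t0 d) f \<Longrightarrow>
      Anti f t0 = 0 \<and> (\<forall>t\<in>ball t0 d. (Anti f has_vector_derivative f t) (at t))"
    using antiderivative_ball[where ?'a = 'x] by metis
  define z where "z n = ((\<lambda>x t. x0 + Anti (\<lambda>s. m (A s) (x s) + b s) t) ^^ n) (\<lambda>_. x0)" for n
  have z0: "z 0 = (\<lambda>_. x0)"
    and zS: "z (Suc n) = (\<lambda>t. x0 + Anti (\<lambda>s. m (A s) (z n s) + b s) t)" for n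
    by (simp_all add: z_def)
  have zc: "continuous_on (ball t0 d) (z n)" and
    zd: "\<forall>t\<in>ball t0 d. (z (Suc n) has_vector_derivative m (A t) (z n t) + b t) (at t)" and
    zt: "z n t0 = x0" for n
  proof -
    have cf: "continuous_on (ball t0 d) (\<lambda>s. m (A s) (z n s) + b s)" if "continuous_on (ball t0 d) (z n)" for n
      by (intro continuous_on_add m.continuous_on A b that)
    have *: "(z (Suc n) has_vector_derivative m (A t) (z n t) + b t) (at t)"
      if "continuous_on (ball t0 d) (z n)" "t \<in> ball t0 d" for n t
    proof -
      have "((\<lambda>t. x0 + Anti (\<lambda>s. m (A s) (z n s) + b s) t) has_vector_derivative 0 + (m (A t) (z n t) + b t)) (at t)"
        by (intro has_vector_derivative_add has_vector_derivative_const)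
           (use Anti[OF cf[OF that(1)]] that(2) in auto)
      then show ?thesis unfolding zS by simp
    qed
    have c: "continuous_on (ball t0 d) (z n)" for n
    proof (induction n)
      case (Suc n)
      show ?case
        using *[OF Suc] by (meson continuous_at_imp_continuous_on has_vector_derivative_continuous)
    qed (simp add: z0)
    then show "continuous_on (ball t0 d) (z n)"
      "\<forall>t\<in>ball t0 d. (z (Suc n) has_vector_derivative m (A t) (z n t) + b t) (at t)" using * by auto
    show "z n t0 = x0"
      using Anti[OF cf[OF c]] by (cases n) (auto simp: z0 zS)
  qed
  define x where "x t = x0 + (\<Sum>i. z (Suc i) t - z i t)" for t
  have telescope: "z n t = x0 + (\<Sum>i<n. z (Suc i) t - z i t)" for n t
    by (induction n) (auto simp: z0)
  have "x t0 = x0" by (simp add: x_def zt)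
  moreover have "(x has_vector_derivative m (A t) (x t) + b t) (at t)" if t: "t \<in> ball t0 d" for t
  proof -
    \<comment> \<open>A compact interval around \<open>t0\<close> that has \<open>t\<close> in its
      interior and still lies in the open domain.\<close>
    define r where "r = (dist t0 t + d) / 2"
    have r: "dist t0 t < r" "r < d" using t by (auto simp: r_def)
    have r0: "0 < r" using r zero_le_dist[of t0 t] by linarith
    let ?J = "cball t0 r"
    have J: "?J \<subseteq> ball t0 d" using r by auto
    have Jabs: "s \<in> ?J \<longleftrightarrow> \<bar>s - t0\<bar> \<le> r" for s by (auto simp: dist_real_def)
    have "continuous_on ?J (\<lambda>s. norm (z 1 s - z 0 s))"
      using zc J by (intro continuous_intros) (auto intro: continuous_on_subset)
    then have "bounded ((\<lambda>s. norm (z 1 s - z 0 s)) ` ?J)"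
      by (intro compact_imp_bounded compact_continuous_image) auto
    then obtain M where M0: "0 < M" "\<forall>y\<in>(\<lambda>s. norm (z 1 s - z 0 s)) ` ?J. norm y \<le> M"
      unfolding bounded_pos by blast
    then have M: "norm (z 1 s - z 0 s) \<le> M" if "s \<in> ?J" for s
      using bspec[OF M0(2) imageI[OF that]] by simp
    define q where "q = L * r"
    have q: "0 \<le> q" "q < 1"
      using L r r0 mult_left_mono[of r d L] by (auto simp: q_def)
    have geom: "\<forall>s\<in>?J. norm (z (Suc n) s - z n s) \<le> M * q ^ n" for n
    proof (induction n)
      case 0
      then show ?case using M by simp
    next
      case (Suc n)
      show ?case
      proof
        fix s assume s: "s \<in> ?J"
        \<comment> \<open>With growth rate 0, \<open>ode_bound\<close> is the plain mean value
          estimate; all the contraction comes from the inhomogeneous term.\<close>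
        have "norm (z (Suc (Suc n)) s - z (Suc n) s) \<le>
            (norm (z (Suc (Suc n)) t0 - z (Suc n) t0) + r * (L * (M * q ^ n))) / (1 - 0 * r)"
        proof (rule ode_bound)
          fix s' assume "\<bar>s' - t0\<bar> \<le> r"
          then have s': "s' \<in> ?J" "s' \<in> ball t0 d" using J Jabs by auto
          have "((\<lambda>s. z (Suc (Suc n)) s - z (Suc n) s) has_vector_derivative
              (m (A s') (z (Suc n) s') + b s') - (m (A s') (z n s') + b s')) (at s')"
            using zd s'(2) by (intro has_vector_derivative_diff) auto
          then show "((\<lambda>s. z (Suc (Suc n)) s - z (Suc n) s) has_vector_derivative
              m (A s') (z (Suc n) s' - z n s')) (at s')"
            by (simp add: m.diff_right)
          have "norm (m (A s') (z (Suc n) s' - z n s')) \<le> L * norm (z (Suc n) s' - z n s')"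
            by (rule bound[OF s'(2)])
          also have "\<dots> \<le> L * (M * q ^ n)"
            using Suc s' L by (intro mult_left_mono) auto
          finally show "norm (m (A s') (z (Suc n) s' - z n s')) \<le>
              0 * norm (z (Suc (Suc n)) s' - z (Suc n) s') + L * (M * q ^ n)" by simp
        qed (use s Jabs L M0(1) q in auto)
        then show "norm (z (Suc (Suc n)) s - z (Suc n) s) \<le> M * q ^ Suc n"
          by (simp add: zt q_def algebra_simps)
      qed
    qed
    have "uniform_limit ?J (\<lambda>n s. \<Sum>i<n. z (Suc i) s - z i s) (\<lambda>s. \<Sum>i. z (Suc i) s - z i s) sequentially"
      using geom q by (intro Weierstrass_m_test[of _ _ "\<lambda>n. M * q ^ n"] summable_mult summable_geometric) auto
    then have lim: "\<forall>\<^sub>F n in sequentially. \<forall>s\<in>?J. dist (z n s) (x s) < e" if "e > 0" for e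
    proof -
      have "dist (z n s) (x s) = dist (\<Sum>i<n. z (Suc i) s - z i s) (\<Sum>i. z (Suc i) s - z i s)" for n s
        unfolding x_def by (subst telescope) (simp add: dist_norm)
      then show ?thesis
        using \<open>uniform_limit ?J _ _ _\<close> that by (simp add: uniform_limit_iff)
    qed
    have lim_pt: "(\<lambda>n. z n s) \<longlonglongrightarrow> x s" if "s \<in> ?J" for s
      by (rule tendstoI, rule eventually_mono[OF lim]) (use that in auto)
    \<comment> \<open>The index is shifted because the derivative of an iterate is expressed by its
      predecessor.\<close>
    have "\<exists>g. \<forall>s\<in>?J. (\<lambda>n. z (Suc n) s) \<longlonglongrightarrow> g s \<and>
        (g has_derivative (\<lambda>h. h *\<^sub>R (m (A s) (x s) + b s))) (at s within ?J)"
    proof (rule has_derivative_sequence[where f' = "\<lambda>n s h. h *\<^sub>R (m (A s) (z n s) + b s)"])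
      show "(z (Suc n) has_derivative (\<lambda>h. h *\<^sub>R (m (A s) (z n s) + b s))) (at s within ?J)" if "s \<in> ?J" for n s
        using zd J that has_derivative_at_withinI unfolding has_vector_derivative_def by blast
      fix e :: real assume e: "e > 0"
      have "\<forall>\<^sub>F n in sequentially. \<forall>s\<in>?J. dist (z n s) (x s) < e / (L + 1)"
        using lim e L by simp
      then show "\<forall>\<^sub>F n in sequentially. \<forall>s\<in>?J. \<forall>h.
          norm (h *\<^sub>R (m (A s) (z n s) + b s) - h *\<^sub>R (m (A s) (x s) + b s)) \<le> e * norm h"
      proof eventually_elim
        case (elim n)
        show ?case
        proof (intro ballI allI)
          fix s and h :: real assume s: "s \<in> ?J"
          have "norm (m (A s) (z n s - x s)) \<le> L * norm (z n s - x s)"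
            using bound J s by blast
          also have "\<dots> \<le> L * (e / (L + 1))"
            using elim s L by (intro mult_left_mono) (auto simp: dist_norm intro: less_imp_le)
          also have "\<dots> \<le> e"
            using e L by (simp add: field_simps)
          finally have "norm (m (A s) (z n s - x s)) \<le> e" .
          then have "\<bar>h\<bar> * norm (m (A s) (z n s - x s)) \<le> \<bar>h\<bar> * e"
            by (rule mult_left_mono) simp
          then show "norm (h *\<^sub>R (m (A s) (z n s) + b s) - h *\<^sub>R (m (A s) (x s) + b s)) \<le> e * norm h"
            by (simp add: scaleR_diff_right[symmetric] m.diff_right[symmetric] mult.commute)
        qed
      qed
    qed (use lim_pt[of t0, THEN LIMSEQ_Suc] r0 in auto)
    then obtain g where g: "\<And>s. s \<in> ?J \<Longrightarrow> (\<lambda>n. z (Suc n) s) \<longlonglongrightarrow> g s"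
      "\<And>s. s \<in> ?J \<Longrightarrow> (g has_vector_derivative m (A s) (x s) + b s) (at s within ?J)"
      unfolding has_vector_derivative_def by blast
    have "g s = x s" if "s \<in> ?J" for s
      using LIMSEQ_unique[OF g(1)[OF that] LIMSEQ_Suc[OF lim_pt[OF that]]] .
    then have "(x has_vector_derivative m (A t) (x t) + b t) (at t within ?J)"
      using g(2)[of t] r by (intro has_vector_derivative_transform[of t ?J x g]) auto
    then show ?thesis
      using at_within_interior[of t ?J] r by (simp add: interior_cball)
  qed
  ultimately show ?thesis by blast
qed

section \<open>Smooth dependence of solutions on parameters\<close>

lemma linear_basis_expansion:
  assumes "linear f" shows "f w = (\<Sum>i\<in>Basis. (w \<bullet> i) *\<^sub>R f i)"
proof -
  have "f (\<Sum>i\<in>Basis. (w \<bullet> i) *\<^sub>R i) = (\<Sum>i\<in>Basis. (w \<bullet> i) *\<^sub>R f i)"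
    unfolding linear_sum[OF assms] by (intro sum.cong refl linear_cmul[OF assms])
  then show ?thesis unfolding euclidean_representation .
qed

text \<open>First-order expansion in \<open>p\<close> with a remainder uniform over the compact set
  \<open>J\<close>: by the tube lemma the derivatives near \<open>p0\<close> are close to those at
  \<open>p0\<close> for all \<open>s\<close> at once. It serves both the dependence of solutions on
  parameters and differentiation under an integral.\<close>

lemma uniform_differentiable:
  fixes f :: "'p::euclidean_space \<times> 's::topological_space \<Rightarrow> 'x::real_normed_vector"
  assumes "open P" "p0 \<in> P" "compact J"
    and der: "\<And>p s. p \<in> P \<Longrightarrow> s \<in> J \<Longrightarrow> ((\<lambda>p. f (p, s)) has_derivative f' p s) (at p)"
    and cont: "\<And>i. i \<in> Basis \<Longrightarrow> continuous_on (P \<times> J) (\<lambda>(p, s). f' p s i)"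
    and "\<epsilon> > 0"
  obtains \<delta> where "\<delta> > 0" "ball p0 \<delta> \<subseteq> P"
    "\<And>p s. p \<in> ball p0 \<delta> \<Longrightarrow> s \<in> J \<Longrightarrow> norm (f (p, s) - f (p0, s) - f' p0 s (p - p0)) \<le> \<epsilon> * norm (p - p0)"
proof -
  \<comment> \<open>The operator norm is estimated by the sum over the basis vectors, so each of
    them may contribute this share.\<close>
  define e where "e = \<epsilon> / DIM('p)"
  have e: "e > 0" "real DIM('p) * e = \<epsilon>" using assms(6) by (auto simp: e_def)
  have "\<exists>X. p0 \<in> X \<and> open X \<and> (\<forall>p\<in>X \<inter> P. \<forall>s\<in>J. dist (f' p s i) (f' p0 s i) \<le> e)" if "i \<in> Basis" for i
    using continuous_on_prod_compactE[OF cont[OF that] assms(3,2) e(1)] by (simp add: case_prod_unfold) metis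
  then obtain X where X: "\<And>i. i \<in> Basis \<Longrightarrow> p0 \<in> X i" "\<And>i. i \<in> Basis \<Longrightarrow> open (X i)"
    "\<And>i p s. i \<in> Basis \<Longrightarrow> p \<in> X i \<inter> P \<Longrightarrow> s \<in> J \<Longrightarrow> dist (f' p s i) (f' p0 s i) \<le> e"
    by metis
  have "open (P \<inter> (\<Inter>i\<in>Basis. X i))" "p0 \<in> P \<inter> (\<Inter>i\<in>Basis. X i)"
    using X assms(1,2) by (auto intro!: open_Int open_INT)
  then obtain \<delta> where \<delta>: "\<delta> > 0" "ball p0 \<delta> \<subseteq> P \<inter> (\<Inter>i\<in>Basis. X i)"
    by (rule openE)
  show ?thesis
  proof (rule that[OF \<delta>(1)])
    show "ball p0 \<delta> \<subseteq> P" using \<delta>(2) by blast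
    fix p s assume p: "p \<in> ball p0 \<delta>" and s: "s \<in> J"
    have lin: "linear (f' q s)" if "q \<in> ball p0 \<delta>" for q
      using der[OF _ s] that \<delta>(2) has_derivative_linear by blast
    have "norm (f (p, s) - f (p0, s) - f' p0 s (p - p0)) \<le> norm (p - p0) * \<epsilon>"
    proof (rule differentiable_bound_linearization[of p0 p "ball p0 \<delta>" "\<lambda>p. f (p, s)" "\<lambda>p. f' p s" p0])
      show "p0 + t *\<^sub>R (p - p0) \<in> ball p0 \<delta>" if "t \<in> {0..1}" for t
      proof -
        have "norm (t *\<^sub>R (p - p0)) \<le> norm (p - p0)"
          using that mult_right_mono[of t 1 "norm (p - p0)"] by simp
        then show ?thesis using p by (simp add: dist_norm norm_minus_commute)
      qed
      show "((\<lambda>p. f (p, s)) has_derivative f' q s) (at q within ball p0 \<delta>)" if "q \<in> ball p0 \<delta>" for q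
        using der[OF _ s] that \<delta>(2) by (blast intro: has_derivative_at_withinI)
      show "onorm (f' q s - f' p0 s) \<le> \<epsilon>" if q: "q \<in> ball p0 \<delta>" for q
      proof (rule onorm_le)
        fix w
        have "(f' q s - f' p0 s) w = (\<Sum>i\<in>Basis. (w \<bullet> i) *\<^sub>R (f' q s i - f' p0 s i))"
          using linear_basis_expansion[OF lin[OF q], of w] linear_basis_expansion[OF lin[of p0], of w] \<delta>(1)
          by (simp add: scaleR_diff_right sum_subtractf)
        also have "norm \<dots> \<le> (\<Sum>i\<in>(Basis::'p set). norm w * e)"
        proof (rule sum_norm_le)
          fix i :: 'p assume i: "i \<in> Basis"
          have "q \<in> X i \<inter> P" using q \<delta>(2) i by blast
          then have "norm (f' q s i - f' p0 s i) \<le> e"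
            using X(3)[OF i _ s, of q] by (simp add: dist_norm)
          then show "norm ((w \<bullet> i) *\<^sub>R (f' q s i - f' p0 s i)) \<le> norm w * e"
            using Basis_le_norm[OF i, of w] by (simp add: mult_mono)
        qed
        also have "\<dots> = \<epsilon> * norm w" using e(2) by (simp add: algebra_simps)
        finally show "norm ((f' q s - f' p0 s) w) \<le> \<epsilon> * norm w" .
      qed
    qed (use \<delta>(1) in simp)
    then show "norm (f (p, s) - f (p0, s) - f' p0 s (p - p0)) \<le> \<epsilon> * norm (p - p0)"
      by (simp add: mult.commute)
  qed
qed

text \<open>The equation X' = A X + b with parameter \<open>p\<close>. The action \<open>m\<close>
  is kept abstract so that matrices multiplying whole frames are an instance.\<close>

locale linear_ode =
  fixes m :: "'c::real_normed_vector \<Rightarrow> 'x::euclidean_space \<Rightarrow> 'x"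
    and P :: "'p::euclidean_space set" and t0 d L :: real
    and A :: "'p \<times> real \<Rightarrow> 'c"
  assumes bilinear: "bounded_bilinear m" and open_P: "open P"
    and A_bound: "\<And>p t x. p \<in> P \<Longrightarrow> t \<in> ball t0 d \<Longrightarrow> norm (m (A (p, t)) x) \<le> L * norm x"
    and L: "0 \<le> L" "L * d < 1"
begin

sublocale m: bounded_bilinear m by (rule bilinear)

text \<open>The inhomogeneity and the initial value are arguments, not locale parameters, because
  the derivatives of a solution in \<open>p\<close> solve an equation with the same \<open>A\<close>
  but with other data.\<close>

definition solves where
  "solves b x0 X \<longleftrightarrow> (\<forall>p\<in>P. X (p, t0) = x0 p \<and>
     (\<forall>t\<in>ball t0 d. ((\<lambda>t. X (p, t)) has_vector_derivative m (A (p, t)) (X (p, t)) + b (p, t)) (at t)))"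

lemma solvesD:
  assumes "solves b x0 X" "p \<in> P"
  shows "X (p, t0) = x0 p"
    and "t \<in> ball t0 d \<Longrightarrow> ((\<lambda>t. X (p, t)) has_vector_derivative m (A (p, t)) (X (p, t)) + b (p, t)) (at t)"
  using assms unfolding solves_def by auto

lemma solution_exists:
  assumes "continuous_on (P \<times> ball t0 d) A" "continuous_on (P \<times> ball t0 d) b"
  shows "\<exists>X. solves b x0 X"
proof -
  have "\<exists>x. x t0 = x0 p \<and> (\<forall>t\<in>ball t0 d. (x has_vector_derivative m (A (p, t)) (x t) + b (p, t)) (at t))"
    if "p \<in> P" for p
  proof (rule linear_ode_exists[OF bilinear _ _ A_bound[OF that] L])
    show "continuous_on (ball t0 d) (\<lambda>t. A (p, t))" "continuous_on (ball t0 d) (\<lambda>t. b (p, t))"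
      using that by (auto intro!: continuous_on_compose2[OF assms(1)] continuous_on_compose2[OF assms(2)]
          continuous_on_Pair continuous_on_const continuous_on_id)
  qed
  then obtain x where x: "\<And>p. p \<in> P \<Longrightarrow> x p t0 = x0 p \<and>
      (\<forall>t\<in>ball t0 d. (x p has_vector_derivative m (A (p, t)) (x p t) + b (p, t)) (at t))"
    by metis
  have "solves b x0 (\<lambda>(p, t). x p t)"
    unfolding solves_def using x by simp
  then show ?thesis by blast
qed

text \<open>To be applied to differences of solutions: continuity and differentiability in
  \<open>p\<close> both reduce to an equation for an error \<open>e\<close> whose inhomogeneity is
  small.\<close>

lemma perturbation_bound:
  assumes "p \<in> P" "0 \<le> r" "r < d" "0 \<le> \<beta>"
    and "\<And>s. s \<in> cball t0 r \<Longrightarrow> (e has_vector_derivative m (A (p, s)) (e s) + \<phi> s) (at s)"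
    and "\<And>s. s \<in> cball t0 r \<Longrightarrow> norm (\<phi> s) \<le> \<beta>"
    and "s \<in> cball t0 r"
  shows "norm (e s) \<le> (norm (e t0) + r * \<beta>) / (1 - L * r)"
proof (rule ode_bound)
  have cb: "s \<in> cball t0 r \<longleftrightarrow> \<bar>s - t0\<bar> \<le> r" for s by (auto simp: dist_real_def)
  fix s assume "\<bar>s - t0\<bar> \<le> r"
  then have s: "s \<in> cball t0 r" "s \<in> ball t0 d" using assms(3) by (auto simp: dist_real_def)
  show "(e has_vector_derivative m (A (p, s)) (e s) + \<phi> s) (at s)" by (rule assms(5)[OF s(1)])
  show "norm (m (A (p, s)) (e s) + \<phi> s) \<le> L * norm (e s) + \<beta>"
    using norm_triangle_ineq[of "m (A (p, s)) (e s)" "\<phi> s"] A_bound[OF assms(1) s(2), of "e s"] assms(6)[OF s(1)]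
    by linarith
next
  show "L * r < 1" using mult_left_mono[of r d L] assms(3) L by linarith
  show "\<bar>s - t0\<bar> \<le> r" using assms(7) by (auto simp: dist_real_def)
qed (use L assms in auto)

text \<open>The difference of the solutions for \<open>p\<close> and \<open>p0\<close> solves the
  equation with coefficient \<open>A\<close> at \<open>p\<close> and with an inhomogeneity that
  tends to 0 uniformly in time as \<open>p\<close> tends to \<open>p0\<close>.\<close>

lemma solution_continuous:
  assumes A: "continuous_on (P \<times> ball t0 d) A" and b: "continuous_on (P \<times> ball t0 d) b"
    and x0: "continuous_on P x0" and X: "solves b x0 X"
  shows "continuous_on (P \<times> ball t0 d) X"
proof (rule continuous_at_imp_continuous_on, rule ballI)
  fix y assume "y \<in> P \<times> ball t0 d"
  then obtain p0 t1 where y: "y = (p0, t1)" "p0 \<in> P" "t1 \<in> ball t0 d" by auto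
  define r where "r = (dist t0 t1 + d) / 2"
  have r: "dist t0 t1 < r" "r < d" using y by (auto simp: r_def)
  have r0: "0 < r" using r zero_le_dist[of t0 t1] by linarith
  have Lr: "L * r < 1" using mult_left_mono[of r d L] r L by linarith
  have J: "cball t0 r \<subseteq> ball t0 d" using r by auto
  have Xc: "continuous_on (ball t0 d) (\<lambda>t. X (p0, t))"
    using solvesD(2)[OF X y(2)] by (meson continuous_at_imp_continuous_on has_vector_derivative_continuous)
  \<comment> \<open>The solution inside is frozen at \<open>p0\<close>, so that
    \<open>\<psi>\<close> is continuous before anything is known about \<open>X\<close> as a
    function of \<open>p\<close>.\<close>
  define \<psi> where "\<psi> y = m (A y) (X (p0, snd y)) + b y" for y
  have \<psi>: "continuous_on (P \<times> cball t0 r) \<psi>"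
    unfolding \<psi>_def using J
    by (intro continuous_on_add m.continuous_on continuous_on_subset[OF A] continuous_on_subset[OF b]
        continuous_on_compose2[OF Xc] continuous_on_snd continuous_on_id) auto
  show "isCont X y"
    unfolding y(1) continuous_at
  proof (rule tendstoI)
    fix \<epsilon> :: real assume \<epsilon>: "\<epsilon> > 0"
    \<comment> \<open>Chosen so that \<open>perturbation_bound\<close>, with initial error and
      inhomogeneity both at most \<open>\<eta>\<close>, returns half of
      \<open>\<epsilon>\<close>.\<close>
    define \<eta> where "\<eta> = \<epsilon> / 2 * (1 - L * r) / (1 + r)"
    have \<eta>: "\<eta> > 0" using \<epsilon> Lr r0 by (simp add: \<eta>_def)
    obtain U where U: "p0 \<in> U" "open U" "\<forall>p\<in>U \<inter> P. \<forall>t\<in>cball t0 r. dist (\<psi> (p, t)) (\<psi> (p0, t)) \<le> \<eta>"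
      by (rule continuous_on_prod_compactE[OF \<psi> compact_cball y(2) \<eta>])
    obtain V where V: "p0 \<in> V" "open V" "\<forall>p\<in>V \<inter> P. dist (x0 p) (x0 p0) \<le> \<eta>"
    proof -
      have "isCont x0 p0" using x0 open_P y(2) by (simp add: continuous_on_eq_continuous_at)
      then have "\<forall>\<^sub>F p in nhds p0. dist (x0 p) (x0 p0) < \<eta>"
        using \<eta> by (simp add: tendstoD tendsto_at_iff_tendsto_nhds[symmetric] isCont_def)
      then show ?thesis using that unfolding eventually_nhds by (metis IntD1 less_imp_le)
    qed
    have unif: "dist (X (p, s)) (X (p0, s)) \<le> \<epsilon> / 2" if p: "p \<in> U \<inter> V \<inter> P" and s: "s \<in> cball t0 r" for p s
    proof -
      have pP: "p \<in> P" using p by simp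
      have "norm (X (p, s) - X (p0, s)) \<le> (norm (X (p, t0) - X (p0, t0)) + r * \<eta>) / (1 - L * r)"
      proof (rule perturbation_bound[OF pP _ r(2), of _ "\<lambda>s. X (p, s) - X (p0, s)" "\<lambda>s. \<psi> (p, s) - \<psi> (p0, s)"])
        fix s' assume s': "s' \<in> cball t0 r"
        then have "s' \<in> ball t0 d" using J by auto
        then have "((\<lambda>s. X (p, s) - X (p0, s)) has_vector_derivative
            (m (A (p, s')) (X (p, s')) + b (p, s')) - (m (A (p0, s')) (X (p0, s')) + b (p0, s'))) (at s')"
          by (intro has_vector_derivative_diff solvesD(2)[OF X] pP y(2))
        then show "((\<lambda>s. X (p, s) - X (p0, s)) has_vector_derivative
            m (A (p, s')) (X (p, s') - X (p0, s')) + (\<psi> (p, s') - \<psi> (p0, s'))) (at s')"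
          by (simp add: \<psi>_def m.diff_right algebra_simps)
        show "norm (\<psi> (p, s') - \<psi> (p0, s')) \<le> \<eta>"
          using U(3) p s' by (simp add: dist_norm)
      qed (use r0 \<eta> s in auto)
      also have "\<dots> \<le> (\<eta> + r * \<eta>) / (1 - L * r)"
        using V(3) p Lr solvesD(1)[OF X pP] solvesD(1)[OF X y(2)]
        by (intro divide_right_mono add_mono) (auto simp: dist_norm)
      also have "\<dots> = \<eta> * (1 + r) / (1 - L * r)"
        by (simp add: algebra_simps)
      also have "\<eta> * (1 + r) = \<epsilon> / 2 * (1 - L * r)"
        unfolding \<eta>_def using r0 by (subst nonzero_eq_divide_eq[symmetric]) auto
      also have "\<epsilon> / 2 * (1 - L * r) / (1 - L * r) = \<epsilon> / 2"
        using Lr by (intro nonzero_mult_div_cancel_right) simp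
      finally show ?thesis by (simp add: dist_norm)
    qed
    have "isCont (\<lambda>t. X (p0, t)) t1"
      using Xc y(3) by (simp add: continuous_on_eq_continuous_at)
    then have "((\<lambda>t. X (p0, t)) \<longlongrightarrow> X (p0, t1)) (nhds t1)"
      using tendsto_at_iff_tendsto_nhds[of "\<lambda>t. X (p0, t)" t1] by (simp add: isCont_def)
    then have "\<forall>\<^sub>F t in nhds t1. dist (X (p0, t)) (X (p0, t1)) < \<epsilon> / 2"
      by (rule tendstoD) (use \<epsilon> in simp)
    then obtain T where T: "open T" "t1 \<in> T" "\<And>t. t \<in> T \<Longrightarrow> dist (X (p0, t)) (X (p0, t1)) < \<epsilon> / 2"
      unfolding eventually_nhds by blast
    have "dist (X z) (X (p0, t1)) < \<epsilon>" if z: "z \<in> (U \<inter> V \<inter> P) \<times> (T \<inter> ball t0 r)" for z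
    proof -
      have "dist (X z) (X (p0, snd z)) \<le> \<epsilon> / 2" "dist (X (p0, snd z)) (X (p0, t1)) < \<epsilon> / 2"
        using unif[of "fst z" "snd z"] T(3)[of "snd z"] z by (auto simp: mem_Times_iff)
      then show ?thesis
        using dist_triangle[of "X z" "X (p0, t1)" "X (p0, snd z)"] by linarith
    qed
    moreover have "open ((U \<inter> V \<inter> P) \<times> (T \<inter> ball t0 r))" "(p0, t1) \<in> (U \<inter> V \<inter> P) \<times> (T \<inter> ball t0 r)"
      using U V T r y(2) open_P by (auto intro!: open_Times)
    ultimately show "\<forall>\<^sub>F z in at (p0, t1). dist (X z) (X (p0, t1)) < \<epsilon>"
      unfolding eventually_at_topological by blast
  qed
qed

lemma partial_has_derivative:
  assumes "(f has_derivative f') (at (p, s))"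
  shows "((\<lambda>p. f (p, s)) has_derivative (\<lambda>w. f' (w, 0))) (at p)"
proof -
  have d: "((\<lambda>p. (p, s)) has_derivative (\<lambda>w. (w, 0))) (at p)"
    by (auto intro!: derivative_eq_intros)
  show ?thesis by (rule has_derivative_compose[OF d assms])
qed

text \<open>The functions \<open>Y i\<close> solve the variational equation, obtained by formally
  differentiating the given one in direction \<open>i\<close>. The error of the resulting linear
  approximation again solves the linear equation, with an inhomogeneity that is of smaller order
  than the increment.\<close>

lemma solution_differentiable:
  assumes A: "Ck_on 1 A (P \<times> ball t0 d)" and b: "Ck_on 1 b (P \<times> ball t0 d)"
    and x0: "Ck_on 1 x0 P" and X: "solves b x0 X"
    and Y: "\<And>i. i \<in> Basis \<Longrightarrow> solves
      (\<lambda>y. m (frechet_derivative A (at y) (i, 0)) (X y) + frechet_derivative b (at y) (i, 0))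
      (\<lambda>p. frechet_derivative x0 (at p) i) (Y i)"
    and Yc: "\<And>i. i \<in> Basis \<Longrightarrow> continuous_on (P \<times> ball t0 d) (Y i)"
    and p0: "p0 \<in> P" and t1: "t1 \<in> ball t0 d"
  shows "((\<lambda>p. X (p, t1)) has_derivative (\<lambda>w. \<Sum>i\<in>Basis. (w \<bullet> i) *\<^sub>R Y i (p0, t1))) (at p0)"
proof -
  note CkD = Ck_on_Suc_has_derivative[of 0, folded One_nat_def]
  define r where "r = (dist t0 t1 + d) / 2"
  have r: "dist t0 t1 < r" "r < d" using t1 by (auto simp: r_def)
  have r0: "0 < r" using r zero_le_dist[of t0 t1] by linarith
  have Lr: "L * r < 1" using mult_left_mono[of r d L] r L by linarith
  let ?J = "cball t0 r"
  have J: "?J \<subseteq> ball t0 d" using r by auto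
  have sub: "P \<times> ?J \<subseteq> P \<times> ball t0 d" using J by auto
  have Ac: "continuous_on (P \<times> ball t0 d) A" and bc: "continuous_on (P \<times> ball t0 d) b"
    using Ck_on_SucD[OF A[unfolded One_nat_def]] Ck_on_SucD[OF b[unfolded One_nat_def]] by simp_all
  have Xc: "continuous_on (ball t0 d) (\<lambda>t. X (p0, t))"
    using solvesD(2)[OF X p0] by (meson continuous_at_imp_continuous_on has_vector_derivative_continuous)
  define YY where "YY w s = (\<Sum>i\<in>Basis. (w \<bullet> i) *\<^sub>R Y i (p0, s))" for w s
  obtain C where C: "C > 0" "\<And>s w. s \<in> ?J \<Longrightarrow> norm (YY w s) \<le> norm w * C"
  proof -
    have "continuous_on ?J (\<lambda>s. \<Sum>i\<in>Basis. norm (Y i (p0, s)))"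
      using J p0 by (intro continuous_on_sum continuous_on_norm continuous_on_compose2[OF Yc] continuous_on_Pair
          continuous_on_const continuous_on_id) auto
    then have "bounded ((\<lambda>s. \<Sum>i\<in>Basis. norm (Y i (p0, s))) ` ?J)"
      by (intro compact_imp_bounded compact_continuous_image) auto
    then obtain C where C: "C > 0" "\<forall>y\<in>(\<lambda>s. \<Sum>i\<in>Basis. norm (Y i (p0, s))) ` ?J. norm y \<le> C"
      unfolding bounded_pos by blast
    show ?thesis
    proof (rule that[OF C(1)])
      fix s w assume s: "s \<in> ?J"
      have "norm (YY w s) \<le> (\<Sum>i\<in>Basis. norm w * norm (Y i (p0, s)))"
        unfolding YY_def by (intro sum_norm_le) (simp add: mult_right_mono Basis_le_norm)
      also have "\<dots> = norm w * (\<Sum>i\<in>Basis. norm (Y i (p0, s)))"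
        by (simp add: sum_distrib_left)
      also have "\<dots> \<le> norm w * C"
        using bspec[OF C(2) imageI[OF s]] by (intro mult_left_mono) auto
      finally show "norm (YY w s) \<le> norm w * C" .
    qed
  qed
  obtain K where K: "K > 0" "\<And>a x. norm (m a x) \<le> norm a * norm x * K"
    using m.pos_bounded by blast
  define \<psi> where "\<psi> y = m (A y) (X (p0, snd y)) + b y" for y
  define \<psi>' where "\<psi>' p s w = m (frechet_derivative A (at (p, s)) (w, 0)) (X (p0, s))
      + frechet_derivative b (at (p, s)) (w, 0)" for p s w
  have \<psi>d: "((\<lambda>p. \<psi> (p, s)) has_derivative \<psi>' p s) (at p)" if "p \<in> P" "s \<in> ball t0 d" for p s
  proof -
    have "((\<lambda>p. m (A (p, s)) (X (p0, s)) + b (p, s)) has_derivative (\<lambda>w.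
        m (frechet_derivative A (at (p, s)) (w, 0)) (X (p0, s)) + frechet_derivative b (at (p, s)) (w, 0))) (at p)"
      using that by (intro has_derivative_add bounded_linear.has_derivative[OF m.bounded_linear_left]
          partial_has_derivative CkD[OF A] CkD[OF b]) auto
    then show ?thesis unfolding \<psi>_def \<psi>'_def by simp
  qed
  have \<psi>'c: "continuous_on (P \<times> ?J) (\<lambda>(p, s). \<psi>' p s i)" for i
  proof -
    have "continuous_on (P \<times> ?J) (\<lambda>y. m (frechet_derivative A (at y) (i, 0)) (X (p0, snd y))
        + frechet_derivative b (at y) (i, 0))"
      using A b J
      by (intro continuous_on_add m.continuous_on continuous_on_subset[OF _ sub]
          continuous_on_compose2[OF Xc] continuous_on_snd continuous_on_id) auto
    then show ?thesis unfolding \<psi>'_def by (simp add: case_prod_unfold)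
  qed
  have "\<exists>\<delta>>0. \<forall>p. norm (p - p0) < \<delta> \<longrightarrow> norm (X (p, t1) - X (p0, t1) - YY (p - p0) t1) \<le> \<epsilon> * norm (p - p0)"
    if \<epsilon>: "\<epsilon> > 0" for \<epsilon>
  proof -
    \<comment> \<open>Absorbs the constants of the final estimate: \<open>K\<close> bounds the
      bilinear map, \<open>C\<close> the candidates \<open>Y i\<close>.\<close>
    define \<eta> where "\<eta> = \<epsilon> * (1 - L * r) / (1 + r * (K * C + 1))"
    have pos: "1 + r * (K * C + 1) > 0"
      using r0 K C by (simp add: add_pos_pos)
    have \<eta>: "\<eta> > 0" using \<epsilon> Lr pos by (simp add: \<eta>_def)
    have \<eta>\<epsilon>: "\<eta> * (1 + r * (K * C + 1)) / (1 - L * r) = \<epsilon>"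
      using Lr pos by (simp add: \<eta>_def)
    obtain \<delta>1 where \<delta>1: "\<delta>1 > 0" "ball p0 \<delta>1 \<subseteq> P" "\<And>p s. p \<in> ball p0 \<delta>1 \<Longrightarrow> s \<in> ?J \<Longrightarrow>
        norm (\<psi> (p, s) - \<psi> (p0, s) - \<psi>' p0 s (p - p0)) \<le> \<eta> * norm (p - p0)"
      using uniform_differentiable[OF open_P p0 compact_cball[of t0 r], of \<psi> \<psi>' \<eta>] \<psi>d \<psi>'c \<eta> J by blast
    obtain U where U: "p0 \<in> U" "open U" "\<forall>p\<in>U \<inter> P. \<forall>t\<in>?J. dist (A (p, t)) (A (p0, t)) \<le> \<eta>"
      by (rule continuous_on_prod_compactE[OF continuous_on_subset[OF Ac sub] compact_cball p0 \<eta>])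
    obtain \<delta>2 where \<delta>2: "\<delta>2 > 0" "ball p0 \<delta>2 \<subseteq> U"
      using U by (meson openE)
    obtain \<delta>3 where \<delta>3: "\<delta>3 > 0" "\<And>p. norm (p - p0) < \<delta>3 \<Longrightarrow>
        norm (x0 p - x0 p0 - frechet_derivative x0 (at p0) (p - p0)) \<le> \<eta> * norm (p - p0)"
      using CkD[OF x0 p0] \<eta> unfolding has_derivative_at_alt by blast
    have "norm (X (p, t1) - X (p0, t1) - YY (p - p0) t1) \<le> \<epsilon> * norm (p - p0)"
      if p: "norm (p - p0) < min \<delta>1 (min \<delta>2 \<delta>3)" for p
    proof -
      define w where "w = p - p0"
      have pb: "p \<in> ball p0 \<delta>1" "p \<in> ball p0 \<delta>2" "norm (p - p0) < \<delta>3"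
        using p by (auto simp: dist_norm norm_minus_commute)
      have pP: "p \<in> P" using pb \<delta>1 by blast
      have pU: "p \<in> U \<inter> P" using pb \<delta>2 pP by blast
      define e where "e s = X (p, s) - X (p0, s) - YY w s" for s
      define \<phi> where "\<phi> s = m (A (p, s) - A (p0, s)) (YY w s) + (\<psi> (p, s) - \<psi> (p0, s) - \<psi>' p0 s w)" for s
      have "norm (e t1) \<le> (norm (e t0) + r * ((K * \<eta> * C + \<eta>) * norm w)) / (1 - L * r)"
      proof (rule perturbation_bound[OF pP _ r(2), where \<phi> = \<phi>])
        fix s assume s: "s \<in> ?J"
        then have sI: "s \<in> ball t0 d" using J by auto
        have lin: "linear (\<psi>' p0 s)"
          using \<psi>d[OF p0 sI] by (rule has_derivative_linear)
        have "(e has_vector_derivative (m (A (p, s)) (X (p, s)) + b (p, s)) - (m (A (p0, s)) (X (p0, s)) + b (p0, s))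
            - (\<Sum>i\<in>Basis. (w \<bullet> i) *\<^sub>R (m (A (p0, s)) (Y i (p0, s)) + \<psi>' p0 s i))) (at s)"
          unfolding e_def YY_def \<psi>'_def
          by (intro has_vector_derivative_diff has_vector_derivative_sum solvesD(2)[OF X] pP p0 sI
              bounded_linear.has_vector_derivative[OF bounded_linear_scaleR_right] solvesD(2)[OF Y])
        moreover have "(\<Sum>i\<in>Basis. (w \<bullet> i) *\<^sub>R (m (A (p0, s)) (Y i (p0, s)) + \<psi>' p0 s i)) =
            m (A (p0, s)) (YY w s) + \<psi>' p0 s w"
          unfolding YY_def linear_basis_expansion[OF lin, of w]
          by (simp add: m.sum_right m.scaleR_right scaleR_add_right sum.distrib)
        ultimately show "(e has_vector_derivative m (A (p, s)) (e s) + \<phi> s) (at s)"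
          unfolding \<phi>_def e_def \<psi>_def by (simp add: m.diff_left m.diff_right m.add_right algebra_simps)
        have "norm (m (A (p, s) - A (p0, s)) (YY w s)) \<le> norm (A (p, s) - A (p0, s)) * norm (YY w s) * K"
          by (rule K(2))
        also have "\<dots> \<le> \<eta> * (norm w * C) * K"
          using U(3) pU s C K(1) \<eta> by (intro mult_right_mono mult_mono) (auto simp: dist_norm)
        finally have "norm (\<phi> s) \<le> \<eta> * (norm w * C) * K + \<eta> * norm w"
          unfolding \<phi>_def using \<delta>1(3)[OF pb(1) s] norm_triangle_ineq add_mono order_trans
          unfolding w_def by blast
        then show "norm (\<phi> s) \<le> (K * \<eta> * C + \<eta>) * norm w"
          by (simp add: algebra_simps)
      next
        show "0 \<le> (K * \<eta> * C + \<eta>) * norm w" using K C \<eta> by simp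
      qed (use r0 r in auto)
      also have "norm (e t0) \<le> \<eta> * norm w"
      proof -
        have "linear (frechet_derivative x0 (at p0))"
          using CkD[OF x0 p0] by (rule has_derivative_linear)
        then have "YY w t0 = frechet_derivative x0 (at p0) w"
          unfolding YY_def using linear_basis_expansion[of "frechet_derivative x0 (at p0)" w] solvesD(1)[OF Y p0]
          by (simp cong: sum.cong)
        then show ?thesis
          using \<delta>3(2)[OF pb(3)] solvesD(1)[OF X pP] solvesD(1)[OF X p0] by (simp add: e_def w_def)
      qed
      finally have "norm (e t1) \<le> (\<eta> * norm w + r * ((K * \<eta> * C + \<eta>) * norm w)) / (1 - L * r)"
        using Lr by (simp add: divide_right_mono)
      also have "\<dots> = (\<eta> * (1 + r * (K * C + 1)) / (1 - L * r)) * norm w"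
        by (simp add: algebra_simps)
      finally show ?thesis
        unfolding \<eta>\<epsilon> by (simp add: e_def w_def)
    qed
    then show ?thesis
      using \<delta>1(1) \<delta>2(1) \<delta>3(1) by (intro exI[of _ "min \<delta>1 (min \<delta>2 \<delta>3)"]) auto
  qed
  moreover have "bounded_linear (\<lambda>w. YY w t1)"
    unfolding YY_def by (intro bounded_linear_sum bounded_linear_scaleR_const bounded_linear_inner_left)
  ultimately show ?thesis
    unfolding has_derivative_at_alt YY_def by blast
qed

text \<open>The variational equations contain \<open>X\<close> in their inhomogeneity, so the
  induction hypothesis is used twice: for \<open>X\<close>, which makes that inhomogeneity
  \<open>Ck_on\<close> of order \<open>k\<close>, and then for the \<open>Y i\<close>. The
  derivative in time is the right-hand side and has the same order.\<close>

lemma solution_Ck: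
  assumes "Ck_on k A (P \<times> ball t0 d)" "Ck_on k b (P \<times> ball t0 d)" "Ck_on k x0 P" "solves b x0 X"
  shows "Ck_on k X (P \<times> ball t0 d)"
  using assms
proof (induction k arbitrary: b x0 X)
  case 0
  then show ?case using solution_continuous by simp
next
  case (Suc k)
  let ?S = "P \<times> ball t0 d"
  have oS: "open ?S" using open_P by (simp add: open_Times)
  have down: "Ck_on j f S" if "Ck_on i f S" "j \<le> i" for i j f and S :: "'y::euclidean_space set"
    using that(2,1) by (induction rule: dec_induct) (blast dest: Ck_on_SucD)+
  note X = Suc.prems(4)
  have Xk: "Ck_on k X ?S"
    by (rule Suc.IH[OF Ck_on_SucD[OF Suc.prems(1)] Ck_on_SucD[OF Suc.prems(2)] Ck_on_SucD[OF Suc.prems(3)] X])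
  define bi where "bi i y = m (frechet_derivative A (at y) (i, 0)) (X y) + frechet_derivative b (at y) (i, 0)" for i y
  have bk: "Ck_on k (bi i) ?S" for i
    unfolding bi_def using Suc.prems(1,2) Xk by (intro Ck_on_add[OF oS] m.Ck_on[OF oS]) auto
  have Ac: "continuous_on ?S A" and bic: "continuous_on ?S (bi i)" for i
    using down[OF Suc.prems(1), of 0] down[OF bk, of 0] by auto
  have "\<exists>Y. solves (bi i) (\<lambda>p. frechet_derivative x0 (at p) i) Y" for i
    by (rule solution_exists[OF Ac bic])
  then obtain Y where Y: "\<And>i. solves (bi i) (\<lambda>p. frechet_derivative x0 (at p) i) (Y i)"
    by metis
  have Yk: "Ck_on k (Y i) ?S" for i
    using Suc.prems(3) by (intro Suc.IH[OF Ck_on_SucD[OF Suc.prems(1)] bk _ Y]) simp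
  have 1: "Ck_on 1 A ?S" "Ck_on 1 b ?S" "Ck_on 1 x0 P"
    using Suc.prems(1-3) by (auto intro: down[of "Suc k"] simp del: Ck_on.simps)
  define f where "f y = m (A y) (X y) + b y" for y
  have fk: "Ck_on k f ?S"
    unfolding f_def
    by (rule Ck_on_add[OF oS m.Ck_on[OF oS Ck_on_SucD[OF Suc.prems(1)] Xk] Ck_on_SucD[OF Suc.prems(2)]])
  show ?case
  proof (rule Ck_on_SucI[OF oS])
    show "(X has_derivative (\<lambda>w. (\<Sum>i\<in>Basis. (fst w \<bullet> i) *\<^sub>R Y i y) + snd w *\<^sub>R f y)) (at y)" if y: "y \<in> ?S" for y
    proof -
      obtain p t where pt: "y = (p, t)" "p \<in> P" "t \<in> ball t0 d" using y by auto
      \<comment> \<open>Total differentiability follows from the partial derivatives once the one in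
        time is continuous.\<close>
      have "((\<lambda>(p, t). X (p, t)) has_derivative
          (\<lambda>(w, s). (\<Sum>i\<in>Basis. (w \<bullet> i) *\<^sub>R Y i (p, t)) + blinfun_apply (blinfun_scaleR_left (f (p, t))) s))
          (at (p, t) within ?S)"
      proof (rule has_derivative_partialsI[where fy = "\<lambda>p t. blinfun_scaleR_left (f (p, t))"])
        have "((\<lambda>p. X (p, t)) has_derivative (\<lambda>w. \<Sum>i\<in>Basis. (w \<bullet> i) *\<^sub>R Y i (p, t))) (at p)"
          by (rule solution_differentiable[OF 1(1-3) X Y[unfolded bi_def] _ pt(2,3)])
             (use down[OF Yk, of 0] in simp)
        then show "((\<lambda>p. X (p, t)) has_derivative (\<lambda>w. \<Sum>i\<in>Basis. (w \<bullet> i) *\<^sub>R Y i (p, t))) (at p within P)"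
          by (rule has_derivative_at_withinI)
        show "((\<lambda>t. X (q, t)) has_derivative blinfun_apply (blinfun_scaleR_left (f (q, s)))) (at s within ball t0 d)"
          if "q \<in> P" "s \<in> ball t0 d" for q s
          using solvesD(2)[OF X that] has_derivative_at_withinI
          unfolding f_def has_vector_derivative_def blinfun_scaleR_left.rep_eq by blast
        have "continuous_on ?S (\<lambda>y. blinfun_scaleR_left (f y))"
          using down[OF fk, of 0] by (auto intro: bounded_linear.continuous_on[OF bounded_linear_blinfun_scaleR_left])
        then show "continuous (at (p, t) within ?S) (\<lambda>(p, t). blinfun_scaleR_left (f (p, t)))"
          using y pt(1) by (simp add: continuous_on_eq_continuous_within case_prod_unfold)
      qed (use pt in auto)
      then show ?thesis
        using at_within_open[OF y oS] pt(1) by (simp add: case_prod_unfold)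
    qed
    show "Ck_on k (\<lambda>y. (\<Sum>i\<in>Basis. (fst w \<bullet> i) *\<^sub>R Y i y) + snd w *\<^sub>R f y) ?S" for w
      using Yk fk by (intro Ck_on_add[OF oS] Ck_on_sum[OF oS] Ck_on_bounded_linear[OF bounded_linear_scaleR_right oS])
  qed
qed

lemma smooth_solution_exists:
  assumes "smooth_on A (P \<times> ball t0 d)" "smooth_on b (P \<times> ball t0 d)" "smooth_on x0 P"
  obtains X where "smooth_on X (P \<times> ball t0 d)" "solves b x0 X"
proof -
  obtain X where "solves b x0 X"
    using solution_exists[OF smooth_on_continuous[OF assms(1)] smooth_on_continuous[OF assms(2)]] by blast
  then show ?thesis
    using that solution_Ck assms unfolding smooth_on_def by blast
qed

end

subsection \<open>Rules for partial derivatives\<close>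

lemma D_cong:
  assumes "open S" "x \<in> S" "\<And>y. y \<in> S \<Longrightarrow> f y = g y"
  shows "D1 f x = D1 g x" "D2 f x = D2 g x"
  unfolding D1_def D2_def using frechet_derivative_cong_open[OF assms] by simp_all

lemma smooth_on_has_derivative_partials:
  assumes "smooth_on f S" "x \<in> S"
  shows "(f has_derivative (\<lambda>w. fst w *\<^sub>R D1 f x + snd w *\<^sub>R D2 f x)) (at x)"
  by (rule has_derivative_eq_rhs[OF smooth_on_has_derivative[OF assms]])
     (rule ext, rule frechet_derivative_D1_D2, rule differentiableI, rule smooth_on_has_derivative[OF assms])

lemma D_const [simp]: "D1 (\<lambda>x. c) x = 0" "D2 (\<lambda>x. c) x = 0"
  unfolding D1_def D2_def by simp_all

lemma D_add:
  assumes "smooth_on f S" "smooth_on g S" "x \<in> S"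
  shows "D1 (\<lambda>x. f x + g x) x = D1 f x + D1 g x" "D2 (\<lambda>x. f x + g x) x = D2 f x + D2 g x"
  by (simp_all only: D1_def D2_def frechet_derivative_at[OF has_derivative_add[OF smooth_on_has_derivative[OF assms(1,3)] smooth_on_has_derivative[OF assms(2,3)]], symmetric])

lemma D_diff:
  assumes "smooth_on f S" "smooth_on g S" "x \<in> S"
  shows "D1 (\<lambda>x. f x - g x) x = D1 f x - D1 g x" "D2 (\<lambda>x. f x - g x) x = D2 f x - D2 g x"
  by (simp_all only: D1_def D2_def frechet_derivative_at[OF has_derivative_diff[OF smooth_on_has_derivative[OF assms(1,3)] smooth_on_has_derivative[OF assms(2,3)]], symmetric])

lemma D_bilinear:
  assumes "bounded_bilinear b" "smooth_on f S" "smooth_on g S" "x \<in> S"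
  shows "D1 (\<lambda>x. b (f x) (g x)) x = b (f x) (D1 g x) + b (D1 f x) (g x)"
    "D2 (\<lambda>x. b (f x) (g x)) x = b (f x) (D2 g x) + b (D2 f x) (g x)"
  by (simp_all only: D1_def D2_def frechet_derivative_at[OF bounded_bilinear.FDERIV[OF assms(1) smooth_on_has_derivative[OF assms(2,4)] smooth_on_has_derivative[OF assms(3,4)]], symmetric])

lemmas D_mink = D_bilinear[OF bounded_bilinear_mink]
lemmas D_mult = D_bilinear[OF bounded_bilinear_mult]
lemmas D_scaleR = D_bilinear[OF bounded_bilinear_scaleR]

lemma D_linear:
  assumes "bounded_linear h" "smooth_on f S" "x \<in> S"
  shows "D1 (\<lambda>x. h (f x)) x = h (D1 f x)" "D2 (\<lambda>x. h (f x)) x = h (D2 f x)"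
  by (simp_all only: D1_def D2_def frechet_derivative_at[OF bounded_linear.has_derivative[OF assms(1) smooth_on_has_derivative[OF assms(2,3)]], symmetric])

subsection \<open>Completely integrable linear systems\<close>

text \<open>The overdetermined system X_u = U X, X_v = W X is solved along the line v = v0 and from
  there in the direction of v. The defect Z = X_u - U X vanishes on that line and, by flatness,
  satisfies Z_v = W Z, so it vanishes everywhere. The variable \<open>t\<close> is carried along as
  a parameter, which gives smoothness in all three variables.\<close>

lemma flat_system_solution:
  fixes m :: "'c::euclidean_space \<Rightarrow> 'x::euclidean_space \<Rightarrow> 'x"
    and U W :: "real \<times> real \<times> real \<Rightarrow> 'c" and T :: "real set" and u0 v0 d L :: real
  defines "B \<equiv> ball u0 d \<times> ball v0 d"
  assumes m: "bounded_bilinear m" and T: "open T"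
    and U: "smooth_on U (T \<times> B)" and W: "smooth_on W (T \<times> B)"
    and bU: "\<And>y \<xi>. y \<in> T \<times> B \<Longrightarrow> norm (m (U y) \<xi>) \<le> L * norm \<xi>"
    and bW: "\<And>y \<xi>. y \<in> T \<times> B \<Longrightarrow> norm (m (W y) \<xi>) \<le> L * norm \<xi>"
    and L: "0 \<le> L" "L * d < 1" and d: "0 < d"
    and flat: "\<And>t x \<xi>. t \<in> T \<Longrightarrow> x \<in> B \<Longrightarrow>
      m (D2 (\<lambda>x. U (t, x)) x) \<xi> + m (U (t, x)) (m (W (t, x)) \<xi>) =
      m (D1 (\<lambda>x. W (t, x)) x) \<xi> + m (W (t, x)) (m (U (t, x)) \<xi>)"
    and x0: "smooth_on x0 T"
  obtains X where "smooth_on X (T \<times> B)"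
    "\<And>t. t \<in> T \<Longrightarrow> X (t, u0, v0) = x0 t"
    "\<And>t x. t \<in> T \<Longrightarrow> x \<in> B \<Longrightarrow> D1 (\<lambda>x. X (t, x)) x = m (U (t, x)) (X (t, x))"
    "\<And>t x. t \<in> T \<Longrightarrow> x \<in> B \<Longrightarrow> D2 (\<lambda>x. X (t, x)) x = m (W (t, x)) (X (t, x))"
proof -
  interpret m: bounded_bilinear m by (rule m)
  have oB: "open B" unfolding B_def by (intro open_Times open_ball)
  have oTB: "open (T \<times> B)" using T oB by (rule open_Times)
  have c: "u0 \<in> ball u0 d" "v0 \<in> ball v0 d" using d by auto
  have TU: "open (T \<times> ball u0 d)" using T by (simp add: open_Times)
  have TUV: "open ((T \<times> ball u0 d) \<times> ball v0 d)" using TU by (simp add: open_Times)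
  interpret e1: linear_ode m T u0 d L "\<lambda>y. U (fst y, snd y, v0)"
    by unfold_locales (use m T bU L c in \<open>auto simp: B_def\<close>)
  \<comment> \<open>The second equation runs in v; both t and u are parameters for it, and the first
    solution is its initial value.\<close>
  interpret e2: linear_ode m "T \<times> ball u0 d" v0 d L "\<lambda>y. W (fst (fst y), snd (fst y), snd y)"
    by unfold_locales (use m TU bW L in \<open>auto simp: B_def\<close>)
  have U1: "smooth_on (\<lambda>y. U (fst y, snd y, v0)) (T \<times> ball u0 d)"
    by (rule smooth_on_compose[OF TU oTB _ _ U]) (use TU c in \<open>auto simp: B_def intro!: smooth_intros\<close>)
  have W2: "smooth_on (\<lambda>y. W (fst (fst y), snd (fst y), snd y)) ((T \<times> ball u0 d) \<times> ball v0 d)"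
    by (rule smooth_on_compose[OF TUV oTB _ _ W]) (use TUV in \<open>auto simp: B_def intro!: smooth_intros\<close>)
  obtain X1 where X1: "smooth_on X1 (T \<times> ball u0 d)" "e1.solves (\<lambda>_. 0) x0 X1"
    using e1.smooth_solution_exists[OF U1 smooth_on_const x0] by blast
  obtain X2 where X2: "smooth_on X2 ((T \<times> ball u0 d) \<times> ball v0 d)" "e2.solves (\<lambda>_. 0) X1 X2"
    using e2.smooth_solution_exists[OF W2 smooth_on_const X1(1)] by blast
  define X where "X y = X2 ((fst y, fst (snd y)), snd (snd y))" for y
  have X: "smooth_on X (T \<times> B)"
    unfolding X_def
    by (rule smooth_on_compose[OF oTB TUV _ _ X2(1)]) (use oTB in \<open>auto simp: B_def intro!: smooth_intros\<close>)
  have slice: "smooth_on (\<lambda>x. f (t, x)) B" if "smooth_on f (T \<times> B)" "t \<in> T"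
    for f :: "real \<times> real \<times> real \<Rightarrow> 'z::real_normed_vector" and t
    by (rule smooth_on_compose[OF oB oTB _ _ that(1)]) (use oB that(2) in \<open>auto intro!: smooth_intros\<close>)
  have X0: "X (t, u, v0) = X1 (t, u)" if "t \<in> T" "u \<in> ball u0 d" for t u
    using e2.solvesD(1)[OF X2(2), of "(t, u)"] that by (simp add: X_def)
  have XW: "D2 (\<lambda>x. X (t, x)) x = m (W (t, x)) (X (t, x))" if t: "t \<in> T" and x: "x \<in> B" for t x
  proof -
    obtain u v where uv: "x = (u, v)" "u \<in> ball u0 d" "v \<in> ball v0 d" using x by (auto simp: B_def)
    have "((\<lambda>s. X (t, u, s)) has_vector_derivative m (W (t, x)) (X (t, x))) (at v)"
      using e2.solvesD(2)[OF X2(2), of "(t, u)" v] t uv by (simp add: X_def)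
    moreover have "((\<lambda>s. X (t, u, s)) has_vector_derivative D2 (\<lambda>x. X (t, x)) (u, v)) (at v)"
      using smooth_on_partials(2)[OF slice[OF X t]] x uv(1) by simp
    ultimately show ?thesis using vector_derivative_unique_at uv(1) by blast
  qed
  have XU: "D1 (\<lambda>x. X (t, x)) x = m (U (t, x)) (X (t, x))" if t: "t \<in> T" and x: "x \<in> B" for t x
  proof -
    define Xt where "Xt = (\<lambda>x. X (t, x))"
    define Ut where "Ut = (\<lambda>x. U (t, x))"
    define Wt where "Wt = (\<lambda>x. W (t, x))"
    have sm: "smooth_on Xt B" "smooth_on Ut B" "smooth_on Wt B"
      unfolding Xt_def Ut_def Wt_def using slice X U W t by auto
    have flat': "m (D2 Ut x) \<xi> + m (Ut x) (m (Wt x) \<xi>) = m (D1 Wt x) \<xi> + m (Wt x) (m (Ut x) \<xi>)"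
      if "x \<in> B" for x \<xi>
      using flat[OF t that] by (simp add: Ut_def Wt_def)
    \<comment> \<open>The defect in the u-equation, which so far holds on the line v = v0
      only.\<close>
    define Z where "Z x = D1 Xt x - m (Ut x) (Xt x)" for x
    have sZ: "smooth_on Z B"
      unfolding Z_def using oB sm by (intro smooth_on_diff smooth_on_D1 smooth_on_bilinear[OF m])
    have DZ: "D2 Z x = m (Wt x) (Z x)" if x: "x \<in> B" for x
    proof -
      have e: "D2 Xt y = m (Wt y) (Xt y)" if "y \<in> B" for y
        using XW[OF t that] by (simp add: Xt_def Wt_def)
      have "D2 Z x = D2 (D1 Xt) x - (m (Ut x) (D2 Xt x) + m (D2 Ut x) (Xt x))"
        unfolding Z_def
        by (simp add: D_diff[OF smooth_on_D1[OF sm(1)] smooth_on_bilinear[OF m oB sm(2,1)] x] D_bilinear[OF m sm(2,1) x])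
      also have "D2 (D1 Xt) x = D1 (\<lambda>y. m (Wt y) (Xt y)) x"
        using D1_D2_commute[OF oB sm(1) x] D_cong(1)[OF oB x e] by simp
      also have "\<dots> = m (Wt x) (D1 Xt x) + m (D1 Wt x) (Xt x)"
        by (rule D_bilinear[OF m sm(3,1) x])
      finally show ?thesis
        using flat'[OF x, of "Xt x"] e[OF x] unfolding Z_def by (simp add: m.diff_right algebra_simps)
    qed
    obtain u v where uv: "x = (u, v)" "u \<in> ball u0 d" "v \<in> ball v0 d" using x by (auto simp: B_def)
    have Z0: "Z (u, v0) = 0"
    proof -
      have uB: "(u, v0) \<in> B" using uv c by (simp add: B_def)
      have e: "X1 (t, s) = Xt (s, v0)" if "s \<in> ball u0 d" for s
        using X0[OF t that] by (simp add: Xt_def)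
      have "((\<lambda>s. X1 (t, s)) has_vector_derivative m (Ut (u, v0)) (Xt (u, v0))) (at u)"
        using e1.solvesD(2)[OF X1(2) t uv(2)] by (simp add: Ut_def e[OF uv(2), symmetric])
      then have b: "((\<lambda>s. Xt (s, v0)) has_vector_derivative m (Ut (u, v0)) (Xt (u, v0))) (at u)"
        by (rule has_vector_derivative_transform_within_open[OF _ open_ball uv(2) e])
      then show ?thesis
        using vector_derivative_unique_at[OF smooth_on_partials(1)[OF sm(1) uB] b] by (simp add: Z_def)
    qed
    have r: "dist v0 v < d" using uv(3) by simp
    have "norm (Z (u, v)) \<le> (norm (Z (u, v0)) + dist v0 v * 0) / (1 - L * dist v0 v)"
    proof (rule ode_bound[where x = "\<lambda>s. Z (u, s)"])
      fix s assume "\<bar>s - v0\<bar> \<le> dist v0 v"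
      then have sB: "(u, s) \<in> B" using uv(2) r by (auto simp: B_def dist_real_def)
      show "((\<lambda>s. Z (u, s)) has_vector_derivative m (Wt (u, s)) (Z (u, s))) (at s)"
        using smooth_on_partials(2)[OF sZ sB] DZ[OF sB] by simp
      show "norm (m (Wt (u, s)) (Z (u, s))) \<le> L * norm (Z (u, s)) + 0"
        using bW[of "(t, u, s)"] t sB by (simp add: Wt_def)
    next
      show "L * dist v0 v < 1" using mult_left_mono[of "dist v0 v" d L] r L by linarith
    qed (use L in \<open>auto simp: dist_real_def\<close>)
    then have "Z x = 0" using Z0 uv(1) by simp
    then show ?thesis by (simp add: Z_def Xt_def Ut_def)
  qed
  have "X (t, u0, v0) = x0 t" if "t \<in> T" for t
    using X0[OF that c(1)] e1.solvesD(1)[OF X1(2) that] by simp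
  then show ?thesis using that[OF X _ XU XW] by blast
qed

subsection \<open>Closed forms on simply connected plane regions\<close>

text \<open>The Poincare lemma by radial integration: the primitive at p is the integral of
  \<theta>(s p) p over s from 0 to 1.\<close>

lemma closed_form_exact_convex:
  fixes \<theta> :: "'a::euclidean_space \<Rightarrow> 'a \<Rightarrow> 'b::banach"
  assumes S: "open S" "convex S" "0 \<in> S"
    and lin: "\<And>x. x \<in> S \<Longrightarrow> linear (\<theta> x)"
    and der: "\<And>x w. x \<in> S \<Longrightarrow> ((\<lambda>x. \<theta> x w) has_derivative \<theta>' x w) (at x)"
    and cont: "\<And>v w. continuous_on S (\<lambda>x. \<theta>' x w v)"
    and sym: "\<And>x v w. x \<in> S \<Longrightarrow> \<theta>' x w v = \<theta>' x v w"
  shows "\<exists>g. \<forall>x\<in>S. (g has_derivative \<theta> x) (at x)"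
proof -
  have inS: "s *\<^sub>R p \<in> S" if "p \<in> S" "s \<in> {0..1}" for p s
    using convexD[OF S(2) that(1) S(3), of s "1 - s"] that(2) by simp
  have \<theta>c: "continuous_on S (\<lambda>x. \<theta> x w)" for w
    using der by (meson has_derivative_continuous continuous_at_imp_continuous_on)
  have lin': "linear (\<theta>' x w)" if "x \<in> S" for x w
    using der[OF that] by (rule has_derivative_linear)
  define f where "f y = \<theta> (snd y *\<^sub>R fst y) (fst y)" for y :: "'a \<times> real"
  \<comment> \<open>The derivative of the integrand in \<open>p\<close>, after one use of
    \<open>sym\<close>. In this form it is the s-derivative of s \<theta>(s p) w, so its integral
    from 0 to 1 is \<theta> p w.\<close>
  define f' where "f' p s w = \<theta> (s *\<^sub>R p) w + s *\<^sub>R \<theta>' (s *\<^sub>R p) w p" for p s w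
  have fsum: "f (p, s) = (\<Sum>i\<in>Basis. (p \<bullet> i) *\<^sub>R \<theta> (s *\<^sub>R p) i)" if "p \<in> S" "s \<in> {0..1}" for p s
    unfolding f_def using linear_basis_expansion[OF lin[OF inS[OF that]], of p] by simp
  have fd: "((\<lambda>p. f (p, s)) has_derivative f' p s) (at p)" if p: "p \<in> S" and s: "s \<in> {0..1}" for p s
  proof -
    have sd: "((\<lambda>p. s *\<^sub>R p) has_derivative (\<lambda>w. s *\<^sub>R w)) (at p)"
      by (auto intro!: derivative_eq_intros)
    have i: "((\<lambda>p. \<theta> (s *\<^sub>R p) i) has_derivative (\<lambda>w. \<theta>' (s *\<^sub>R p) i (s *\<^sub>R w))) (at p)" for i
      by (rule has_derivative_compose[OF sd der[OF inS[OF p s], of i]])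
    have "((\<lambda>p. \<Sum>i\<in>Basis. (p \<bullet> i) *\<^sub>R \<theta> (s *\<^sub>R p) i) has_derivative
        (\<lambda>w. \<Sum>i\<in>Basis. (p \<bullet> i) *\<^sub>R \<theta>' (s *\<^sub>R p) i (s *\<^sub>R w) + (w \<bullet> i) *\<^sub>R \<theta> (s *\<^sub>R p) i)) (at p)"
      by (intro has_derivative_sum has_derivative_scaleR i has_derivative_inner_left has_derivative_ident)
    moreover have "(\<Sum>i\<in>Basis. (p \<bullet> i) *\<^sub>R \<theta>' (s *\<^sub>R p) i (s *\<^sub>R w) + (w \<bullet> i) *\<^sub>R \<theta> (s *\<^sub>R p) i) = f' p s w" for w
    proof -
      have sP: "s *\<^sub>R p \<in> S" using inS p s .
      have "(\<Sum>i\<in>Basis. (p \<bullet> i) *\<^sub>R \<theta>' (s *\<^sub>R p) i (s *\<^sub>R w)) = (\<Sum>i\<in>Basis. s *\<^sub>R ((p \<bullet> i) *\<^sub>R \<theta>' (s *\<^sub>R p) w i))"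
        using sym[OF sP] linear_cmul[OF lin'[OF sP]] by (intro sum.cong) (auto simp: algebra_simps)
      also have "\<dots> = s *\<^sub>R \<theta>' (s *\<^sub>R p) w p"
        unfolding linear_basis_expansion[OF lin'[OF sP, of w], of p] scaleR_sum_right by simp
      finally show ?thesis
        unfolding f'_def linear_basis_expansion[OF lin[OF sP], of w] by (simp add: sum.distrib)
    qed
    ultimately have D: "((\<lambda>p. \<Sum>i\<in>Basis. (p \<bullet> i) *\<^sub>R \<theta> (s *\<^sub>R p) i) has_derivative f' p s) (at p)"
      by simp
    show ?thesis
      by (rule has_derivative_transform_within_open[OF D S(1) p]) (use fsum s in auto)
  qed
  have f'c: "continuous_on (S \<times> {0..1}) (\<lambda>(p, s). f' p s i)" for i
  proof -
    have img: "(\<lambda>y. snd y *\<^sub>R fst y) ` (S \<times> {0..1}) \<subseteq> S" using inS by auto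
    have c: "continuous_on (S \<times> {0..1}) (\<lambda>y. snd y *\<^sub>R fst y)" by (intro continuous_intros)
    have "continuous_on (S \<times> {0..1}) (\<lambda>y. \<theta> (snd y *\<^sub>R fst y) i +
        snd y *\<^sub>R (\<Sum>j\<in>Basis. (fst y \<bullet> j) *\<^sub>R \<theta>' (snd y *\<^sub>R fst y) i j))"
      by (intro continuous_intros continuous_on_compose2[OF \<theta>c c img] continuous_on_compose2[OF cont c img])
    moreover have "f' p s i = \<theta> (s *\<^sub>R p) i + s *\<^sub>R (\<Sum>j\<in>Basis. (p \<bullet> j) *\<^sub>R \<theta>' (s *\<^sub>R p) i j)"
      if "p \<in> S" "s \<in> {0..1}" for p s
      unfolding f'_def using linear_basis_expansion[OF lin'[OF inS[OF that]], of i p] by simp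
    ultimately show ?thesis
      by (auto elim!: continuous_on_eq)
  qed
  have fi: "(\<lambda>s. f (p, s)) integrable_on {0..1}" if p: "p \<in> S" for p
  proof -
    have "continuous_on {0..1} (\<lambda>s. \<Sum>i\<in>Basis. (p \<bullet> i) *\<^sub>R \<theta> (s *\<^sub>R p) i)"
      using inS[OF p] by (intro continuous_intros continuous_on_compose2[OF \<theta>c]) auto
    then have "continuous_on {0..1} (\<lambda>s. f (p, s))"
      by (rule continuous_on_eq) (use fsum[OF p] in auto)
    then show ?thesis by (rule integrable_continuous_real)
  qed
  define g where "g p = integral {0..1} (\<lambda>s. f (p, s))" for p
  have "(g has_derivative \<theta> p0) (at p0)" if p0: "p0 \<in> S" for p0
    unfolding has_derivative_at_alt
  proof (intro conjI allI impI)
    show "bounded_linear (\<theta> p0)" using lin[OF p0] by (simp add: linear_conv_bounded_linear)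
    fix \<epsilon> :: real assume "\<epsilon> > 0"
    then obtain \<delta> where \<delta>: "\<delta> > 0" "ball p0 \<delta> \<subseteq> S" "\<And>p s. p \<in> ball p0 \<delta> \<Longrightarrow> s \<in> {0..1} \<Longrightarrow>
        norm (f (p, s) - f (p0, s) - f' p0 s (p - p0)) \<le> \<epsilon> * norm (p - p0)"
      using uniform_differentiable[OF S(1) p0 compact_Icc[of 0 1], of f f' \<epsilon>] fd f'c by blast
    have "norm (g p - g p0 - \<theta> p0 (p - p0)) \<le> \<epsilon> * norm (p - p0)" if p: "norm (p - p0) < \<delta>" for p
    proof -
      have pb: "p \<in> ball p0 \<delta>" using p by (simp add: dist_norm norm_minus_commute)
      have "((\<lambda>s. s *\<^sub>R \<theta> (s *\<^sub>R p0) (p - p0)) has_vector_derivative f' p0 s (p - p0)) (at s within {0..1})"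
        if s: "s \<in> {0..1}" for s
      proof -
        have sd: "((\<lambda>s. s *\<^sub>R p0) has_derivative (\<lambda>h. h *\<^sub>R p0)) (at s)"
          by (auto intro!: derivative_eq_intros)
        have "((\<lambda>s. \<theta> (s *\<^sub>R p0) (p - p0)) has_derivative (\<lambda>h. \<theta>' (s *\<^sub>R p0) (p - p0) (h *\<^sub>R p0))) (at s)"
          by (rule has_derivative_compose[OF sd der[OF inS[OF p0 s], of "p - p0"]])
        then have "((\<lambda>s. \<theta> (s *\<^sub>R p0) (p - p0)) has_vector_derivative \<theta>' (s *\<^sub>R p0) (p - p0) p0) (at s)"
          unfolding has_vector_derivative_def linear_cmul[OF lin'[OF inS[OF p0 s]]] .
        then have "((\<lambda>s. s *\<^sub>R \<theta> (s *\<^sub>R p0) (p - p0)) has_vector_derivative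
            s *\<^sub>R \<theta>' (s *\<^sub>R p0) (p - p0) p0 + 1 *\<^sub>R \<theta> (s *\<^sub>R p0) (p - p0)) (at s)"
          by (intro has_vector_derivative_scaleR) (auto intro!: derivative_eq_intros)
        then show ?thesis
          by (simp add: f'_def add.commute has_vector_derivative_at_within)
      qed
      then have "((\<lambda>s. f' p0 s (p - p0)) has_integral (1 *\<^sub>R \<theta> (1 *\<^sub>R p0) (p - p0) - 0 *\<^sub>R \<theta> (0 *\<^sub>R p0) (p - p0))) {0..1}"
        by (intro fundamental_theorem_of_calculus) auto
      then have "((\<lambda>s. f (p, s) - f (p0, s) - f' p0 s (p - p0)) has_integral (g p - g p0 - \<theta> p0 (p - p0))) {0..1}"
        using \<delta>(2) pb p0 unfolding g_def
        by (intro has_integral_diff integrable_integral fi) auto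
      then have "norm (g p - g p0 - \<theta> p0 (p - p0)) \<le> (\<epsilon> * norm (p - p0)) * measure lborel {0..1::real}"
        using \<delta>(3)[OF pb] \<open>\<epsilon> > 0\<close> by (intro has_integral_bound_real[of _ "{}"]) auto
      then show ?thesis by simp
    qed
    then show "\<exists>d>0. \<forall>y. norm (y - p0) < d \<longrightarrow> norm (g y - g p0 - \<theta> p0 (y - p0)) \<le> \<epsilon> * norm (y - p0)"
      using \<delta>(1) by blast
  qed
  then show ?thesis by blast
qed

text \<open>The Riemann map transports the form to a disc or to the plane.\<close>

lemma closed_form_exact_simply_connected:
  fixes P Q :: "real \<times> real \<Rightarrow> 'b::euclidean_space"
  assumes S: "open S" "simply_connected S"
    and P: "smooth_on P S" and Q: "smooth_on Q S"
    and closed: "\<And>x. x \<in> S \<Longrightarrow> D2 P x = D1 Q x"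
  shows "\<exists>g. \<forall>x\<in>S. (g has_derivative (\<lambda>w. fst w *\<^sub>R P x + snd w *\<^sub>R Q x)) (at x)"
proof (cases "S = {}")
  case False
  define c :: "real \<times> real \<Rightarrow> complex" where "c x = Complex (fst x) (snd x)" for x
  define r :: "complex \<Rightarrow> real \<times> real" where "r z = (Re z, Im z)" for z
  have cr: "c (r z) = z" "r (c x) = x" for z x by (simp_all add: c_def r_def complex_eq_iff)
  have lc: "bounded_linear c"
    unfolding linear_conv_bounded_linear[symmetric] by (rule linearI) (auto simp: c_def complex_eq_iff)
  have lr: "bounded_linear r"
    unfolding r_def by (intro bounded_linear_Pair bounded_linear_Re bounded_linear_Im)
  have "homeomorphism S (c ` S) c r"
    by (intro homeomorphismI linear_continuous_on lc lr) (auto simp: cr)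
  then have "simply_connected (c ` S)"
    using S(2) homeomorphic_simply_connected homeomorphic_def by blast
  moreover have "c ` S = r -` S"
  proof (intro equalityI subsetI)
    fix z assume "z \<in> r -` S"
    then show "z \<in> c ` S" by (intro image_eqI[of _ c "r z"]) (auto simp: cr)
  qed (auto simp: cr)
  then have oc: "open (c ` S)"
    using S(1) linear_continuous_on[OF lr] by (simp add: continuous_open_vimage linear_continuous_at[OF lr])
  ultimately have cases: "c ` S = UNIV \<or> (\<exists>f g. f holomorphic_on c ` S \<and> g holomorphic_on ball 0 1 \<and>
      (\<forall>z \<in> c ` S. f z \<in> ball 0 1 \<and> g (f z) = z) \<and> (\<forall>z \<in> ball 0 1. g z \<in> c ` S \<and> f (g z) = z))"
    using simply_connected_eq_biholomorphic_to_disc[OF oc] False by blast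
  obtain D k h where D: "open D" "convex D" "0 \<in> D"
    and k: "k holomorphic_on c ` S" and h: "h holomorphic_on D"
    and kh: "\<And>z. z \<in> c ` S \<Longrightarrow> k z \<in> D \<and> h (k z) = z" and hk: "\<And>z. z \<in> D \<Longrightarrow> h z \<in> c ` S"
  proof (cases "c ` S = UNIV")
    case True
    then show ?thesis using that[of UNIV "\<lambda>z. z" "\<lambda>z. z"] by (auto simp: holomorphic_on_ident)
  next
    case False
    then show ?thesis using cases that[of "ball 0 1"] by (metis centre_in_ball convex_ball open_ball zero_less_one)
  qed
  define \<phi> where "\<phi> z = r (h z)" for z
  have \<phi>S: "\<phi> z \<in> S" if "z \<in> D" for z using hk[OF that] cr by (auto simp: \<phi>_def)
  define h1 where "h1 = deriv h"
  define h2 where "h2 = deriv h1"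
  have h1: "(h has_derivative (\<lambda>w. h1 z * w)) (at z)" if "z \<in> D" for z
    using holomorphic_derivI[OF h D(1) that] by (simp add: h1_def has_field_derivative_def)
  have hh1: "h1 holomorphic_on D" unfolding h1_def by (rule holomorphic_deriv[OF h D(1)])
  have h2: "(h1 has_derivative (\<lambda>w. h2 z * w)) (at z)" if "z \<in> D" for z
    using holomorphic_derivI[OF hh1 D(1) that] by (simp add: h2_def has_field_derivative_def)
  have h2c: "continuous_on D h2"
    unfolding h2_def by (intro holomorphic_on_imp_continuous_on holomorphic_deriv[OF hh1 D(1)])
  have h1c: "continuous_on D h1" by (rule holomorphic_on_imp_continuous_on[OF hh1])
  have \<phi>d: "(\<phi> has_derivative (\<lambda>w. r (h1 z * w))) (at z)" if "z \<in> D" for z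
    unfolding \<phi>_def by (rule bounded_linear.has_derivative[OF lr h1[OF that]])
  have \<phi>c: "continuous_on D \<phi>"
    using \<phi>d by (meson has_derivative_continuous continuous_at_imp_continuous_on)
  have Pd: "(P has_derivative (\<lambda>w. fst w *\<^sub>R D1 P x + snd w *\<^sub>R D2 P x)) (at x)"
    and Qd: "(Q has_derivative (\<lambda>w. fst w *\<^sub>R D1 Q x + snd w *\<^sub>R D2 Q x)) (at x)" if "x \<in> S" for x
    by (rule smooth_on_has_derivative_partials[OF P that], rule smooth_on_has_derivative_partials[OF Q that])
  define \<theta> where "\<theta> z w = Re (h1 z * w) *\<^sub>R P (\<phi> z) + Im (h1 z * w) *\<^sub>R Q (\<phi> z)" for z w
  define \<theta>' where "\<theta>' z w v =
      (Re (h1 z * w) *\<^sub>R (Re (h1 z * v) *\<^sub>R D1 P (\<phi> z) + Im (h1 z * v) *\<^sub>R D2 P (\<phi> z))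
        + Re (h2 z * v * w) *\<^sub>R P (\<phi> z)) +
      (Im (h1 z * w) *\<^sub>R (Re (h1 z * v) *\<^sub>R D1 Q (\<phi> z) + Im (h1 z * v) *\<^sub>R D2 Q (\<phi> z))
        + Im (h2 z * v * w) *\<^sub>R Q (\<phi> z))" for z w v
  have "\<exists>g. \<forall>z\<in>D. (g has_derivative \<theta> z) (at z)"
  proof (rule closed_form_exact_convex[OF D, where \<theta>' = \<theta>'])
    fix z assume z: "z \<in> D"
    show "linear (\<theta> z)"
      by (rule linearI) (simp_all add: \<theta>_def algebra_simps)
    show "((\<lambda>z. \<theta> z w) has_derivative \<theta>' z w) (at z)" for w
    proof -
      have a: "((\<lambda>z. P (\<phi> z)) has_derivative (\<lambda>v. Re (h1 z * v) *\<^sub>R D1 P (\<phi> z) + Im (h1 z * v) *\<^sub>R D2 P (\<phi> z))) (at z)"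
        "((\<lambda>z. Q (\<phi> z)) has_derivative (\<lambda>v. Re (h1 z * v) *\<^sub>R D1 Q (\<phi> z) + Im (h1 z * v) *\<^sub>R D2 Q (\<phi> z))) (at z)"
        using has_derivative_compose[OF \<phi>d[OF z] Pd[OF \<phi>S[OF z]]] has_derivative_compose[OF \<phi>d[OF z] Qd[OF \<phi>S[OF z]]]
        by (simp_all add: r_def)
      have b: "((\<lambda>z. h1 z * w) has_derivative (\<lambda>v. h2 z * v * w)) (at z)"
        by (rule has_derivative_mult_left[OF h2[OF z]])
      show ?thesis
        unfolding \<theta>_def \<theta>'_def
        by (intro has_derivative_add has_derivative_scaleR a has_derivative_Re has_derivative_Im b)
    qed
    \<comment> \<open>The terms with \<open>h2\<close> are symmetric because the second derivative
      of a holomorphic map is a complex product; what remains is exactly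
      \<open>closed\<close>.\<close>
    show "\<theta>' z w v = \<theta>' z v w" for v w
      using closed[OF \<phi>S[OF z]] by (simp add: \<theta>'_def scaleR_add_right algebra_simps)
  next
    show "continuous_on D (\<lambda>z. \<theta>' z w v)" for w v
      using \<phi>S unfolding \<theta>'_def
      by (intro continuous_intros h1c h2c
          continuous_on_compose2[OF smooth_on_continuous[OF P] \<phi>c] continuous_on_compose2[OF smooth_on_continuous[OF Q] \<phi>c]
          continuous_on_compose2[OF smooth_on_continuous[OF smooth_on_D1[OF P]] \<phi>c]
          continuous_on_compose2[OF smooth_on_continuous[OF smooth_on_D2[OF P]] \<phi>c]
          continuous_on_compose2[OF smooth_on_continuous[OF smooth_on_D1[OF Q]] \<phi>c]
          continuous_on_compose2[OF smooth_on_continuous[OF smooth_on_D2[OF Q]] \<phi>c]) auto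
  qed
  then obtain g where g: "\<And>z. z \<in> D \<Longrightarrow> (g has_derivative \<theta> z) (at z)" by blast
  have "((\<lambda>x. g (k (c x))) has_derivative (\<lambda>w. fst w *\<^sub>R P x + snd w *\<^sub>R Q x)) (at x)" if x: "x \<in> S" for x
  proof -
    have cx: "c x \<in> c ` S" using x by blast
    have kd: "(k has_derivative (\<lambda>w. deriv k (c x) * w)) (at (c x))"
      using holomorphic_derivI[OF k oc cx] by (simp add: has_field_derivative_def)
    have kD: "k (c x) \<in> D" "h (k (c x)) = c x" using kh[OF cx] by auto
    have "((\<lambda>z. h (k z)) has_derivative (\<lambda>w. h1 (k (c x)) * (deriv k (c x) * w))) (at (c x))"
      by (rule has_derivative_compose[OF kd h1[OF kD(1)]])
    moreover have "((\<lambda>z. h (k z)) has_derivative (\<lambda>w. w)) (at (c x))"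
      by (rule has_derivative_transform_within_open[OF has_derivative_ident oc cx]) (use kh in auto)
    \<comment> \<open>As \<open>h\<close> undoes \<open>k\<close>, their derivatives are reciprocal,
      and pulling the form back along \<open>k\<close> restores its original coefficients.\<close>
    ultimately have inv: "h1 (k (c x)) * (deriv k (c x) * w) = w" for w
      using has_derivative_unique by (metis (no_types, lifting))
    have "((\<lambda>x. g (k (c x))) has_derivative (\<lambda>w. \<theta> (k (c x)) (deriv k (c x) * c w))) (at x)"
      by (rule has_derivative_compose[OF bounded_linear_imp_has_derivative[OF lc]
            has_derivative_compose[OF kd g[OF kD(1)]]])
    moreover have "\<theta> (k (c x)) (deriv k (c x) * c w) = fst w *\<^sub>R P x + snd w *\<^sub>R Q x" for w
      unfolding \<theta>_def \<phi>_def inv kD(2) cr by (simp add: c_def)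
    ultimately show ?thesis by simp
  qed
  then show ?thesis by blast
qed auto

subsection \<open>Surfaces in null coordinates\<close>

lemma mink_simps [simp]:
  "mink (x + y) z = mink x z + mink y z" "mink z (x + y) = mink z x + mink z y"
  "mink (x - y) z = mink x z - mink y z" "mink z (x - y) = mink z x - mink z y"
  "mink (c *\<^sub>R x) z = c * mink x z" "mink z (c *\<^sub>R x) = c * mink z x"
  "mink (- x) z = - mink x z" "mink z (- x) = - mink z x" "mink 0 z = 0" "mink z 0 = 0"
  by (simp_all add: mink_def algebra_simps)

lemma mink_commute: "mink x y = mink y x"
  by (simp add: mink_def algebra_simps)

text \<open>The products with the frame recover the coordinates of a linear combination. Hence the
  combination map is injective, and onto by dimension.\<close>

lemma null_frame_expansion:
  assumes "mink a a = 0" "mink b b = 0" "mink a b \<noteq> 0" "mink n n = 1" "mink a n = 0" "mink b n = 0"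
  shows "w = (mink w b / mink a b) *\<^sub>R a + (mink w a / mink a b) *\<^sub>R b + mink w n *\<^sub>R n"
proof -
  define L :: "real^3 \<Rightarrow> real^3" where "L x = x$1 *\<^sub>R a + x$2 *\<^sub>R b + x$3 *\<^sub>R n" for x
  have lin: "linear L"
    by (rule linearI) (simp_all add: L_def algebra_simps)
  have m: "mink (L x) b = x$1 * mink a b" "mink (L x) a = x$2 * mink a b" "mink (L x) n = x$3" for x
    using assms by (simp_all add: L_def mink_commute[of n a] mink_commute[of n b] mink_commute[of b a])
  have "inj L"
  proof (rule linear_injective_0[OF lin, THEN iffD2], intro allI impI)
    fix x assume "L x = 0"
    from m[of x, unfolded this] show "x = 0" using assms(3) by (simp add: vec_eq_iff forall_3)
  qed
  then obtain x where w: "w = L x"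
    using linear_injective_imp_surjective[OF lin] by (metis surjD)
  have "mink w b / mink a b = x$1" "mink w a / mink a b = x$2" "mink w n = x$3"
    unfolding w m using assms(3) by simp_all
  then show ?thesis by (simp only: w L_def)
qed

text \<open>The coefficient of the metric is only nonzero, of either sign: in the same coordinates
  the dual of an anti isothermic surface has the opposite sign.\<close>

locale null_surface =
  fixes W :: "(real \<times> real) set" and f n :: "real \<times> real \<Rightarrow> real^3"
  assumes open_W: "open W" and smooth_f: "smooth_on f W" and smooth_n: "smooth_on n W"
    and null: "x \<in> W \<Longrightarrow> mink (D1 f x) (D1 f x) = 0" "x \<in> W \<Longrightarrow> mink (D2 f x) (D2 f x) = 0"
    and nondegenerate: "x \<in> W \<Longrightarrow> mink (D1 f x) (D2 f x) \<noteq> 0"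
    and unit: "x \<in> W \<Longrightarrow> mink (n x) (n x) = 1"
    and orth: "x \<in> W \<Longrightarrow> mink (D1 f x) (n x) = 0" "x \<in> W \<Longrightarrow> mink (D2 f x) (n x) = 0"
begin

text \<open>Where it is positive, \<open>h\<close> is half of the exponential of
  \<open>omega\<close>; \<open>k\<close> is the mixed coefficient of the second fundamental form.
  That \<open>H\<close> is the mean curvature is proved in \<open>mean_curvature_eq\<close>.\<close>

definition h where "h x = mink (D1 f x) (D2 f x)"
definition k where "k x = mink (D1 (D2 f) x) (n x)"
definition H where "H x = k x / h x"
abbreviation Q where "Q \<equiv> Q_coeff f n"
abbreviation R where "R \<equiv> R_coeff f n"

lemma h_nonzero: "x \<in> W \<Longrightarrow> h x \<noteq> 0"
  by (simp add: h_def nondegenerate)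

lemma k_eq: "x \<in> W \<Longrightarrow> k x = H x * h x"
  by (simp add: H_def h_nonzero)

lemma expansion:
  assumes "x \<in> W"
  shows "w = (mink w (D2 f x) / h x) *\<^sub>R D1 f x + (mink w (D1 f x) / h x) *\<^sub>R D2 f x + mink w (n x) *\<^sub>R n x"
  unfolding h_def
  using assms by (intro null_frame_expansion null nondegenerate unit orth)

lemmas sm = smooth_f smooth_n smooth_on_D1[OF smooth_f] smooth_on_D2[OF smooth_f]
lemmas sm2 = smooth_on_D1[OF sm(3)] smooth_on_D2[OF sm(3)] smooth_on_D1[OF sm(4)] smooth_on_D2[OF sm(4)]
  smooth_on_D1[OF sm(2)] smooth_on_D2[OF sm(2)]

lemma smooth_h: "smooth_on h W" unfolding h_def by (rule smooth_on_mink[OF open_W sm(3,4)])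
lemma smooth_k: "smooth_on k W" unfolding k_def by (rule smooth_on_mink[OF open_W sm2(3) sm(2)])
lemma smooth_Q: "smooth_on Q W" unfolding Q_coeff_def by (rule smooth_on_mink[OF open_W sm2(1) sm(2)])
lemma smooth_R: "smooth_on R W" unfolding R_coeff_def by (rule smooth_on_mink[OF open_W sm2(4) sm(2)])
lemma smooth_H: "smooth_on H W"
  unfolding H_def by (rule smooth_on_divide[OF open_W smooth_k smooth_h h_nonzero])

lemma mixed: "x \<in> W \<Longrightarrow> D2 (D1 f) x = D1 (D2 f) x"
  using D1_D2_commute[OF open_W smooth_f] by simp

text \<open>Each identity comes from differentiating one of the constant products among the two
  tangent fields and the normal, or \<open>h\<close> itself.\<close>

lemma products:
  assumes x: "x \<in> W"
  shows "mink (D1 (D1 f) x) (D1 f x) = 0" "mink (D1 (D2 f) x) (D1 f x) = 0"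
    "mink (D1 (D2 f) x) (D2 f x) = 0" "mink (D2 (D2 f) x) (D2 f x) = 0"
    "mink (D1 n x) (n x) = 0" "mink (D2 n x) (n x) = 0"
    "mink (D1 n x) (D1 f x) = - Q x" "mink (D2 n x) (D1 f x) = - k x"
    "mink (D1 n x) (D2 f x) = - k x" "mink (D2 n x) (D2 f x) = - R x"
    "mink (D1 (D1 f) x) (D2 f x) = D1 h x" "mink (D2 (D2 f) x) (D1 f x) = D2 h x"
proof -
  have D: "b \<in> {\<lambda>g. D1 g x, \<lambda>g. D2 g x} \<Longrightarrow> (\<And>y. y \<in> W \<Longrightarrow> g y = c) \<Longrightarrow> b g = 0" for b and g :: "real \<times> real \<Rightarrow> real" and c
    using D_cong[OF open_W x, of g "\<lambda>_. c"] by auto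
  have d1: "D1 g x = 0" and d2: "D2 g x = 0" if "\<And>y. y \<in> W \<Longrightarrow> g y = c" for g :: "real \<times> real \<Rightarrow> real" and c
    using D[of "\<lambda>g. D1 g x", OF _ that] D[of "\<lambda>g. D2 g x", OF _ that] by auto
  note c = mink_commute
  show aa: "mink (D1 (D1 f) x) (D1 f x) = 0" "mink (D1 (D2 f) x) (D1 f x) = 0"
    using d1[of "\<lambda>y. mink (D1 f y) (D1 f y)", OF null(1)] d2[of "\<lambda>y. mink (D1 f y) (D1 f y)", OF null(1)]
    by (simp_all add: D_mink[OF sm(3,3) x] mixed[OF x] c[of "D1 f x"])
  show bb: "mink (D1 (D2 f) x) (D2 f x) = 0" "mink (D2 (D2 f) x) (D2 f x) = 0"
    using d1[of "\<lambda>y. mink (D2 f y) (D2 f y)", OF null(2)] d2[of "\<lambda>y. mink (D2 f y) (D2 f y)", OF null(2)]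
    by (simp_all add: D_mink[OF sm(4,4) x] c[of "D2 f x"])
  show "mink (D1 n x) (n x) = 0" "mink (D2 n x) (n x) = 0"
    using d1[of "\<lambda>y. mink (n y) (n y)", OF unit] d2[of "\<lambda>y. mink (n y) (n y)", OF unit]
    by (simp_all add: D_mink[OF sm(2,2) x] c[of "n x"])
  show "mink (D1 n x) (D1 f x) = - Q x" "mink (D2 n x) (D1 f x) = - k x"
    using d1[of "\<lambda>y. mink (D1 f y) (n y)", OF orth(1)] d2[of "\<lambda>y. mink (D1 f y) (n y)", OF orth(1)]
    by (simp_all add: D_mink[OF sm(3,2) x] mixed[OF x] c[of "D1 f x"] Q_coeff_def k_def)
  show "mink (D1 n x) (D2 f x) = - k x" "mink (D2 n x) (D2 f x) = - R x"
    using d1[of "\<lambda>y. mink (D2 f y) (n y)", OF orth(2)] d2[of "\<lambda>y. mink (D2 f y) (n y)", OF orth(2)]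
    by (simp_all add: D_mink[OF sm(4,2) x] c[of "D2 f x"] R_coeff_def k_def)
  have "h = (\<lambda>y. mink (D1 f y) (D2 f y))" by (simp add: h_def fun_eq_iff)
  then show "mink (D1 (D1 f) x) (D2 f x) = D1 h x" "mink (D2 (D2 f) x) (D1 f x) = D2 h x"
    using aa bb by (simp_all add: D_mink[OF sm(3,4) x] mixed[OF x] c[of "D1 f x"])
qed

lemma gauss_weingarten:
  assumes x: "x \<in> W"
  shows "D1 (D1 f) x = (D1 h x / h x) *\<^sub>R D1 f x + Q x *\<^sub>R n x"
    "D1 (D2 f) x = k x *\<^sub>R n x" "D2 (D1 f) x = k x *\<^sub>R n x"
    "D2 (D2 f) x = (D2 h x / h x) *\<^sub>R D2 f x + R x *\<^sub>R n x"
    "D1 n x = (- (k x / h x)) *\<^sub>R D1 f x + (- (Q x / h x)) *\<^sub>R D2 f x"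
    "D2 n x = (- (R x / h x)) *\<^sub>R D1 f x + (- (k x / h x)) *\<^sub>R D2 f x"
  using expansion[OF x, of "D1 (D1 f) x"] expansion[OF x, of "D1 (D2 f) x"] expansion[OF x, of "D2 (D2 f) x"]
    expansion[OF x, of "D1 n x"] expansion[OF x, of "D2 n x"] mixed[OF x]
  unfolding products[OF x] Q_coeff_def[of f n x, symmetric] R_coeff_def[of f n x, symmetric] k_def[symmetric]
  by simp_all

text \<open>Compare the two orders of differentiation in the third derivatives of \<open>f\<close>:
  normal components give the Codazzi equations, a tangential one the Gauss equation. As k = h H, the
  right-hand sides of the first two are h H_u and h H_v.\<close>

lemma codazzi_gauss:
  assumes x: "x \<in> W"
  shows "D2 Q x = D1 k x - D1 h x / h x * k x" "D1 R x = D2 k x - D2 h x / h x * k x"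
    "D2 (\<lambda>y. D1 h y / h y) x = Q x * R x / h x - k x * k x / h x"
proof -
  define l where "l y = D1 h y / h y" for y
  define r where "r y = D2 h y / h y" for y
  have sl: "smooth_on l W" "smooth_on r W"
    unfolding l_def r_def using open_W smooth_h h_nonzero by (auto intro!: smooth_intros)
  have kn: "D1 (\<lambda>y. k y *\<^sub>R n y) x = k x *\<^sub>R D1 n x + D1 k x *\<^sub>R n x"
    "D2 (\<lambda>y. k y *\<^sub>R n y) x = k x *\<^sub>R D2 n x + D2 k x *\<^sub>R n x"
    using D_scaleR[OF smooth_k sm(2) x] by auto
  have E1: "k x *\<^sub>R D1 n x + D1 k x *\<^sub>R n x = l x *\<^sub>R D2 (D1 f) x + D2 l x *\<^sub>R D1 f x + (Q x *\<^sub>R D2 n x + D2 Q x *\<^sub>R n x)"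
  proof -
    have "D1 (D2 (D1 f)) x = D1 (\<lambda>y. k y *\<^sub>R n y) x"
      by (rule D_cong(1)[OF open_W x gauss_weingarten(3)])
    moreover have "D2 (D1 (D1 f)) x = D2 (\<lambda>y. l y *\<^sub>R D1 f y + Q y *\<^sub>R n y) x"
      unfolding l_def by (rule D_cong(2)[OF open_W x gauss_weingarten(1)])
    moreover have "D2 (\<lambda>y. l y *\<^sub>R D1 f y + Q y *\<^sub>R n y) x =
        l x *\<^sub>R D2 (D1 f) x + D2 l x *\<^sub>R D1 f x + (Q x *\<^sub>R D2 n x + D2 Q x *\<^sub>R n x)"
      by (simp add: D_add(2)[OF smooth_on_scaleR[OF open_W sl(1) sm(3)] smooth_on_scaleR[OF open_W smooth_Q sm(2)] x]
          D_scaleR(2)[OF sl(1) sm(3) x] D_scaleR(2)[OF smooth_Q sm(2) x])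
    ultimately show ?thesis
      using D1_D2_commute[OF open_W sm(3) x] kn by simp
  qed
  have E2: "k x *\<^sub>R D2 n x + D2 k x *\<^sub>R n x = r x *\<^sub>R D1 (D2 f) x + D1 r x *\<^sub>R D2 f x + (R x *\<^sub>R D1 n x + D1 R x *\<^sub>R n x)"
  proof -
    have "D2 (D1 (D2 f)) x = D2 (\<lambda>y. k y *\<^sub>R n y) x"
      by (rule D_cong(2)[OF open_W x gauss_weingarten(2)])
    moreover have "D1 (D2 (D2 f)) x = D1 (\<lambda>y. r y *\<^sub>R D2 f y + R y *\<^sub>R n y) x"
      unfolding r_def by (rule D_cong(1)[OF open_W x gauss_weingarten(4)])
    moreover have "D1 (\<lambda>y. r y *\<^sub>R D2 f y + R y *\<^sub>R n y) x =
        r x *\<^sub>R D1 (D2 f) x + D1 r x *\<^sub>R D2 f x + (R x *\<^sub>R D1 n x + D1 R x *\<^sub>R n x)"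
      by (simp add: D_add(1)[OF smooth_on_scaleR[OF open_W sl(2) sm(4)] smooth_on_scaleR[OF open_W smooth_R sm(2)] x]
          D_scaleR(1)[OF sl(2) sm(4) x] D_scaleR(1)[OF smooth_R sm(2) x])
    ultimately show ?thesis
      using D1_D2_commute[OF open_W sm(4) x] kn by simp
  qed
  note o = orth[OF x] unit[OF x] null[OF x] mink_commute[of "n x" "D1 f x"] mink_commute[of "n x" "D2 f x"] mink_commute[of "D2 f x" "D1 f x"]
  show "D2 Q x = D1 k x - D1 h x / h x * k x"
    using arg_cong[OF E1, of "\<lambda>w. mink w (n x)"] products[OF x] o
    by (simp add: gauss_weingarten(3)[OF x] l_def)
  show "D1 R x = D2 k x - D2 h x / h x * k x"
    using arg_cong[OF E2, of "\<lambda>w. mink w (n x)"] products[OF x] o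
    by (simp add: gauss_weingarten(2)[OF x] r_def)
  have "D2 l x * h x = Q x * R x - k x * k x"
    using arg_cong[OF E1, of "\<lambda>w. mink w (D2 f x)"] products[OF x] o
    by (simp add: gauss_weingarten(3)[OF x] h_def)
  then have "D2 l x = Q x * R x / h x - k x * k x / h x"
    using h_nonzero[OF x] by (simp add: field_simps)
  then show "D2 (\<lambda>y. D1 h y / h y) x = Q x * R x / h x - k x * k x / h x"
    by (simp add: l_def[abs_def])
qed

lemma df_eq: "x \<in> W \<Longrightarrow> frechet_derivative f (at x) X = fst X *\<^sub>R D1 f x + snd X *\<^sub>R D2 f x"
  and dn_eq: "x \<in> W \<Longrightarrow> frechet_derivative n (at x) X = fst X *\<^sub>R D1 n x + snd X *\<^sub>R D2 n x"
  by (rule frechet_derivative_D1_D2[OF differentiableI[OF smooth_on_has_derivative[OF smooth_f]]], assumption)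
     (rule frechet_derivative_D1_D2[OF differentiableI[OF smooth_on_has_derivative[OF smooth_n]]])

lemma inj_df: "x \<in> W \<Longrightarrow> inj (frechet_derivative f (at x))"
proof (rule injI)
  fix X Y assume x: "x \<in> W" and e: "frechet_derivative f (at x) X = frechet_derivative f (at x) Y"
  have "mink (frechet_derivative f (at x) X) (D1 f x) = snd X * h x"
    "mink (frechet_derivative f (at x) X) (D2 f x) = fst X * h x" for X
    using null[OF x] by (simp_all add: df_eq[OF x] h_def mink_commute[of "D2 f x" "D1 f x"])
  then show "X = Y" using e h_nonzero[OF x] by (metis mult_cancel_right prod_eq_iff)
qed

text \<open>The matrix of the shape operator, read off from the Weingarten equations. Its
  off-diagonal entries are Q / h and R / h, so umbilics are the common zeros of \<open>Q\<close> and
  \<open>R\<close>.\<close>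

definition S where
  "S x X = (H x * fst X + R x / h x * snd X, Q x / h x * fst X + H x * snd X)"

lemma linear_S: "linear (S x)"
  by (rule linearI) (auto simp: S_def algebra_simps add_divide_distrib)

lemma S_property:
  assumes x: "x \<in> W"
  shows "frechet_derivative f (at x) (S x X) = - frechet_derivative n (at x) X"
  by (simp add: df_eq[OF x] dn_eq[OF x] gauss_weingarten(5,6)[OF x] S_def H_def algebra_simps add_divide_distrib)

lemma lorentzian_first_form:
  assumes x: "x \<in> W" shows "lorentzian (first_form f x)"
  unfolding lorentzian_def
proof (intro exI conjI)
  have "first_form f x X Y = (fst X * snd Y + snd X * fst Y) * h x" for X Y
    using null[OF x] by (simp add: first_form_def df_eq[OF x] h_def mink_commute[of "D2 f x" "D1 f x"] algebra_simps)
  \<comment> \<open>The form takes the value 2 y h on (1, y), so the values -1 and 1 determine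
    y.\<close>
  then show "first_form f x (1, - (1 / (2 * h x))) (1, - (1 / (2 * h x))) = - 1"
    "first_form f x (1, 1 / (2 * h x)) (1, 1 / (2 * h x)) = 1"
    "first_form f x (1, - (1 / (2 * h x))) (1, 1 / (2 * h x)) = 0"
    using h_nonzero[OF x] by (simp_all add: field_simps)
qed

end

subsection \<open>The shape operator and changes of coordinates\<close>

lemma shape_operator_eqI:
  assumes "inj (frechet_derivative f (at x))" "linear S"
    "\<And>X. frechet_derivative f (at x) (S X) = - frechet_derivative n (at x) X"
  shows "shape_operator f n x = S"
  unfolding shape_operator_def
proof (rule the_equality)
  fix S' assume "linear S' \<and> (\<forall>X. frechet_derivative f (at x) (S' X) = - frechet_derivative n (at x) X)"
  then show "S' = S" using assms(1,3) by (metis ext injD)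
qed (use assms in auto)

lemma mean_curvature_trace:
  "mean_curvature f n x = (fst (shape_operator f n x (1, 0)) + snd (shape_operator f n x (0, 1))) / 2"
proof -
  have "(\<Sum>b\<in>(Basis :: (real \<times> real) set). T b \<bullet> b) = fst (T (1, 0)) + snd (T (0, 1))" for T :: "real \<times> real \<Rightarrow> real \<times> real"
    unfolding Basis_prod_def by (subst sum.union_disjoint) (auto simp: inner_prod_def)
  then show ?thesis by (simp add: mean_curvature_def)
qed

lemma trace_conjugate:
  fixes S \<phi> \<psi> :: "real \<times> real \<Rightarrow> real \<times> real"
  assumes "linear S" "linear \<phi>" "linear \<psi>" "\<And>X. \<phi> (\<psi> X) = X"
  shows "fst (\<psi> (S (\<phi> (1, 0)))) + snd (\<psi> (S (\<phi> (0, 1)))) = fst (S (1, 0)) + snd (S (0, 1))"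
proof -
  have e: "T X = (fst X * fst (T (1, 0)) + snd X * fst (T (0, 1)), fst X * snd (T (1, 0)) + snd X * snd (T (0, 1)))"
    if "linear T" for T :: "real \<times> real \<Rightarrow> real \<times> real" and X
  proof -
    have "T (fst X *\<^sub>R (1, 0) + snd X *\<^sub>R (0, 1)) = fst X *\<^sub>R T (1, 0) + snd X *\<^sub>R T (0, 1)"
      unfolding linear_add[OF that] linear_cmul[OF that] ..
    then show ?thesis by (simp add: prod_eq_iff)
  qed
  obtain p1 p2 q1 q2 where p: "\<phi> (1, 0) = (p1, p2)" "\<phi> (0, 1) = (q1, q2)" by fastforce
  obtain r1 r2 t1 t2 where r: "\<psi> (1, 0) = (r1, r2)" "\<psi> (0, 1) = (t1, t2)" by fastforce
  obtain a1 a2 b1 b2 where a: "S (1, 0) = (a1, a2)" "S (0, 1) = (b1, b2)" by fastforce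
  have "\<phi> (r1, r2) = (1, 0)" "\<phi> (t1, t2) = (0, 1)" using assms(4) r by metis+
  then have i: "r1 * p1 + r2 * q1 = 1" "r1 * p2 + r2 * q2 = 0" "t1 * p1 + t2 * q1 = 0" "t1 * p2 + t2 * q2 = 1"
    using e[OF assms(2), of "(r1, r2)"] e[OF assms(2), of "(t1, t2)"] by (auto simp: p)
  have "fst (\<psi> (S (\<phi> (1, 0)))) + snd (\<psi> (S (\<phi> (0, 1)))) =
      a1 * (r1 * p1 + r2 * q1) + b1 * (r1 * p2 + r2 * q2) + a2 * (t1 * p1 + t2 * q1) + b2 * (t1 * p2 + t2 * q2)"
    unfolding p e[OF assms(1), of "(p1, p2)"] e[OF assms(1), of "(q1, q2)"] a
    by (subst (1 2) e[OF assms(3)]) (simp add: r algebra_simps)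
  then show ?thesis unfolding i a by simp
qed

text \<open>By the chain rule a change of coordinates conjugates the shape operator with its
  derivative, and conjugation preserves the trace.\<close>

lemma shape_operator_pullback:
  fixes f n :: "real \<times> real \<Rightarrow> real^3"
  assumes f: "f differentiable (at (\<phi> x))" and n: "n differentiable (at (\<phi> x))"
    and \<phi>: "(\<phi> has_derivative \<phi>') (at x)" and \<psi>': "linear \<psi>'" "\<And>X. \<phi>' (\<psi>' X) = X" "\<And>X. \<psi>' (\<phi>' X) = X"
    and inj: "inj (frechet_derivative f (at (\<phi> x)))" and S: "linear S"
    and S_eq: "\<And>X. frechet_derivative f (at (\<phi> x)) (S X) = - frechet_derivative n (at (\<phi> x)) X"
    and eq: "open U" "x \<in> U" "\<And>y. y \<in> U \<Longrightarrow> f' y = f (\<phi> y)" "\<And>y. y \<in> U \<Longrightarrow> n' y = n (\<phi> y)"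
  shows "shape_operator f' n' x = (\<lambda>X. \<psi>' (S (\<phi>' X)))"
    and "mean_curvature f' n' x = mean_curvature f n (\<phi> x)"
proof -
  have l: "linear \<phi>'" using \<phi> by (rule has_derivative_linear)
  have df: "frechet_derivative f' (at x) = (\<lambda>X. frechet_derivative f (at (\<phi> x)) (\<phi>' X))"
    by (rule trans[OF frechet_derivative_cong_open[OF eq(1-3)]
          frechet_derivative_at[OF has_derivative_compose[OF \<phi> f[unfolded frechet_derivative_works]], symmetric]])
  have dn: "frechet_derivative n' (at x) = (\<lambda>X. frechet_derivative n (at (\<phi> x)) (\<phi>' X))"
    by (rule trans[OF frechet_derivative_cong_open[OF eq(1,2,4)]
          frechet_derivative_at[OF has_derivative_compose[OF \<phi> n[unfolded frechet_derivative_works]], symmetric]])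
  show s: "shape_operator f' n' x = (\<lambda>X. \<psi>' (S (\<phi>' X)))"
  proof (rule shape_operator_eqI)
    show "inj (frechet_derivative f' (at x))"
    proof (rule injI)
      fix X Y assume "frechet_derivative f' (at x) X = frechet_derivative f' (at x) Y"
      then have "\<phi>' X = \<phi>' Y" unfolding df by (rule injD[OF inj])
      then show "X = Y" using \<psi>'(3) by metis
    qed
    show "linear (\<lambda>X. \<psi>' (S (\<phi>' X)))"
      using linear_compose[OF linear_compose[OF l S] \<psi>'(1)] by (simp add: o_def)
  qed (simp add: df dn \<psi>' S_eq)
  have "shape_operator f n (\<phi> x) = S"
    by (rule shape_operator_eqI[OF inj S S_eq])
  then show "mean_curvature f' n' x = mean_curvature f n (\<phi> x)"
    unfolding mean_curvature_trace s by (simp add: trace_conjugate[OF S l \<psi>'(1,2)])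
qed

context null_surface
begin

lemma shape_operator_eq: "x \<in> W \<Longrightarrow> shape_operator f n x = S x"
  by (intro shape_operator_eqI inj_df linear_S S_property)

lemma mean_curvature_eq: "x \<in> W \<Longrightarrow> mean_curvature f n x = H x"
  by (simp add: mean_curvature_trace shape_operator_eq S_def)

end

subsection \<open>The moving frame\<close>

definition vec4 :: "'a \<Rightarrow> 'a \<Rightarrow> 'a \<Rightarrow> 'a \<Rightarrow> 'a ^ 4" where
  "vec4 a b c d = (\<chi> i. if i = 1 then a else if i = 2 then b else if i = 3 then c else d)"

lemma vec4_nth [simp]: "vec4 a b c d $ 1 = a" "vec4 a b c d $ 2 = b" "vec4 a b c d $ 3 = c" "vec4 a b c d $ 4 = d"
  by (simp_all add: vec4_def)

lemma vec4_eq_iff: "x = y \<longleftrightarrow> x $ 1 = y $ 1 \<and> x $ 2 = y $ 2 \<and> x $ 3 = y $ 3 \<and> x $ 4 = y $ 4" for x y :: "'a ^ 4"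
  by (simp add: vec_eq_iff forall_4)

lemma matrix_mult_row: "(A ** B) $ i = (\<Sum>j\<in>UNIV. A $ i $ j *\<^sub>R B $ j)" for A :: "real^'n^'m" and B :: "real^'k^'n"
  by (simp add: vec_eq_iff matrix_matrix_mult_def)

lemma bounded_bilinear_matrix_mult:
  "bounded_bilinear ((**) :: real^'n^'m \<Rightarrow> real^'k^'n \<Rightarrow> real^'k^'m)"
  unfolding bilinear_conv_bounded_bilinear[symmetric] bilinear_def
  by (auto intro!: linearI simp: vec_eq_iff matrix_matrix_mult_def sum.distrib sum_distrib_left algebra_simps)

lemma D_nth:
  fixes F :: "real \<times> real \<Rightarrow> 'b::euclidean_space ^ 'n"
  assumes "smooth_on F S" "x \<in> S"
  shows "D1 F x $ i = D1 (\<lambda>x. F x $ i) x" "D2 F x $ i = D2 (\<lambda>x. F x $ i) x"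
  using D_linear[OF bounded_linear_vec_nth assms] by simp_all

lemma smooth_on_vec4 [smooth_intros]:
  fixes a :: "'a::euclidean_space \<Rightarrow> 'b::euclidean_space"
  assumes "open S" "smooth_on a S" "smooth_on b S" "smooth_on c S" "smooth_on d S"
  shows "smooth_on (\<lambda>x. vec4 (a x) (b x) (c x) (d x)) S"
proof (rule smooth_on_vec[OF assms(1)])
  show "smooth_on (\<lambda>x. vec4 (a x) (b x) (c x) (d x) $ i) S" for i :: 4
    using assms exhaust_4[of i] by auto
qed

text \<open>The coefficients of the Gauss-Weingarten equations for the rows \<open>f, f\<^sub>u, f\<^sub>v, n\<close>.\<close>

definition frame_u :: "real \<Rightarrow> real \<Rightarrow> real \<Rightarrow> real \<Rightarrow> real^4^4" where
  "frame_u l k Q h = vec4 (vec4 0 1 0 0) (vec4 0 l 0 Q) (vec4 0 0 0 k) (vec4 0 (- (k / h)) (- (Q / h)) 0)"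

definition frame_v :: "real \<Rightarrow> real \<Rightarrow> real \<Rightarrow> real \<Rightarrow> real^4^4" where
  "frame_v r k R h = vec4 (vec4 0 0 1 0) (vec4 0 0 0 k) (vec4 0 0 r R) (vec4 0 (- (R / h)) (- (k / h)) 0)"

lemma smooth_on_frame:
  fixes l k Q h :: "'a::euclidean_space \<Rightarrow> real"
  assumes "open S" "smooth_on l S" "smooth_on k S" "smooth_on Q S" "smooth_on h S" "\<And>x. x \<in> S \<Longrightarrow> h x \<noteq> 0"
  shows "smooth_on (\<lambda>x. frame_u (l x) (k x) (Q x) (h x)) S" "smooth_on (\<lambda>x. frame_v (l x) (k x) (Q x) (h x)) S"
  unfolding frame_u_def frame_v_def using assms by (intro smooth_intros; simp)+

context null_surface
begin

definition l where "l x = D1 h x / h x"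
definition r where "r x = D2 h x / h x"

lemma smooth_l: "smooth_on l W" and smooth_r: "smooth_on r W"
  unfolding l_def r_def using open_W smooth_h h_nonzero by (auto intro!: smooth_intros)

text \<open>Both are mixed second derivatives of the logarithm of the absolute value of
  \<open>h\<close>; the proof works with \<open>h\<close> directly because its sign is not
  fixed.\<close>

lemma D1_r: "x \<in> W \<Longrightarrow> D1 r x = D2 l x"
proof -
  assume x: "x \<in> W"
  have "D1 h y = l y * h y" "D2 h y = r y * h y" if "y \<in> W" for y
    using h_nonzero[OF that] by (simp_all add: l_def r_def)
  then have "D2 (D1 h) x = l x * D2 h x + D2 l x * h x" "D1 (D2 h) x = r x * D1 h x + D1 r x * h x"
    using D_cong[OF open_W x, of "D1 h" "\<lambda>y. l y * h y"] D_cong[OF open_W x, of "D2 h" "\<lambda>y. r y * h y"]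
      D_mult[OF smooth_l smooth_h x] D_mult[OF smooth_r smooth_h x] by auto
  moreover have "l x * D2 h x = r x * D1 h x"
    by (simp add: l_def r_def)
  ultimately have "D2 l x * h x = D1 r x * h x"
    using D1_D2_commute[OF open_W smooth_h x] by linarith
  then show ?thesis
    using h_nonzero[OF x] by simp
qed

text \<open>The position \<open>f\<close> is one of the rows, so that a single linear system also
  produces the surface and no further integration is needed.\<close>

definition frame where "frame x = vec4 (f x) (D1 f x) (D2 f x) (n x)"

lemma smooth_frame: "smooth_on frame W"
  unfolding frame_def by (rule smooth_on_vec4[OF open_W sm(1,3,4,2)])

lemma D_frame:
  assumes x: "x \<in> W"
  shows "D1 frame x = frame_u (l x) (k x) (Q x) (h x) ** frame x"
    "D2 frame x = frame_v (r x) (k x) (R x) (h x) ** frame x"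
proof -
  have "(\<lambda>y. frame y $ 1) = f" "(\<lambda>y. frame y $ 2) = D1 f" "(\<lambda>y. frame y $ 3) = D2 f" "(\<lambda>y. frame y $ 4) = n"
    by (simp_all add: frame_def fun_eq_iff)
  then show "D1 frame x = frame_u (l x) (k x) (Q x) (h x) ** frame x"
    "D2 frame x = frame_v (r x) (k x) (R x) (h x) ** frame x"
    unfolding vec4_eq_iff D_nth[OF smooth_frame x] matrix_mult_row
    by (simp_all add: gauss_weingarten[OF x] sum_4 frame_u_def frame_v_def frame_def l_def r_def)
qed

end

lemma frame_zero:
  fixes Z :: "real \<times> real \<Rightarrow> real^'n^4"
  assumes W: "open W" "connected W" "x0 \<in> W" "x1 \<in> W" and Z: "smooth_on Z W" "Z x0 = 0"
    and c: "continuous_on W U" "continuous_on W V"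
    and D: "\<And>x. x \<in> W \<Longrightarrow> D1 Z x = U x ** Z x" "\<And>x. x \<in> W \<Longrightarrow> D2 Z x = V x ** Z x"
  shows "Z x1 = 0"
proof -
  obtain K where K: "0 < K" "\<And>(A :: real^4^4) (B :: real^'n^4). norm (A ** B) \<le> norm A * norm B * K"
    using bounded_bilinear.pos_bounded[OF bounded_bilinear_matrix_mult] by blast
  have "continuous_on W (\<lambda>x. (norm (U x) + norm (V x)) * K)"
    using c by (intro continuous_intros)
  moreover have "norm (A ** Z x) \<le> (norm (U x) + norm (V x)) * K * norm (Z x)" if "A \<in> {U x, V x}" for A x
  proof -
    have "norm (A ** Z x) \<le> norm A * (norm (Z x) * K)"
      using K(2)[of A "Z x"] by (simp add: mult.assoc)
    also have "\<dots> \<le> (norm (U x) + norm (V x)) * (norm (Z x) * K)"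
      using that K(1) by (intro mult_right_mono) auto
    finally show ?thesis by (simp add: algebra_simps)
  qed
  ultimately show ?thesis
    using D
    by (intro zero_propagation_partials[of W x0 Z x1 "\<lambda>x. (norm (U x) + norm (V x)) * K"])
       (use W Z(2) differentiableI[OF smooth_on_has_derivative[OF Z(1)]] in auto)
qed

text \<open>Uniqueness in the fundamental theorem of surface theory: the frame of \<open>f2\<close>
  and the transformed frame of \<open>f1\<close> solve the same linear system and agree at
  \<open>x0\<close>, so their difference, a solution as well, vanishes.\<close>

lemma rigidity:
  assumes f1: "null_surface W f1 n1" and f2: "null_surface W f2 n2"
    and W: "connected W" "x0 \<in> W" "x1 \<in> W"
    and eq: "\<And>x. x \<in> W \<Longrightarrow> null_surface.h f1 x = null_surface.h f2 x"
      "\<And>x. x \<in> W \<Longrightarrow> null_surface.k f1 n1 x = null_surface.k f2 n2 x"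
      "\<And>x. x \<in> W \<Longrightarrow> Q_coeff f1 n1 x = Q_coeff f2 n2 x" "\<And>x. x \<in> W \<Longrightarrow> R_coeff f1 n1 x = R_coeff f2 n2 x"
    and L: "linear L"
    and init: "f2 x0 = L (f1 x0) + b" "D1 f2 x0 = L (D1 f1 x0)" "D2 f2 x0 = L (D2 f1 x0)" "n2 x0 = L (n1 x0)"
  shows "f2 x1 = L (f1 x1) + b" "n2 x1 = L (n1 x1)"
proof -
  interpret s1: null_surface W f1 n1 by (rule f1)
  interpret s2: null_surface W f2 n2 by (rule f2)
  have bl: "bounded_linear L" using L by (simp add: linear_conv_bounded_linear)
  note LL = smooth_on_bounded_linear[OF bl s1.open_W]
  define Y where "Y x = vec4 (L (f1 x) + b) (L (D1 f1 x)) (L (D2 f1 x)) (L (n1 x))" for x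
  have sY: "smooth_on Y W"
    unfolding Y_def by (intro smooth_intros LL s1.open_W s1.sm)
  have Lsimp: "L (x + y) = L x + L y" "L (c *\<^sub>R x) = c *\<^sub>R L x" "L (- x) = - L x" "L (x - y) = L x - L y" for x y c
    using L by (simp_all add: linear_add linear_cmul linear_neg linear_diff)
  have DY: "D1 Y x = frame_u (s1.l x) (s1.k x) (s1.Q x) (s1.h x) ** Y x"
    "D2 Y x = frame_v (s1.r x) (s1.k x) (s1.R x) (s1.h x) ** Y x" if x: "x \<in> W" for x
  proof -
    have "(\<lambda>y. Y y $ 1) = (\<lambda>y. L (f1 y) + b)" "(\<lambda>y. Y y $ 2) = (\<lambda>y. L (D1 f1 y))"
      "(\<lambda>y. Y y $ 3) = (\<lambda>y. L (D2 f1 y))" "(\<lambda>y. Y y $ 4) = (\<lambda>y. L (n1 y))"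
      by (simp_all add: Y_def fun_eq_iff)
    then show "D1 Y x = frame_u (s1.l x) (s1.k x) (s1.Q x) (s1.h x) ** Y x"
      "D2 Y x = frame_v (s1.r x) (s1.k x) (s1.R x) (s1.h x) ** Y x"
      unfolding vec4_eq_iff D_nth[OF sY x] matrix_mult_row
      by (simp_all add: D_add[OF LL[OF s1.sm(1)] smooth_on_const x] D_linear[OF bl s1.sm(1) x] D_linear[OF bl s1.sm(2) x]
          D_linear[OF bl s1.sm(3) x] D_linear[OF bl s1.sm(4) x] s1.gauss_weingarten[OF x] Lsimp
          sum_4 frame_u_def frame_v_def Y_def s1.l_def s1.r_def)
  qed
  have Dh: "D1 s1.h x = D1 s2.h x" "D2 s1.h x = D2 s2.h x" if "x \<in> W" for x
    using D_cong[OF s1.open_W that eq(1)] by auto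
  have "s2.frame x1 - Y x1 = 0"
  proof (rule frame_zero[of W x0 x1 "\<lambda>x. s2.frame x - Y x"
        "\<lambda>x. frame_u (s1.l x) (s1.k x) (s1.Q x) (s1.h x)" "\<lambda>x. frame_v (s1.r x) (s1.k x) (s1.R x) (s1.h x)"])
    show "s2.frame x0 - Y x0 = 0"
      using init by (simp add: Y_def s2.frame_def)
    show "continuous_on W (\<lambda>x. frame_u (s1.l x) (s1.k x) (s1.Q x) (s1.h x))"
      "continuous_on W (\<lambda>x. frame_v (s1.r x) (s1.k x) (s1.R x) (s1.h x))"
      by (intro smooth_on_continuous smooth_on_frame s1.open_W s1.smooth_l s1.smooth_r s1.smooth_k s1.smooth_Q
          s1.smooth_R s1.smooth_h s1.h_nonzero; assumption)+
    fix x assume x: "x \<in> W"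
    have "s2.l x = s1.l x" "s2.r x = s1.r x"
      using Dh[OF x] eq(1)[OF x] by (simp_all add: s1.l_def s2.l_def s1.r_def s2.r_def)
    then show "D1 (\<lambda>x. s2.frame x - Y x) x = frame_u (s1.l x) (s1.k x) (s1.Q x) (s1.h x) ** (s2.frame x - Y x)"
      "D2 (\<lambda>x. s2.frame x - Y x) x = frame_v (s1.r x) (s1.k x) (s1.R x) (s1.h x) ** (s2.frame x - Y x)"
      using DY[OF x] s2.D_frame[OF x] eq[OF x]
      by (simp_all add: D_diff[OF s2.smooth_frame sY x] bounded_bilinear.diff_right[OF bounded_bilinear_matrix_mult])
  qed (use W s1.open_W sY s2.smooth_frame in \<open>auto intro: smooth_on_diff\<close>)
  then have "s2.frame x1 = Y x1" by simp
  then show "f2 x1 = L (f1 x1) + b" "n2 x1 = L (n1 x1)"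
    by (simp_all add: vec4_eq_iff s2.frame_def Y_def)
qed

lemma null_surface_subset:
  assumes "null_surface W f n" "B \<subseteq> W" "open B"
  shows "null_surface B f n"
proof -
  interpret null_surface W f n by (rule assms(1))
  show ?thesis
    using assms(2,3) smooth_on_subset[OF smooth_f assms(2)] smooth_on_subset[OF smooth_n assms(2)]
    by unfold_locales (auto simp: null nondegenerate unit orth subset_iff)
qed

subsection \<open>Surfaces with prescribed mean curvature and deformed Hopf differentials\<close>

text \<open>A solution of the frame equations is the frame of a surface only if it has the right
  scalar products. The deviation \<open>Z\<close> of its Gram matrix from the expected one satisfies
  Z_u = A Z + Z A^T and likewise in v, hence stays 0 if it is 0 at one point.\<close>

lemma gram_conservation:
  fixes a b c :: "real \<times> real \<Rightarrow> real^3"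
  assumes W: "open W" "connected W" "x0 \<in> W"
    and sm: "smooth_on a W" "smooth_on b W" "smooth_on c W"
    and co: "smooth_on h W" "smooth_on k W" "smooth_on q W" "smooth_on r W" "\<And>x. x \<in> W \<Longrightarrow> h x \<noteq> 0"
    and D1: "\<And>x. x \<in> W \<Longrightarrow> D1 a x = (D1 h x / h x) *\<^sub>R a x + q x *\<^sub>R c x" "\<And>x. x \<in> W \<Longrightarrow> D1 b x = k x *\<^sub>R c x"
      "\<And>x. x \<in> W \<Longrightarrow> D1 c x = (- (k x / h x)) *\<^sub>R a x + (- (q x / h x)) *\<^sub>R b x"
    and D2: "\<And>x. x \<in> W \<Longrightarrow> D2 a x = k x *\<^sub>R c x" "\<And>x. x \<in> W \<Longrightarrow> D2 b x = (D2 h x / h x) *\<^sub>R b x + r x *\<^sub>R c x"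
      "\<And>x. x \<in> W \<Longrightarrow> D2 c x = (- (r x / h x)) *\<^sub>R a x + (- (k x / h x)) *\<^sub>R b x"
    and init: "mink (a x0) (a x0) = 0" "mink (b x0) (b x0) = 0" "mink (a x0) (b x0) = h x0"
      "mink (c x0) (c x0) = 1" "mink (a x0) (c x0) = 0" "mink (b x0) (c x0) = 0"
    and x1: "x1 \<in> W"
  shows "mink (a x1) (a x1) = 0" "mink (b x1) (b x1) = 0" "mink (a x1) (b x1) = h x1"
    "mink (c x1) (c x1) = 1" "mink (a x1) (c x1) = 0" "mink (b x1) (c x1) = 0"
proof -
  define Z :: "real \<times> real \<Rightarrow> real^3^3" where "Z x = vector
    [vector [mink (a x) (a x), mink (a x) (b x) - h x, mink (a x) (c x)],
     vector [mink (a x) (b x) - h x, mink (b x) (b x), mink (b x) (c x)],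
     vector [mink (a x) (c x), mink (b x) (c x), mink (c x) (c x) - 1]]" for x
  have Zn: "Z x $ 1 $ 1 = mink (a x) (a x)" "Z x $ 1 $ 2 = mink (a x) (b x) - h x" "Z x $ 1 $ 3 = mink (a x) (c x)"
    "Z x $ 2 $ 1 = mink (a x) (b x) - h x" "Z x $ 2 $ 2 = mink (b x) (b x)" "Z x $ 2 $ 3 = mink (b x) (c x)"
    "Z x $ 3 $ 1 = mink (a x) (c x)" "Z x $ 3 $ 2 = mink (b x) (c x)" "Z x $ 3 $ 3 = mink (c x) (c x) - 1" for x
    by (simp_all add: Z_def vector_3)
  define A :: "real \<times> real \<Rightarrow> real^3^3" where "A x = vector
    [vector [D1 h x / h x, 0, q x], vector [0, 0, k x], vector [- (k x / h x), - (q x / h x), 0]]" for x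
  define B :: "real \<times> real \<Rightarrow> real^3^3" where "B x = vector
    [vector [0, 0, k x], vector [0, D2 h x / h x, r x], vector [- (r x / h x), - (k x / h x), 0]]" for x
  note smm = smooth_on_mink[OF W(1) sm(1) sm(1)] smooth_on_mink[OF W(1) sm(2) sm(2)] smooth_on_mink[OF W(1) sm(3) sm(3)]
    smooth_on_mink[OF W(1) sm(1) sm(2)] smooth_on_mink[OF W(1) sm(1) sm(3)] smooth_on_mink[OF W(1) sm(2) sm(3)]
    smooth_on_diff[OF W(1) smooth_on_mink[OF W(1) sm(1) sm(2)] co(1)]
    smooth_on_diff[OF W(1) smooth_on_mink[OF W(1) sm(3) sm(3)] smooth_on_const]
  have sZ: "smooth_on Z W"
  proof (rule smooth_on_vec[OF W(1)], rule smooth_on_vec[OF W(1)])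
    fix i j :: 3
    show "smooth_on (\<lambda>x. Z x $ i $ j) W"
      using exhaust_3[of i] exhaust_3[of j] smm by (auto simp: Zn)
  qed
  have smAB: "smooth_on A W" "smooth_on B W"
  proof -
    have 1: "smooth_on (\<lambda>x. D1 h x / h x) W" "smooth_on (\<lambda>x. D2 h x / h x) W" "smooth_on (\<lambda>x. - (k x / h x)) W"
      "smooth_on (\<lambda>x. - (q x / h x)) W" "smooth_on (\<lambda>x. - (r x / h x)) W"
      using W(1) co by (auto intro!: smooth_intros)
    have 2: "smooth_on (\<lambda>x. A x $ i $ j) W" "smooth_on (\<lambda>x. B x $ i $ j) W" for i j :: 3
      using exhaust_3[of i] exhaust_3[of j] 1 co by (auto simp: A_def B_def vector_3 smooth_on_const)
    show "smooth_on A W"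
      by (rule smooth_on_vec[OF W(1) smooth_on_vec[OF W(1) 2(1)]])
    show "smooth_on B W"
      by (rule smooth_on_vec[OF W(1) smooth_on_vec[OF W(1) 2(2)]])
  qed
  have comm: "mink (b x) (a x) = mink (a x) (b x)" "mink (c x) (a x) = mink (a x) (c x)" "mink (c x) (b x) = mink (b x) (c x)" for x
    by (simp_all add: mink_commute)
  note Dm = D_mink[OF sm(1) sm(1)] D_mink[OF sm(2) sm(2)] D_mink[OF sm(3) sm(3)] D_mink[OF sm(1) sm(2)]
    D_mink[OF sm(1) sm(3)] D_mink[OF sm(2) sm(3)]
    D_diff[OF smooth_on_mink[OF W(1) sm(3) sm(3)] smooth_on_const] D_diff[OF smooth_on_mink[OF W(1) sm(1) sm(2)] co(1)]
  have DZ: "D1 Z x = A x ** Z x + Z x ** transpose (A x)" "D2 Z x = B x ** Z x + Z x ** transpose (B x)"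
    if x: "x \<in> W" for x
    unfolding vec_eq_iff forall_3 D_nth[OF sZ x] D_nth[OF smooth_on_nth[OF W(1) sZ] x] Zn
    using co(5)[OF x]
    by (simp_all add: Dm x D1 D2 matrix_matrix_mult_def transpose_def sum_3 Zn A_def B_def vector_3 comm field_simps)
  obtain K where K: "0 < K" "\<And>(A :: real^3^3) (B :: real^3^3). norm (A ** B) \<le> norm A * norm B * K"
    using bounded_bilinear.pos_bounded[OF bounded_bilinear_matrix_mult[where ?'n = 3 and ?'m = 3 and ?'k = 3]] by blast
  define C where "C x = (norm (A x) + norm (transpose (A x)) + norm (B x) + norm (transpose (B x))) * K" for x
  have bd: "norm (M ** Z x + Z x ** transpose M) \<le> C x * norm (Z x)" if "M \<in> {A x, B x}" for M x
  proof -
    have "norm (M ** Z x + Z x ** transpose M) \<le> (norm M + norm (transpose M)) * (norm (Z x) * K)"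
      using norm_triangle_ineq[of "M ** Z x" "Z x ** transpose M"] K(2)[of M "Z x"] K(2)[of "Z x" "transpose M"]
      by (simp add: algebra_simps)
    also have "\<dots> \<le> (norm (A x) + norm (transpose (A x)) + norm (B x) + norm (transpose (B x))) * (norm (Z x) * K)"
      using that K(1) by (intro mult_right_mono) auto
    finally show ?thesis by (simp add: C_def algebra_simps)
  qed
  have bt: "bounded_linear (transpose :: real^3^3 \<Rightarrow> real^3^3)"
    unfolding linear_conv_bounded_linear[symmetric] by (rule linearI) (auto simp: vec_eq_iff transpose_def)
  have "Z x1 = 0"
  proof (rule zero_propagation_partials[of W x0 Z x1 C])
    show "continuous_on W C"
      unfolding C_def using smAB[THEN smooth_on_continuous] smAB[THEN smooth_on_bounded_linear[OF bt W(1)], THEN smooth_on_continuous]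
      by (intro continuous_intros)
    show "Z differentiable (at x)" if "x \<in> W" for x
      using differentiableI[OF smooth_on_has_derivative[OF sZ that]] .
    show "Z x0 = 0"
      using init by (simp add: vec_eq_iff forall_3 Zn)
  qed (use W x1 DZ bd in auto)
  then show "mink (a x1) (a x1) = 0" "mink (b x1) (b x1) = 0" "mink (a x1) (b x1) = h x1"
    "mink (c x1) (c x1) = 1" "mink (a x1) (c x1) = 0" "mink (b x1) (c x1) = 0"
    by (simp_all add: vec_eq_iff forall_3 Zn)
qed

text \<open>Flatness of the frame system, entry by entry: it is equivalent in content to the
  equations of Gauss and Codazzi together with the commuting second derivatives of
  \<open>h\<close>.\<close>

lemma frame_flat:
  fixes h k q r :: "real \<times> real \<Rightarrow> real"
  assumes W: "open W" and co: "smooth_on h W" "smooth_on k W" "smooth_on q W" "smooth_on r W"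
      "smooth_on l W" "smooth_on m W" "\<And>x. x \<in> W \<Longrightarrow> h x \<noteq> 0"
    and l: "\<And>x. x \<in> W \<Longrightarrow> D1 h x = l x * h x" and m: "\<And>x. x \<in> W \<Longrightarrow> D2 h x = m x * h x"
    and codazzi: "\<And>x. x \<in> W \<Longrightarrow> D2 q x = D1 k x - l x * k x" "\<And>x. x \<in> W \<Longrightarrow> D1 r x = D2 k x - m x * k x"
    and gauss: "\<And>x. x \<in> W \<Longrightarrow> D2 l x = q x * r x / h x - k x * k x / h x" "\<And>x. x \<in> W \<Longrightarrow> D1 m x = D2 l x"
    and x: "x \<in> W"
  shows "D2 (\<lambda>x. frame_u (l x) (k x) (q x) (h x)) x + frame_u (l x) (k x) (q x) (h x) ** frame_v (m x) (k x) (r x) (h x) =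
    D1 (\<lambda>x. frame_v (m x) (k x) (r x) (h x)) x + frame_v (m x) (k x) (r x) (h x) ** frame_u (l x) (k x) (q x) (h x)"
proof -
  \<comment> \<open>Quotient rule with the derivatives of \<open>h\<close> replaced by the
    logarithmic ones, the form in which the entries of the last row cancel.\<close>
  have quot: "D1 (\<lambda>x. - (g x / h x)) x = - (D1 g x / h x - l x * g x / h x)"
    "D2 (\<lambda>x. - (g x / h x)) x = - (D2 g x / h x - m x * g x / h x)" if g: "smooth_on g W" for g
  proof -
    have s: "smooth_on (\<lambda>x. g x / h x) W" using W g co(1,7) by (intro smooth_intros)
    have gh: "g y = (g y / h y) * h y" if "y \<in> W" for y using co(7)[OF that] by simp
    have "D1 g x = (g x / h x) * D1 h x + D1 (\<lambda>x. g x / h x) x * h x" "D2 g x = (g x / h x) * D2 h x + D2 (\<lambda>x. g x / h x) x * h x"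
      using D_cong[OF W x gh] D_mult[OF s co(1) x] by auto
    then show "D1 (\<lambda>x. - (g x / h x)) x = - (D1 g x / h x - l x * g x / h x)"
      "D2 (\<lambda>x. - (g x / h x)) x = - (D2 g x / h x - m x * g x / h x)"
      using D_linear[OF bounded_linear_minus[OF bounded_linear_ident] s x] co(7)[OF x] l[OF x] m[OF x]
      by (auto simp: field_simps)
  qed
  have sU: "smooth_on (\<lambda>x. frame_u (l x) (k x) (q x) (h x)) W" and sV: "smooth_on (\<lambda>x. frame_v (m x) (k x) (r x) (h x)) W"
    by (rule smooth_on_frame[OF W co(5,2,3,1,7)], assumption) (rule smooth_on_frame[OF W co(6,2,4,1,7)])
  have D: "D2 (\<lambda>x. frame_u (l x) (k x) (q x) (h x)) x $ i $ j = D2 (\<lambda>x. frame_u (l x) (k x) (q x) (h x) $ i $ j) x"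
    "D1 (\<lambda>x. frame_v (m x) (k x) (r x) (h x)) x $ i $ j = D1 (\<lambda>x. frame_v (m x) (k x) (r x) (h x) $ i $ j) x" for i j
    unfolding D_nth[OF sU x] D_nth[OF sV x] D_nth[OF smooth_on_nth[OF W sU] x] D_nth[OF smooth_on_nth[OF W sV] x] by simp_all
  have nn: "frame_u a b c d $ 1 = vec4 0 1 0 0" "frame_u a b c d $ 2 = vec4 0 a 0 c" "frame_u a b c d $ 3 = vec4 0 0 0 b"
    "frame_u a b c d $ 4 = vec4 0 (- (b / d)) (- (c / d)) 0"
    "frame_v a b c d $ 1 = vec4 0 0 1 0" "frame_v a b c d $ 2 = vec4 0 0 0 b" "frame_v a b c d $ 3 = vec4 0 0 a c"
    "frame_v a b c d $ 4 = vec4 0 (- (c / d)) (- (b / d)) 0" for a b c d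
    by (simp_all add: frame_u_def frame_v_def)
  show ?thesis
    unfolding vec4_eq_iff
    by (simp add: D nn matrix_matrix_mult_def sum_4 quot co codazzi[OF x] gauss[OF x] diff_divide_distrib algebra_simps)
qed

lemma smooth_on_slice:
  fixes f :: "real \<times> real \<times> real \<Rightarrow> 'z::real_normed_vector"
  assumes "smooth_on f (T \<times> B)" "open T" "open B" "t \<in> T"
  shows "smooth_on (\<lambda>x. f (t, x)) B"
  by (rule smooth_on_compose[OF assms(3) open_Times[OF assms(2,3)] _ _ assms(1)])
     (use assms in \<open>auto intro!: smooth_intros\<close>)

lemma connected_rectangle: "connected (ball (u::real) d \<times> ball (v::real) d)"
  by (intro convex_connected convex_Times convex_ball)

context null_surface
begin

text \<open>The existence part of the fundamental theorem, with a parameter. The Codazzi equations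
  see only \<open>D2 Q\<close> and \<open>D1 R\<close>, the Gauss equation only the product, so the
  hypotheses say precisely that \<open>h\<close>, \<open>k\<close>, \<open>q\<close> and
  \<open>\<rho>\<close> satisfy all compatibility conditions at each t.\<close>

lemma deformation:
  fixes q \<rho> :: "real \<times> real \<times> real \<Rightarrow> real"
  assumes x0: "(u0, v0) \<in> W" and \<epsilon>: "\<epsilon> > 0"
    and q: "smooth_on q (ball 0 \<epsilon> \<times> W)" and \<rho>: "smooth_on \<rho> (ball 0 \<epsilon> \<times> W)"
    and codazzi: "\<And>t x. t \<in> ball 0 \<epsilon> \<Longrightarrow> x \<in> W \<Longrightarrow> D2 (\<lambda>x. q (t, x)) x = D2 Q x"
      "\<And>t x. t \<in> ball 0 \<epsilon> \<Longrightarrow> x \<in> W \<Longrightarrow> D1 (\<lambda>x. \<rho> (t, x)) x = D1 R x"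
    and gauss: "\<And>t x. t \<in> ball 0 \<epsilon> \<Longrightarrow> x \<in> W \<Longrightarrow> q (t, x) * \<rho> (t, x) = Q x * R x"
    and init: "\<And>x. x \<in> W \<Longrightarrow> q (0, x) = Q x" "\<And>x. x \<in> W \<Longrightarrow> \<rho> (0, x) = R x"
  obtains d \<delta> F N where "d > 0" "\<delta> > 0" "\<delta> \<le> \<epsilon>" "ball u0 d \<times> ball v0 d \<subseteq> W"
    "smooth_on F (ball 0 \<delta> \<times> ball u0 d \<times> ball v0 d)" "smooth_on N (ball 0 \<delta> \<times> ball u0 d \<times> ball v0 d)"
    "\<And>t. t \<in> ball 0 \<delta> \<Longrightarrow> null_surface (ball u0 d \<times> ball v0 d) (\<lambda>x. F (t, x)) (\<lambda>x. N (t, x))"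
    "\<And>t x. t \<in> ball 0 \<delta> \<Longrightarrow> x \<in> ball u0 d \<times> ball v0 d \<Longrightarrow> null_surface.h (\<lambda>x. F (t, x)) x = h x"
    "\<And>t x. t \<in> ball 0 \<delta> \<Longrightarrow> x \<in> ball u0 d \<times> ball v0 d \<Longrightarrow> null_surface.k (\<lambda>x. F (t, x)) (\<lambda>x. N (t, x)) x = k x"
    "\<And>t x. t \<in> ball 0 \<delta> \<Longrightarrow> x \<in> ball u0 d \<times> ball v0 d \<Longrightarrow> Q_coeff (\<lambda>x. F (t, x)) (\<lambda>x. N (t, x)) x = q (t, x)"
    "\<And>x. x \<in> ball u0 d \<times> ball v0 d \<Longrightarrow> F (0, x) = f x" "\<And>x. x \<in> ball u0 d \<times> ball v0 d \<Longrightarrow> N (0, x) = n x"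
proof -
  let ?S = "ball (0::real) \<epsilon> \<times> W"
  have oS: "open ?S" using open_W by (intro open_Times open_ball)
  define U where "U y = frame_u (l (snd y)) (k (snd y)) (q y) (h (snd y))" for y
  define V where "V y = frame_v (r (snd y)) (k (snd y)) (\<rho> y) (h (snd y))" for y
  have sndS: "smooth_on (\<lambda>y. g (snd y)) ?S" if "smooth_on g W" for g :: "real \<times> real \<Rightarrow> real"
    by (rule smooth_on_compose[OF oS open_W _ _ that]) (use oS in \<open>auto intro!: smooth_intros\<close>)
  have hS: "h (snd y) \<noteq> 0" if "y \<in> ?S" for y using that h_nonzero by auto
  have sU: "smooth_on U ?S" and sV: "smooth_on V ?S"
    unfolding U_def V_def
    using smooth_on_frame[OF oS sndS[OF smooth_l] sndS[OF smooth_k] q sndS[OF smooth_h] hS]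
      smooth_on_frame[OF oS sndS[OF smooth_r] sndS[OF smooth_k] \<rho> sndS[OF smooth_h] hS] by simp_all
  \<comment> \<open>A common bound for both coefficient matrices near the base point; the summand 1
    makes it strict, so that it persists on a neighbourhood.\<close>
  define C where "C = norm (U (0, u0, v0)) + norm (V (0, u0, v0)) + 1"
  have z: "(0, u0, v0) \<in> ?S" using x0 \<epsilon> by simp
  have "isCont (\<lambda>y. norm (U y)) (0, u0, v0)" "isCont (\<lambda>y. norm (V y)) (0, u0, v0)"
    using continuous_on_eq_continuous_at[OF oS] smooth_on_continuous[OF sU] smooth_on_continuous[OF sV] z
    by (blast intro: continuous_norm)+
  then have "((\<lambda>y. norm (U y)) \<longlongrightarrow> norm (U (0, u0, v0))) (nhds (0, u0, v0))"
    "((\<lambda>y. norm (V y)) \<longlongrightarrow> norm (V (0, u0, v0))) (nhds (0, u0, v0))"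
    using tendsto_at_iff_tendsto_nhds[of "\<lambda>y. norm (U y)" "(0, u0, v0)"]
      tendsto_at_iff_tendsto_nhds[of "\<lambda>y. norm (V y)" "(0, u0, v0)"] by (simp_all add: isCont_def)
  then have "\<forall>\<^sub>F y in nhds (0, u0, v0). norm (U y) < C" "\<forall>\<^sub>F y in nhds (0, u0, v0). norm (V y) < C"
    by (auto elim!: order_tendstoD simp: C_def add_nonneg_pos add_strict_increasing)
  moreover have "\<forall>\<^sub>F y in nhds (0, u0, v0). y \<in> ?S" using oS z by (rule eventually_nhds_in_open)
  ultimately have "\<forall>\<^sub>F y in nhds (0, u0, v0). y \<in> ?S \<and> norm (U y) < C \<and> norm (V y) < C"
    by (auto intro: eventually_conj)
  then obtain T1 where T1: "open T1" "(0, u0, v0) \<in> T1" "\<And>y. y \<in> T1 \<Longrightarrow> y \<in> ?S \<and> norm (U y) < C \<and> norm (V y) < C"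
    unfolding eventually_nhds by blast
  obtain A1 A2 where A: "open A1" "open A2" "(0, u0, v0) \<in> A1 \<times> A2" "A1 \<times> A2 \<subseteq> T1"
    using open_prod_elim[OF T1(1,2)] by blast
  obtain \<delta>0 where \<delta>0: "\<delta>0 > 0" "ball 0 \<delta>0 \<subseteq> A1"
    using A(1,3) openE by blast
  obtain e where e: "e > 0" "{u0-e..u0+e} \<times> {v0-e..v0+e} \<subseteq> A2"
    using open_contains_rectangle A(2,3) by blast
  obtain K where K: "0 < K" "\<And>(A :: real^4^4) (B :: real^3^4). norm (A ** B) \<le> norm A * norm B * K"
    using bounded_bilinear.pos_bounded[OF bounded_bilinear_matrix_mult[where ?'n = 4 and ?'m = 4 and ?'k = 3]] by blast
  define L where "L = C * K"
  have L0: "L > 0" using K by (simp add: L_def C_def add_nonneg_pos)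
  \<comment> \<open>The rectangle is shrunk until \<open>L * d < 1\<close>, the condition under
    which the linear systems are solved.\<close>
  define d where "d = min e (1 / (2 * L))"
  define \<delta> where "\<delta> = min \<delta>0 \<epsilon>"
  have d: "d > 0" "d \<le> e" "L * d < 1"
    using e L0 by (auto simp: d_def min_def field_simps)
  have \<delta>: "\<delta> > 0" "\<delta> \<le> \<delta>0" "\<delta> \<le> \<epsilon>" using \<delta>0 \<epsilon> by (auto simp: \<delta>_def)
  let ?B = "ball u0 d \<times> ball v0 d" and ?T = "ball (0::real) \<delta>"
  have "?B \<subseteq> {u0-e..u0+e} \<times> {v0-e..v0+e}" using d(2) by (auto simp: dist_real_def)
  then have TB1: "?T \<times> ?B \<subseteq> T1" using e(2) \<delta>0(2) \<delta>(2) A(4) by (fastforce simp: subset_iff)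
  then have TB: "?T \<times> ?B \<subseteq> ?S" using T1(3) by blast
  have BW: "?B \<subseteq> W"
  proof
    fix x assume "x \<in> ?B"
    then have "(0, x) \<in> ?T \<times> ?B" using \<delta>(1) by simp
    then have "(0, x) \<in> ?S" by (rule subsetD[OF TB])
    then show "x \<in> W" by simp
  qed
  have oB: "open ?B" and oTB: "open (?T \<times> ?B)" by (intro open_Times open_ball)+
  have xB: "(u0, v0) \<in> ?B" using d(1) by simp
  have TE: "t \<in> ball 0 \<epsilon>" if "t \<in> ?T" for t using that \<delta>(3) by auto
  have bnd: "norm (M ** \<xi>) \<le> L * norm \<xi>" if "M \<in> {U y, V y}" "y \<in> ?T \<times> ?B" for M y and \<xi> :: "real^3^4"
  proof -
    have "norm M \<le> C" using T1(3)[OF subsetD[OF TB1 that(2)]] that(1) by auto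
    then have "norm M * (norm \<xi> * K) \<le> C * (norm \<xi> * K)"
      using K(1) by (intro mult_right_mono) auto
    then show ?thesis using K(2)[of M \<xi>] by (simp add: L_def algebra_simps)
  qed
  have flat: "D2 (\<lambda>x. U (t, x)) x + U (t, x) ** V (t, x) = D1 (\<lambda>x. V (t, x)) x + V (t, x) ** U (t, x)"
    if t: "t \<in> ?T" and x: "x \<in> ?B" for t x
    unfolding U_def V_def snd_conv
  proof (rule frame_flat[OF oB])
    have xW: "x \<in> W" if "x \<in> ?B" for x using that BW by blast
    show "smooth_on (\<lambda>x. q (t, x)) ?B" "smooth_on (\<lambda>x. \<rho> (t, x)) ?B"
      using smooth_on_slice[OF q open_ball open_W TE[OF t]] smooth_on_slice[OF \<rho> open_ball open_W TE[OF t]]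
        smooth_on_subset BW by blast+
    fix x assume "x \<in> ?B"
    then have x: "x \<in> W" using xW by blast
    show "h x \<noteq> 0" "D1 h x = l x * h x" "D2 h x = r x * h x" "D1 r x = D2 l x"
      using h_nonzero[OF x] D1_r[OF x] by (simp_all add: l_def r_def)
    show "D2 (\<lambda>x. q (t, x)) x = D1 k x - l x * k x" "D1 (\<lambda>x. \<rho> (t, x)) x = D2 k x - r x * k x"
      using codazzi[OF TE[OF t] x] codazzi_gauss(1,2)[OF x] by (simp_all add: l_def r_def)
    show "D2 l x = q (t, x) * \<rho> (t, x) / h x - k x * k x / h x"
      using codazzi_gauss(3)[OF x] gauss[OF TE[OF t] x] by (simp add: l_def[abs_def])
  qed (use x smooth_on_subset[OF _ BW] smooth_h smooth_k smooth_l smooth_r in auto)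
  obtain X where X: "smooth_on X (?T \<times> ?B)" "\<And>t. t \<in> ?T \<Longrightarrow> X (t, u0, v0) = frame (u0, v0)"
    "\<And>t x. t \<in> ?T \<Longrightarrow> x \<in> ?B \<Longrightarrow> D1 (\<lambda>x. X (t, x)) x = U (t, x) ** X (t, x)"
    "\<And>t x. t \<in> ?T \<Longrightarrow> x \<in> ?B \<Longrightarrow> D2 (\<lambda>x. X (t, x)) x = V (t, x) ** X (t, x)"
  proof (rule flat_system_solution[where m = "(**) :: real^4^4 \<Rightarrow> real^3^4 \<Rightarrow> real^3^4" and T = ?T and U = U and W = V
        and L = L and d = d and ?u0.0 = u0 and ?v0.0 = v0 and ?x0.0 = "\<lambda>_. frame (u0, v0)"])
    show "smooth_on U (?T \<times> ?B)" "smooth_on V (?T \<times> ?B)"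
      using smooth_on_subset[OF sU TB] smooth_on_subset[OF sV TB] .
    show "D2 (\<lambda>x. U (t, x)) x ** \<xi> + U (t, x) ** (V (t, x) ** \<xi>) = D1 (\<lambda>x. V (t, x)) x ** \<xi> + V (t, x) ** (U (t, x) ** \<xi>)"
      if "t \<in> ?T" "x \<in> ?B" for t x and \<xi> :: "real^3^4"
      using arg_cong[OF flat[OF that], of "\<lambda>M. M ** \<xi>"] by (simp add: bounded_bilinear.add_left[OF bounded_bilinear_matrix_mult] matrix_mul_assoc)
    show "norm (U y ** \<xi>) \<le> L * norm \<xi>" "norm (V y ** \<xi>) \<le> L * norm \<xi>" if "y \<in> ?T \<times> ?B" for y and \<xi> :: "real^3^4"
      using bnd[OF _ that] by simp_all
  qed (use bounded_bilinear_matrix_mult L0 d that in \<open>auto simp: smooth_on_const\<close>)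
  define F where "F y = X y $ 1" for y
  define N where "N y = X y $ 4" for y
  have sF: "smooth_on F (?T \<times> ?B)" and sN: "smooth_on N (?T \<times> ?B)"
    unfolding F_def N_def by (intro smooth_on_nth oTB X(1))+
  have surf: "null_surface ?B (\<lambda>x. F (t, x)) (\<lambda>x. N (t, x)) \<and>
      D1 (\<lambda>x. F (t, x)) (u0, v0) = D1 f (u0, v0) \<and> D2 (\<lambda>x. F (t, x)) (u0, v0) = D2 f (u0, v0) \<and>
      (\<forall>x\<in>?B. null_surface.h (\<lambda>x. F (t, x)) x = h x \<and>
        null_surface.k (\<lambda>x. F (t, x)) (\<lambda>x. N (t, x)) x = k x \<and>
        Q_coeff (\<lambda>x. F (t, x)) (\<lambda>x. N (t, x)) x = q (t, x) \<and> R_coeff (\<lambda>x. F (t, x)) (\<lambda>x. N (t, x)) x = \<rho> (t, x))"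
    if t: "t \<in> ?T" for t
  proof -
    define Xt where "Xt = (\<lambda>x. X (t, x))"
    define Ft where "Ft = (\<lambda>x. F (t, x))"
    define Nt where "Nt = (\<lambda>x. N (t, x))"
    define a where "a x = Xt x $ 2" for x
    define b where "b x = Xt x $ 3" for x
    have sX: "smooth_on Xt ?B"
      unfolding Xt_def by (rule smooth_on_slice[OF X(1) open_ball oB t])
    have rows: "(\<lambda>x. Xt x $ 1) = Ft" "(\<lambda>x. Xt x $ 2) = a" "(\<lambda>x. Xt x $ 3) = b" "(\<lambda>x. Xt x $ 4) = Nt"
      "Xt x $ 1 = Ft x" "Xt x $ 2 = a x" "Xt x $ 3 = b x" "Xt x $ 4 = Nt x" for x
      by (simp_all add: fun_eq_iff Xt_def Ft_def Nt_def F_def N_def a_def b_def)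
    have s: "smooth_on Ft ?B" "smooth_on a ?B" "smooth_on b ?B" "smooth_on Nt ?B"
      using smooth_on_nth[OF oB sX, of 1] smooth_on_nth[OF oB sX, of 2] smooth_on_nth[OF oB sX, of 3] smooth_on_nth[OF oB sX, of 4]
      unfolding rows .
    have DX1: "D1 Ft x = a x" "D1 a x = (D1 h x / h x) *\<^sub>R a x + q (t, x) *\<^sub>R Nt x" "D1 b x = k x *\<^sub>R Nt x"
      "D1 Nt x = (- (k x / h x)) *\<^sub>R a x + (- (q (t, x) / h x)) *\<^sub>R b x"
      and DX2: "D2 Ft x = b x" "D2 a x = k x *\<^sub>R Nt x" "D2 b x = (D2 h x / h x) *\<^sub>R b x + \<rho> (t, x) *\<^sub>R Nt x"
      "D2 Nt x = (- (\<rho> (t, x) / h x)) *\<^sub>R a x + (- (k x / h x)) *\<^sub>R b x" if x: "x \<in> ?B" for x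
    proof -
      have 1: "D1 Xt x $ i = (\<Sum>j\<in>UNIV. U (t, x) $ i $ j *\<^sub>R Xt x $ j)"
        and 2: "D2 Xt x $ i = (\<Sum>j\<in>UNIV. V (t, x) $ i $ j *\<^sub>R Xt x $ j)" for i
        using X(3,4)[OF t x] by (simp_all add: Xt_def matrix_mult_row)
      note nd = D_nth[OF sX x]
      show "D1 Ft x = a x" "D1 a x = (D1 h x / h x) *\<^sub>R a x + q (t, x) *\<^sub>R Nt x" "D1 b x = k x *\<^sub>R Nt x"
        "D1 Nt x = (- (k x / h x)) *\<^sub>R a x + (- (q (t, x) / h x)) *\<^sub>R b x"
        using 1[of 1] 1[of 2] 1[of 3] 1[of 4] unfolding nd rows
        by (simp_all add: sum_4 U_def frame_u_def rows l_def)
      show "D2 Ft x = b x" "D2 a x = k x *\<^sub>R Nt x" "D2 b x = (D2 h x / h x) *\<^sub>R b x + \<rho> (t, x) *\<^sub>R Nt x"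
        "D2 Nt x = (- (\<rho> (t, x) / h x)) *\<^sub>R a x + (- (k x / h x)) *\<^sub>R b x"
        using 2[of 1] 2[of 2] 2[of 3] 2[of 4] unfolding nd rows
        by (simp_all add: sum_4 V_def frame_v_def rows r_def)
    qed
    have x0W: "(u0, v0) \<in> W" by (rule x0)
    have init0: "Ft (u0, v0) = f (u0, v0)" "a (u0, v0) = D1 f (u0, v0)" "b (u0, v0) = D2 f (u0, v0)" "Nt (u0, v0) = n (u0, v0)"
      using X(2)[OF t] by (simp_all add: frame_def Xt_def Ft_def Nt_def F_def N_def a_def b_def)
    have hB: "h x \<noteq> 0" if "x \<in> ?B" for x using h_nonzero BW that by blast
    note sub = smooth_on_subset[OF _ BW]
    have gram: "mink (a x) (a x) = 0" "mink (b x) (b x) = 0" "mink (a x) (b x) = h x"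
      "mink (Nt x) (Nt x) = 1" "mink (a x) (Nt x) = 0" "mink (b x) (Nt x) = 0" if "x \<in> ?B" for x
      using gram_conservation[OF oB connected_rectangle xB s(2-4) sub[OF smooth_h] sub[OF smooth_k]
          sub[OF smooth_on_slice[OF q open_ball open_W TE[OF t]]] sub[OF smooth_on_slice[OF \<rho> open_ball open_W TE[OF t]]]
          hB DX1(2-4) DX2(2-4) _ _ _ _ _ _ that]
        null[OF x0] unit[OF x0] orth[OF x0] h_def init0 by simp_all
    have ns: "null_surface ?B Ft Nt"
      by unfold_locales (use oB s DX1 DX2 gram hB in auto)
    interpret t: null_surface ?B Ft Nt by (rule ns)
    have "t.h x = h x \<and> t.k x = k x \<and> t.Q x = q (t, x) \<and> t.R x = \<rho> (t, x)" if x: "x \<in> ?B" for x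
    proof -
      have "D1 (D1 Ft) x = D1 a x" "D1 (D2 Ft) x = D1 b x" "D2 (D2 Ft) x = D2 b x"
        using D_cong[OF oB x, of "D1 Ft" a] D_cong[OF oB x, of "D2 Ft" b] DX1(1) DX2(1) by auto
      then show ?thesis
        using gram[OF x] DX1[OF x] DX2[OF x]
        by (simp add: t.h_def t.k_def Q_coeff_def R_coeff_def)
    qed
    then show ?thesis
      using ns DX1(1)[OF xB] DX2(1)[OF xB] init0 unfolding Ft_def Nt_def by simp
  qed
  have t0: "0 \<in> ?T" using \<delta>(1) by simp
  \<comment> \<open>At t = 0 all data are those of the given surface, and every t starts from its
    frame at the base point; \<open>rigidity\<close> with the identity map applies.\<close>
  have "F (0, x) = f x \<and> N (0, x) = n x" if x: "x \<in> ?B" for x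
  proof -
    have "null_surface ?B f n"
      by (rule null_surface_subset[OF null_surface_axioms BW oB])
    note R = this conjunct1[OF surf[OF t0]] connected_rectangle xB x
    have "F (0, x) = f x + 0"
      by (rule rigidity(1)[OF R _ _ _ _ bounded_linear.linear[OF bounded_linear_ident]])
         (use surf[OF t0] init BW X(2)[OF t0] in \<open>auto simp: frame_def F_def N_def subset_iff\<close>)
    moreover have "N (0, x) = n x"
      by (rule rigidity(2)[OF R _ _ _ _ bounded_linear.linear[OF bounded_linear_ident], where b = 0])
         (use surf[OF t0] init BW X(2)[OF t0] in \<open>auto simp: frame_def F_def N_def subset_iff\<close>)
    ultimately show ?thesis by simp
  qed
  then show ?thesis
    using that[OF d(1) \<delta>(1,3) BW sF sN] surf by blast
qed

end

section \<open>Isothermic coordinates: the dual surface and the Bonnet deformation\<close>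

lemma D2_of_fst:
  assumes "open S" "smooth_on g S" "x \<in> S" "\<And>y. y \<in> S \<Longrightarrow> g y = G (fst y)"
  shows "D2 g x = 0"
proof -
  obtain u v where x: "x = (u, v)" by (cases x)
  obtain e where e: "e > 0" "{u-e..u+e} \<times> {v-e..v+e} \<subseteq> S"
    using open_contains_rectangle assms(1,3) x by metis
  have "((\<lambda>s. g (u, s)) has_vector_derivative 0) (at v)"
  proof (rule has_vector_derivative_transform_within_open[OF has_vector_derivative_const open_ball[of v e]])
    show "G u = g (u, s)" if "s \<in> ball v e" for s
    proof -
      have "(u, s) \<in> {u-e..u+e} \<times> {v-e..v+e}" using that e(1) by (auto simp: dist_real_def)
      then have "(u, s) \<in> S" using e(2) by blast
      then show ?thesis using assms(4) by force
    qed
  qed (use e in simp)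
  then show ?thesis
    using vector_derivative_unique_at[OF smooth_on_partials(2)[OF assms(2), of u v]] assms(3) x by blast
qed

lemma D1_of_snd:
  assumes "open S" "smooth_on g S" "x \<in> S" "\<And>y. y \<in> S \<Longrightarrow> g y = G (snd y)"
  shows "D1 g x = 0"
proof -
  obtain u v where x: "x = (u, v)" by (cases x)
  obtain e where e: "e > 0" "{u-e..u+e} \<times> {v-e..v+e} \<subseteq> S"
    using open_contains_rectangle assms(1,3) x by metis
  have "((\<lambda>s. g (s, v)) has_vector_derivative 0) (at u)"
  proof (rule has_vector_derivative_transform_within_open[OF has_vector_derivative_const open_ball[of u e]])
    show "G v = g (s, v)" if "s \<in> ball u e" for s
    proof -
      have "(s, v) \<in> {u-e..u+e} \<times> {v-e..v+e}" using that e(1) by (auto simp: dist_real_def)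
      then have "(s, v) \<in> S" using e(2) by blast
      then show ?thesis using assms(4) by force
    qed
  qed (use e in simp)
  then show ?thesis
    using vector_derivative_unique_at[OF smooth_on_partials(1)[OF assms(2), of u v]] assms(3) x by blast
qed

lemma separation_of_variables:
  fixes p :: "real \<times> real \<Rightarrow> 'b::euclidean_space"
  assumes p: "smooth_on p (ball u0 e \<times> ball v0 e)" and e: "e > 0"
    and harmonic: "\<And>x. x \<in> ball u0 e \<times> ball v0 e \<Longrightarrow> D2 (D1 p) x = 0"
    and x: "u \<in> ball u0 e" "v \<in> ball v0 e"
  shows "p (u, v) = p (u, v0) + (p (u0, v) - p (u0, v0))"
proof -
  have c: "u0 \<in> ball u0 e" "v0 \<in> ball v0 e" using e by auto
  have D: "D1 p (u', v) = D1 p (u', v0)" if u': "u' \<in> ball u0 e" for u'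
  proof -
    have "((\<lambda>s. D1 p (u', s)) has_derivative (\<lambda>h. 0)) (at s within ball v0 e)" if "s \<in> ball v0 e" for s
      using smooth_on_partials(2)[OF smooth_on_D1[OF p], of u' s] harmonic[of "(u', s)"] u' that
      by (auto simp: has_vector_derivative_def intro: has_derivative_at_withinI)
    then show ?thesis
      using has_derivative_zero_constant[OF convex_ball, of v0 e "\<lambda>s. D1 p (u', s)"] x(2) c(2) by metis
  qed
  have "((\<lambda>s. p (s, v) - p (s, v0)) has_derivative (\<lambda>h. 0)) (at s within ball u0 e)" if s: "s \<in> ball u0 e" for s
  proof -
    have "((\<lambda>s. p (s, v) - p (s, v0)) has_vector_derivative D1 p (s, v) - D1 p (s, v0)) (at s)"
      using s x c by (intro has_vector_derivative_diff smooth_on_partials(1)[OF p]) auto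
    then show ?thesis
      unfolding D[OF s] has_vector_derivative_def by (auto intro: has_derivative_at_withinI)
  qed
  then have "p (u, v) - p (u, v0) = p (u0, v) - p (u0, v0)"
    using has_derivative_zero_constant[OF convex_ball, of u0 e "\<lambda>s. p (s, v) - p (s, v0)"] x(1) c(1) by metis
  then show ?thesis by (simp add: algebra_simps)
qed

text \<open>Instantiated twice: for the given surface, and for its dual in the same coordinates,
  with the mean curvature of the given surface in the place of \<open>q\<close>.\<close>

locale isothermic_patch = null_surface +
  fixes s :: real and q :: "real \<times> real \<Rightarrow> real" and \<rho> \<sigma> :: "real \<Rightarrow> real"
  assumes s: "s = 1 \<or> s = -1"
    and smooth_\<rho>: "smooth_on \<rho> (fst ` W)" and smooth_\<sigma>: "smooth_on \<sigma> (snd ` W)"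
    and pos: "x \<in> W \<Longrightarrow> \<rho> (fst x) > 0" "x \<in> W \<Longrightarrow> \<sigma> (snd x) > 0"
    and Q_eq: "x \<in> W \<Longrightarrow> Q x = 1/2 * q x * \<rho> (fst x)"
    and R_eq: "x \<in> W \<Longrightarrow> R x = s * (1/2 * q x * \<sigma> (snd x))"
begin

lemma smooth_\<rho>_fst: "smooth_on (\<lambda>x. \<rho> (fst x)) W"
  by (rule smooth_on_compose[OF open_W open_image_fst[OF open_W] _ _ smooth_\<rho>]) (use open_W in \<open>auto intro!: smooth_intros\<close>)

lemma smooth_\<sigma>_snd: "smooth_on (\<lambda>x. \<sigma> (snd x)) W"
  by (rule smooth_on_compose[OF open_W open_image_snd[OF open_W] _ _ smooth_\<sigma>]) (use open_W in \<open>auto intro!: smooth_intros\<close>)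

text \<open>The factors are those of the Christoffel transform, since exp(-omega) is 1 / (2 h) where
  h > 0. The defining form is closed exactly because of the isothermic condition, and its primitive
  has the second fundamental form with \<open>q\<close> and \<open>H\<close> exchanged.\<close>

lemma dual_exists:
  assumes "simply_connected W"
  obtains g where "null_surface W g n"
    "\<And>x. x \<in> W \<Longrightarrow> D1 g x = (\<rho> (fst x) / (2 * h x)) *\<^sub>R D2 f x"
    "\<And>x. x \<in> W \<Longrightarrow> D2 g x = (s * \<sigma> (snd x) / (2 * h x)) *\<^sub>R D1 f x"
    "\<And>x. x \<in> W \<Longrightarrow> null_surface.h g x = s * (\<rho> (fst x) * \<sigma> (snd x) / (4 * h x))"
    "\<And>x. x \<in> W \<Longrightarrow> null_surface.H g n x = q x"
    "\<And>x. x \<in> W \<Longrightarrow> Q_coeff g n x = 1/2 * H x * \<rho> (fst x)"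
    "\<And>x. x \<in> W \<Longrightarrow> R_coeff g n x = s * (1/2 * H x * \<sigma> (snd x))"
proof -
  have ss: "s * s = 1" "s \<noteq> 0" using s by auto
  define A where "A x = \<rho> (fst x) / (2 * h x)" for x
  define B where "B x = s * \<sigma> (snd x) / (2 * h x)" for x
  have sAB: "smooth_on A W" "smooth_on B W"
    unfolding A_def B_def using open_W smooth_\<rho>_fst smooth_\<sigma>_snd smooth_h h_nonzero by (auto intro!: smooth_intros)
  \<comment> \<open>The product \<open>A h\<close> depends on u only. This cancels the tangential
    term in the v-derivative of \<open>A f_v\<close>, leaving a multiple of the normal.\<close>
  have DA: "D2 A x = - (A x * D2 h x / h x)" if x: "x \<in> W" for x
  proof -
    have "D2 (\<lambda>y. A y * h y) x = D2 (\<lambda>y. \<rho> (fst y) / 2) x"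
      by (rule D_cong(2)[OF open_W x]) (use h_nonzero in \<open>simp add: A_def\<close>)
    also have "\<dots> = 0"
      by (rule D2_of_fst[OF open_W _ x, where G = "\<lambda>u. \<rho> u / 2"])
         (use open_W smooth_\<rho>_fst in \<open>auto intro!: smooth_intros\<close>)
    finally have "A x * D2 h x + D2 A x * h x = 0"
      using D_mult(2)[OF sAB(1) smooth_h x] by simp
    then show ?thesis using h_nonzero[OF x] by (simp add: field_simps add_eq_0_iff)
  qed
  have DB: "D1 B x = - (B x * D1 h x / h x)" if x: "x \<in> W" for x
  proof -
    have "D1 (\<lambda>y. B y * h y) x = D1 (\<lambda>y. s * \<sigma> (snd y) / 2) x"
      by (rule D_cong(1)[OF open_W x]) (use h_nonzero in \<open>simp add: B_def\<close>)
    also have "\<dots> = 0"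
      by (rule D1_of_snd[OF open_W _ x, where G = "\<lambda>v. s * \<sigma> v / 2"])
         (use open_W smooth_\<sigma>_snd in \<open>auto intro!: smooth_intros\<close>)
    finally have "B x * D1 h x + D1 B x * h x = 0"
      using D_mult(1)[OF sAB(2) smooth_h x] by simp
    then show ?thesis using h_nonzero[OF x] by (simp add: field_simps add_eq_0_iff)
  qed
  have sP: "smooth_on (\<lambda>x. A x *\<^sub>R D2 f x) W" "smooth_on (\<lambda>x. B x *\<^sub>R D1 f x) W"
    by (intro smooth_on_scaleR open_W sAB sm)+
  have DP: "D2 (\<lambda>x. A x *\<^sub>R D2 f x) x = (A x * R x) *\<^sub>R n x" "D1 (\<lambda>x. B x *\<^sub>R D1 f x) x = (B x * Q x) *\<^sub>R n x"
    if x: "x \<in> W" for x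
    using D_scaleR[OF sAB(1) sm(4) x] D_scaleR[OF sAB(2) sm(3) x]
    by (simp_all add: DA[OF x] DB[OF x] gauss_weingarten[OF x] algebra_simps)
  \<comment> \<open>Closedness amounts to A R = B Q, which is the isothermic condition.\<close>
  have "D2 (\<lambda>x. A x *\<^sub>R D2 f x) x = D1 (\<lambda>x. B x *\<^sub>R D1 f x) x" if "x \<in> W" for x
    unfolding DP[OF that] by (simp add: A_def B_def Q_eq[OF that] R_eq[OF that])
  then obtain g where g: "\<And>x. x \<in> W \<Longrightarrow> (g has_derivative (\<lambda>w. fst w *\<^sub>R (A x *\<^sub>R D2 f x) + snd w *\<^sub>R (B x *\<^sub>R D1 f x))) (at x)"
    using closed_form_exact_simply_connected[OF open_W assms sP] by blast
  have sg: "smooth_on g W"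
    by (rule smooth_on_if_derivative_smooth[OF open_W g], assumption) (intro smooth_on_add smooth_on_scaleR smooth_on_const open_W sP sAB sm)
  have Dg: "D1 g x = A x *\<^sub>R D2 f x" "D2 g x = B x *\<^sub>R D1 f x" if "x \<in> W" for x
    using has_derivative_D1[OF g[OF that]] has_derivative_D2[OF g[OF that]] by simp_all
  have AB0: "A x \<noteq> 0" "B x \<noteq> 0" if "x \<in> W" for x
    using that pos[OF that] h_nonzero ss by (auto simp: A_def B_def)
  have hg: "mink (D1 g x) (D2 g x) = A x * B x * h x" if "x \<in> W" for x
    by (simp add: Dg[OF that] h_def mink_commute[of "D2 f x" "D1 f x"])
  have ns: "null_surface W g n"
  proof
    show "mink (D1 g x) (D2 g x) \<noteq> 0" if "x \<in> W" for x
      unfolding hg[OF that] using AB0[OF that] h_nonzero[OF that] by simp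
  qed (use open_W sg smooth_n Dg null unit orth in auto)
  interpret g: null_surface W g n by (rule ns)
  have gk: "g.k x = B x * Q x" and gQ: "g.Q x = A x * k x" and gR: "g.R x = B x * k x" if x: "x \<in> W" for x
  proof -
    have e: "D1 (D2 g) x = D1 (\<lambda>x. B x *\<^sub>R D1 f x) x" "D1 (D1 g) x = D1 (\<lambda>x. A x *\<^sub>R D2 f x) x"
      "D2 (D2 g) x = D2 (\<lambda>x. B x *\<^sub>R D1 f x) x"
      using D_cong[OF open_W x, of "D2 g"] D_cong[OF open_W x, of "D1 g"] Dg by auto
    show "g.k x = B x * Q x" "g.Q x = A x * k x" "g.R x = B x * k x"
      unfolding g.k_def Q_coeff_def[of g n x] R_coeff_def[of g n x] e DP(2)[OF x]
      using unit[OF x] orth[OF x] D_scaleR[OF sAB(1) sm(4) x] D_scaleR[OF sAB(2) sm(3) x]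
      by (simp_all add: gauss_weingarten(2,3)[OF x])
  qed
  have gh: "g.h x = A x * B x * h x" if "x \<in> W" for x using hg[OF that] by (simp add: g.h_def)
  show ?thesis
  proof (rule that[OF ns])
    fix x assume x: "x \<in> W"
    note h0 = h_nonzero[OF x] pos[OF x]
    show "D1 g x = (\<rho> (fst x) / (2 * h x)) *\<^sub>R D2 f x" "D2 g x = (s * \<sigma> (snd x) / (2 * h x)) *\<^sub>R D1 f x"
      using Dg[OF x] by (simp_all add: A_def B_def)
    show "g.h x = s * (\<rho> (fst x) * \<sigma> (snd x) / (4 * h x))"
      using h0 by (simp add: gh[OF x] A_def B_def)
    show "g.H x = q x"
      using h0 AB0[OF x] by (simp add: g.H_def gh[OF x] gk[OF x] Q_eq[OF x]) (simp add: A_def)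
    show "g.Q x = 1/2 * H x * \<rho> (fst x)" "g.R x = s * (1/2 * H x * \<sigma> (snd x))"
      using h0 by (simp_all add: gQ[OF x] gR[OF x] A_def B_def k_eq[OF x])
  qed
qed

text \<open>Nontriviality is recorded as a change of the absolute value of \<open>Q\<close> at the
  base point, because a congruence can alter \<open>Q\<close> by a sign only.\<close>

lemma bonnet_deformation:
  assumes x0: "(u0, v0) \<in> W" and q: "smooth_on q W" "\<And>x. x \<in> W \<Longrightarrow> q x \<noteq> 0"
    and harmonic: "\<And>x. x \<in> W \<Longrightarrow> D2 (D1 (\<lambda>y. 1 / q y)) x = 0"
  obtains d \<delta> F N where "d > 0" "\<delta> > 0" "ball u0 d \<times> ball v0 d \<subseteq> W"
    "smooth_on F (ball (0::real) \<delta> \<times> ball u0 d \<times> ball v0 d)" "smooth_on N (ball 0 \<delta> \<times> ball u0 d \<times> ball v0 d)"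
    "\<And>t. t \<in> ball 0 \<delta> \<Longrightarrow> null_surface (ball u0 d \<times> ball v0 d) (\<lambda>x. F (t, x)) (\<lambda>x. N (t, x))"
    "\<And>t x. t \<in> ball 0 \<delta> \<Longrightarrow> x \<in> ball u0 d \<times> ball v0 d \<Longrightarrow> null_surface.h (\<lambda>x. F (t, x)) x = h x"
    "\<And>t x. t \<in> ball 0 \<delta> \<Longrightarrow> x \<in> ball u0 d \<times> ball v0 d \<Longrightarrow> null_surface.k (\<lambda>x. F (t, x)) (\<lambda>x. N (t, x)) x = k x"
    "\<And>x. x \<in> ball u0 d \<times> ball v0 d \<Longrightarrow> F (0, x) = f x" "\<And>x. x \<in> ball u0 d \<times> ball v0 d \<Longrightarrow> N (0, x) = n x"
    "\<exists>t\<in>ball 0 \<delta>. \<bar>Q_coeff (\<lambda>x. F (t, x)) (\<lambda>x. N (t, x)) (u0, v0)\<bar> \<noteq> \<bar>Q (u0, v0)\<bar>"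
proof -
  define p where "p x = 1 / q x" for x
  have sp: "smooth_on p W" unfolding p_def using open_W q by (intro smooth_intros)
  \<comment> \<open>A bound for 1 / q that persists on a small rectangle; there
    \<open>\<alpha>\<close> is bounded by \<open>C\<close> and \<open>\<beta>\<close>, a difference
    of two values, by 2 C.\<close>
  define C where "C = \<bar>p (u0, v0)\<bar> + 1"
  have C: "C > 0" by (simp add: C_def add_nonneg_pos)
  have "open (W \<inter> p -` {-C<..<C})"
    using smooth_on_continuous[OF sp] open_W by (simp add: continuous_open_preimage)
  moreover have "(u0, v0) \<in> W \<inter> p -` {-C<..<C}" using x0 by (auto simp: C_def)
  ultimately obtain e where e: "e > 0" "{u0-e..u0+e} \<times> {v0-e..v0+e} \<subseteq> W \<inter> p -` {-C<..<C}"
    by (rule open_contains_rectangle)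
  let ?B = "ball u0 e \<times> ball v0 e"
  have "?B \<subseteq> {u0-e..u0+e} \<times> {v0-e..v0+e}" by (auto simp: dist_real_def)
  then have B2: "?B \<subseteq> W \<inter> p -` {-C<..<C}" using e(2) by (rule order_trans)
  then have BW: "?B \<subseteq> W" by blast
  have Bp: "\<bar>p x\<bar> < C" if "x \<in> ?B" for x
    using subsetD[OF B2 that] by auto
  have oB: "open ?B" by (intro open_Times open_ball)
  have c: "u0 \<in> ball u0 e" "v0 \<in> ball v0 e" using e(1) by auto
  define \<alpha> where "\<alpha> u = p (u, v0)" for u
  define \<beta> where "\<beta> v = p (u0, v) - p (u0, v0)" for v
  have pB: "p x = \<alpha> (fst x) + \<beta> (snd x)" if x: "x \<in> ?B" for x
  proof -
    have "p (fst x, snd x) = p (fst x, v0) + (p (u0, snd x) - p (u0, v0))"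
    proof (rule separation_of_variables[OF smooth_on_subset[OF sp BW] e(1)])
      show "D2 (D1 p) x = 0" if "x \<in> ?B" for x
        using harmonic[of x] BW that by (auto simp: p_def[abs_def])
    qed (use x in auto)
    then show ?thesis by (simp add: \<alpha>_def \<beta>_def)
  qed
  \<comment> \<open>Keeps \<open>t * \<alpha>\<close> within 1/4 and \<open>t * \<beta>\<close>
    within 1/2 of zero, so that both denominators stay positive.\<close>
  define \<epsilon> where "\<epsilon> = 1 / (4 * C)"
  have \<epsilon>: "\<epsilon> > 0" "\<epsilon> * C = 1/4" using C by (simp_all add: \<epsilon>_def)
  have small: "1 + t * \<alpha> (fst x) > 0" "1 - t * \<beta> (snd x) > 0" if t: "t \<in> ball 0 \<epsilon>" and x: "x \<in> ?B" for t x
  proof -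
    have a: "\<bar>\<alpha> (fst x)\<bar> \<le> C" using Bp[of "(fst x, v0)"] x c by (auto simp: \<alpha>_def)
    have b: "\<bar>\<beta> (snd x)\<bar> \<le> 2 * C" using Bp[of "(u0, snd x)"] Bp[of "(u0, v0)"] x c by (auto simp: \<beta>_def)
    have "\<bar>t * \<alpha> (fst x)\<bar> \<le> \<epsilon> * C" "\<bar>t * \<beta> (snd x)\<bar> \<le> \<epsilon> * (2 * C)"
      unfolding abs_mult using t a b C \<epsilon>(1) by (intro mult_mono; simp)+
    then show "1 + t * \<alpha> (fst x) > 0" "1 - t * \<beta> (snd x) > 0" using \<epsilon>(2) by linarith+
  qed
  let ?S = "ball (0::real) \<epsilon> \<times> ?B"
  have oS: "open ?S" by (intro open_Times open_ball)
  text \<open>That is, \<open>Q\<^sub>t = \<lambda> Q\<close> and \<open>R\<^sub>t = R / \<lambda>\<close> with \<open>\<lambda> = (1 - t \<beta>) / (1 + t \<alpha>)\<close> and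
    \<open>1 / q = \<alpha> + \<beta>\<close>.\<close>
  define qt where "qt y = Q (snd y) - 1/2 * (fst y * \<rho> (fst (snd y)) / (1 + fst y * \<alpha> (fst (snd y))))" for y :: "real \<times> real \<times> real"
  define rt where "rt y = R (snd y) + 1/2 * (s * (fst y * \<sigma> (snd (snd y)) / (1 - fst y * \<beta> (snd (snd y)))))" for y :: "real \<times> real \<times> real"
  have sW: "smooth_on (\<lambda>y. g (\<phi> y)) ?S" if "smooth_on g W" "smooth_on \<phi> ?S" "\<And>y. y \<in> ?S \<Longrightarrow> \<phi> y \<in> W"
    for g :: "real \<times> real \<Rightarrow> real" and \<phi> :: "real \<times> real \<times> real \<Rightarrow> real \<times> real"
    by (rule smooth_on_compose[OF oS open_W _ that(2,1)]) (use that(3) in auto)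
  have s\<phi>: "smooth_on (\<lambda>y. (fst (snd y), v0)) ?S" "smooth_on (\<lambda>y. (u0, snd (snd y))) ?S"
    by (intro smooth_on_Pair smooth_on_const smooth_on_fst smooth_on_snd smooth_on_ident oS)+
  have s\<alpha>: "smooth_on (\<lambda>y. \<alpha> (fst (snd y))) ?S"
    unfolding \<alpha>_def using BW c by (intro sW[OF sp s\<phi>(1)]) auto
  have s\<beta>: "smooth_on (\<lambda>y. \<beta> (snd (snd y))) ?S"
    unfolding \<beta>_def using BW c by (intro smooth_on_diff smooth_on_const oS sW[OF sp s\<phi>(2)]) auto
  have sR: "smooth_on (\<lambda>y. g (snd y)) ?S" if "smooth_on g W" for g :: "real \<times> real \<Rightarrow> real"
    using BW by (intro sW[OF that] smooth_on_snd smooth_on_ident oS) auto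
  have nz: "1 + fst y * \<alpha> (fst (snd y)) \<noteq> 0" "1 - fst y * \<beta> (snd (snd y)) \<noteq> 0" if "y \<in> ?S" for y
    using small[of "fst y" "snd y"] that by (auto simp: mem_Times_iff)
  have sqt: "smooth_on qt ?S"
    unfolding qt_def
    using small sR[OF smooth_Q] sR[OF smooth_\<rho>_fst] s\<alpha>
    by (intro smooth_on_diff smooth_on_mult smooth_on_divide smooth_on_add smooth_on_const smooth_on_fst smooth_on_ident oS nz) auto
  have srt: "smooth_on rt ?S"
    unfolding rt_def
    using small sR[OF smooth_R] sR[OF smooth_\<sigma>_snd] s\<beta>
    by (intro smooth_on_diff smooth_on_mult smooth_on_divide smooth_on_add smooth_on_const smooth_on_fst smooth_on_ident oS nz) auto
  have p0: "p x \<noteq> 0" "q x = 1 / p x" if "x \<in> W" for x using q(2)[OF that] by (simp_all add: p_def)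
  interpret B: null_surface ?B f n
    by (rule null_surface_subset[OF null_surface_axioms BW oB])
  obtain d \<delta> F N where dF: "d > 0" "\<delta> > 0" "\<delta> \<le> \<epsilon>" "ball u0 d \<times> ball v0 d \<subseteq> ?B"
    "smooth_on F (ball 0 \<delta> \<times> ball u0 d \<times> ball v0 d)" "smooth_on N (ball 0 \<delta> \<times> ball u0 d \<times> ball v0 d)"
    "\<And>t. t \<in> ball 0 \<delta> \<Longrightarrow> null_surface (ball u0 d \<times> ball v0 d) (\<lambda>x. F (t, x)) (\<lambda>x. N (t, x))"
    "\<And>t x. t \<in> ball 0 \<delta> \<Longrightarrow> x \<in> ball u0 d \<times> ball v0 d \<Longrightarrow> null_surface.h (\<lambda>x. F (t, x)) x = h x"
    "\<And>t x. t \<in> ball 0 \<delta> \<Longrightarrow> x \<in> ball u0 d \<times> ball v0 d \<Longrightarrow> null_surface.k (\<lambda>x. F (t, x)) (\<lambda>x. N (t, x)) x = k x"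
    "\<And>t x. t \<in> ball 0 \<delta> \<Longrightarrow> x \<in> ball u0 d \<times> ball v0 d \<Longrightarrow> Q_coeff (\<lambda>x. F (t, x)) (\<lambda>x. N (t, x)) x = qt (t, x)"
    "\<And>x. x \<in> ball u0 d \<times> ball v0 d \<Longrightarrow> F (0, x) = f x" "\<And>x. x \<in> ball u0 d \<times> ball v0 d \<Longrightarrow> N (0, x) = n x"
  proof (rule B.deformation[of u0 v0 \<epsilon> qt rt])
    show "smooth_on qt ?S" "smooth_on rt ?S" by (fact sqt srt)+
    fix t :: real and x assume t: "t \<in> ball 0 \<epsilon>" and x: "x \<in> ?B"
    then have xW: "x \<in> W" using BW by blast
    have s1: "smooth_on (\<lambda>x. qt (t, x)) ?B" "smooth_on (\<lambda>x. rt (t, x)) ?B"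
      using smooth_on_slice[OF sqt open_ball oB t] smooth_on_slice[OF srt open_ball oB t] .
    have "D2 (\<lambda>x. qt (t, x) - Q x) x = 0"
      by (rule D2_of_fst[OF oB smooth_on_diff[OF oB s1(1) B.smooth_Q] x,
            where G = "\<lambda>u. - (1/2 * (t * \<rho> u / (1 + t * \<alpha> u)))"]) (simp add: qt_def)
    then show "D2 (\<lambda>x. qt (t, x)) x = D2 Q x"
      using D_diff(2)[OF s1(1) B.smooth_Q x] by simp
    have "D1 (\<lambda>x. rt (t, x) - R x) x = 0"
      by (rule D1_of_snd[OF oB smooth_on_diff[OF oB s1(2) B.smooth_R] x,
            where G = "\<lambda>v. 1/2 * (s * (t * \<sigma> v / (1 - t * \<beta> v)))"]) (simp add: rt_def)
    then show "D1 (\<lambda>x. rt (t, x)) x = D1 R x"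
      using D_diff(1)[OF s1(2) B.smooth_R x] by simp
    define a b where "a = \<alpha> (fst x)" and "b = \<beta> (snd x)"
    have ab: "1 + t * a \<noteq> 0" "1 - t * b \<noteq> 0" "a + b \<noteq> 0" "q x = 1 / (a + b)"
      using small[OF t x] p0[OF xW] pB[OF x] by (auto simp: a_def b_def)
    have "qt (t, x) = 1/2 * \<rho> (fst x) * (1 / (a + b) - t / (1 + t * a))"
      unfolding qt_def fst_conv snd_conv a_def[symmetric] Q_eq[OF xW] ab(4) by (simp add: right_diff_distrib)
    also have "1 / (a + b) - t / (1 + t * a) = (1 - t * b) / ((a + b) * (1 + t * a))"
      using ab(1,3) by (simp add: diff_frac_eq algebra_simps)
    finally have 1: "qt (t, x) = 1/2 * \<rho> (fst x) * ((1 - t * b) / ((a + b) * (1 + t * a)))" .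
    have "rt (t, x) = s * (1/2 * \<sigma> (snd x)) * (1 / (a + b) + t / (1 - t * b))"
      unfolding rt_def fst_conv snd_conv b_def[symmetric] R_eq[OF xW] ab(4) by (simp add: distrib_left)
    also have "1 / (a + b) + t / (1 - t * b) = (1 + t * a) / ((a + b) * (1 - t * b))"
      using ab(2,3) by (simp add: add_frac_eq algebra_simps)
    finally have "rt (t, x) = s * (1/2 * \<sigma> (snd x)) * ((1 + t * a) / ((a + b) * (1 - t * b)))" .
    then show "qt (t, x) * rt (t, x) = Q x * R x"
      using ab(1-3) unfolding 1 Q_eq[OF xW] R_eq[OF xW] ab(4) by simp
  qed (use c \<epsilon>(1) in \<open>auto simp: qt_def rt_def\<close>)
  define t where "t = \<delta> / 2"
  have t: "t \<in> ball 0 \<delta>" "t \<in> ball 0 \<epsilon>" "t \<noteq> 0" using dF(2,3) by (auto simp: t_def)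
  have x0B: "(u0, v0) \<in> ?B" and x0d: "(u0, v0) \<in> ball u0 d \<times> ball v0 d" using c dF(1) by auto
  define a where "a = p (u0, v0)"
  have a: "a \<noteq> 0" "q (u0, v0) = 1 / a" using p0[OF x0] by (simp_all add: a_def)
  have ta: "1 + t * a > 0" using small(1)[OF t(2) x0B] by (simp add: a_def \<alpha>_def)
  have Q0: "Q (u0, v0) = 1/2 * \<rho> u0 / a" using Q_eq[OF x0] a(2) by simp
  \<comment> \<open>The factor \<lambda> at the base point, where \<open>\<beta>\<close> vanishes.
    It is positive and, as t and a are nonzero, different from 1.\<close>
  define \<mu> where "\<mu> = 1 / (1 + t * a)"
  have "qt (t, u0, v0) = Q (u0, v0) * \<mu>"
    using ta a(1) unfolding qt_def fst_conv snd_conv \<alpha>_def a_def[symmetric] Q0 \<mu>_def by (simp add: field_simps)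
  moreover have "Q (u0, v0) \<noteq> 0" using Q0 a(1) pos(1)[OF x0] by simp
  moreover have "\<bar>\<mu>\<bar> \<noteq> 1" using ta t(3) a(1) by (simp add: \<mu>_def field_simps)
  ultimately have "\<bar>qt (t, u0, v0)\<bar> \<noteq> \<bar>Q (u0, v0)\<bar>" by (simp add: abs_mult)
  then have "\<exists>t\<in>ball 0 \<delta>. \<bar>Q_coeff (\<lambda>x. F (t, x)) (\<lambda>x. N (t, x)) (u0, v0)\<bar> \<noteq> \<bar>Q (u0, v0)\<bar>"
    unfolding dF(10)[OF t(1) x0d, symmetric] using t(1) by (rule bexI)
  then show ?thesis
    by (intro that[OF dF(1,2) order_trans[OF dF(4) BW] dF(5,6,7,8,9,11,12)])
qed

end

subsection \<open>Comparing two surfaces with the same metric and mean curvature\<close>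

lemma null_surface_cong:
  assumes "null_surface W f n" "\<And>x. x \<in> W \<Longrightarrow> f x = f' x" "\<And>x. x \<in> W \<Longrightarrow> n x = n' x"
  shows "null_surface W f' n'"
proof -
  interpret null_surface W f n by (rule assms(1))
  have D: "D1 f' x = D1 f x" "D2 f' x = D2 f x" if "x \<in> W" for x
    using D_cong[OF open_W that assms(2)] by simp_all
  show ?thesis
  proof
    show "smooth_on f' W" "smooth_on n' W"
      using smooth_on_cong[OF open_W assms(2) smooth_f] smooth_on_cong[OF open_W assms(3) smooth_n] by auto
  qed (use open_W null nondegenerate unit orth D assms(3)[symmetric] in simp_all)
qed

text \<open>The right-hand sides of the Codazzi equations involve only \<open>h\<close> and
  \<open>k\<close>, and so does the Gauss equation apart from the product Q R. Subtracting the
  equations of the two surfaces leaves these relations.\<close>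

lemma hopf_differences:
  assumes f1: "null_surface W f1 n1" and f2: "null_surface W f2 n2"
    and h: "\<And>x. x \<in> W \<Longrightarrow> null_surface.h f2 x = null_surface.h f1 x"
    and k: "\<And>x. x \<in> W \<Longrightarrow> null_surface.k f2 n2 x = null_surface.k f1 n1 x"
    and x: "x \<in> W"
  shows "D2 (\<lambda>x. Q_coeff f2 n2 x - Q_coeff f1 n1 x) x = 0"
    "D1 (\<lambda>x. R_coeff f2 n2 x - R_coeff f1 n1 x) x = 0"
    "Q_coeff f2 n2 x * R_coeff f2 n2 x = Q_coeff f1 n1 x * R_coeff f1 n1 x"
proof -
  interpret a: null_surface W f1 n1 by (rule f1)
  interpret b: null_surface W f2 n2 by (rule f2)
  have Dh: "D1 b.h y = D1 a.h y" "D2 b.h y = D2 a.h y" if "y \<in> W" for y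
    using D_cong[OF a.open_W that h] by auto
  have Dk: "D1 b.k x = D1 a.k x" "D2 b.k x = D2 a.k x"
    using D_cong[OF a.open_W x k] by auto
  show "D2 (\<lambda>x. b.Q x - a.Q x) x = 0" "D1 (\<lambda>x. b.R x - a.R x) x = 0"
    using D_diff[OF b.smooth_Q a.smooth_Q x] D_diff[OF b.smooth_R a.smooth_R x]
      a.codazzi_gauss[OF x] b.codazzi_gauss[OF x] Dh[OF x] Dk h[OF x] k[OF x] by simp_all
  have "D2 (\<lambda>y. D1 b.h y / b.h y) x = D2 (\<lambda>y. D1 a.h y / a.h y) x"
    by (rule D_cong(2)[OF a.open_W x]) (simp add: Dh h)
  then show "b.Q x * b.R x = a.Q x * a.R x"
    using a.codazzi_gauss(3)[OF x] b.codazzi_gauss(3)[OF x] h[OF x] k[OF x] a.h_nonzero[OF x] by simp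
qed

lemma constant_on_rectangle:
  fixes g :: "real \<times> real \<Rightarrow> 'b::euclidean_space"
  assumes g: "smooth_on g (ball u0 e \<times> ball v0 e)" and u: "u \<in> ball u0 e" "u' \<in> ball u0 e" and v: "v \<in> ball v0 e" "v' \<in> ball v0 e"
  shows "(\<And>x. x \<in> ball u0 e \<times> ball v0 e \<Longrightarrow> D2 g x = 0) \<Longrightarrow> g (u, v) = g (u, v')"
    and "(\<And>x. x \<in> ball u0 e \<times> ball v0 e \<Longrightarrow> D1 g x = 0) \<Longrightarrow> g (u, v) = g (u', v)"
proof -
  assume D: "\<And>x. x \<in> ball u0 e \<times> ball v0 e \<Longrightarrow> D2 g x = 0"
  have "((\<lambda>s. g (u, s)) has_derivative (\<lambda>h. 0)) (at s within ball v0 e)" if "s \<in> ball v0 e" for s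
    using smooth_on_partials(2)[OF g, of u s] D[of "(u, s)"] u that
    by (auto simp: has_vector_derivative_def intro: has_derivative_at_withinI)
  then show "g (u, v) = g (u, v')"
    using has_derivative_zero_constant[OF convex_ball, of v0 e "\<lambda>s. g (u, s)"] v by metis
next
  assume D: "\<And>x. x \<in> ball u0 e \<times> ball v0 e \<Longrightarrow> D1 g x = 0"
  have "((\<lambda>s. g (s, v)) has_derivative (\<lambda>h. 0)) (at s within ball u0 e)" if "s \<in> ball u0 e" for s
    using smooth_on_partials(1)[OF g, of s v] D[of "(s, v)"] v that
    by (auto simp: has_vector_derivative_def intro: has_derivative_at_withinI)
  then show "g (u, v) = g (u', v)"
    using has_derivative_zero_constant[OF convex_ball, of u0 e "\<lambda>s. g (s, v)"] u by metis
qed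

text \<open>If \<open>a = Q2 - Q1\<close> and \<open>b = R2 - R1\<close>, then \<open>a\<close> depends on \<open>u\<close> only, \<open>b\<close> on \<open>v\<close> only, and
  \<open>a b + a R1 + b Q1 = 0\<close>; so the zero of one at a point spreads to the whole rectangle.\<close>

lemma hopf_agreement_spreads:
  assumes f1: "null_surface W f1 n1" and f2: "null_surface W f2 n2"
    and W: "W = ball u0 e \<times> ball v0 e"
    and h: "\<And>x. x \<in> W \<Longrightarrow> null_surface.h f2 x = null_surface.h f1 x"
    and k: "\<And>x. x \<in> W \<Longrightarrow> null_surface.k f2 n2 x = null_surface.k f1 n1 x"
    and nz: "\<And>x. x \<in> W \<Longrightarrow> Q_coeff f1 n1 x \<noteq> 0" "\<And>x. x \<in> W \<Longrightarrow> R_coeff f1 n1 x \<noteq> 0"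
    and x: "x \<in> W" "Q_coeff f2 n2 x = Q_coeff f1 n1 x" and y: "y \<in> W"
  shows "Q_coeff f2 n2 y = Q_coeff f1 n1 y \<and> R_coeff f2 n2 y = R_coeff f1 n1 y"
proof -
  interpret a: null_surface W f1 n1 by (rule f1)
  interpret b: null_surface W f2 n2 by (rule f2)
  note D = hopf_differences[OF f1 f2 h k]
  obtain u v u' v' where xy: "x = (u, v)" "y = (u', v')" by (metis surj_pair)
  have uv: "u \<in> ball u0 e" "v \<in> ball v0 e" "u' \<in> ball u0 e" "v' \<in> ball v0 e"
    using x(1) y xy W by auto
  \<comment> \<open>Agreement of \<open>Q\<close> travels in the direction of v, is converted by
    this equivalence at the corner (u, v'), and then travels as agreement of \<open>R\<close> in the
    direction of u.\<close>
  have QR: "b.Q z = a.Q z \<longleftrightarrow> b.R z = a.R z" if "z \<in> W" for z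
    using D(3)[OF _ _ that] nz[OF that] by (auto simp: mult_cancel_left mult_cancel_right)
  have s: "smooth_on (\<lambda>x. b.Q x - a.Q x) (ball u0 e \<times> ball v0 e)" "smooth_on (\<lambda>x. b.R x - a.R x) (ball u0 e \<times> ball v0 e)"
    using smooth_on_diff[OF a.open_W b.smooth_Q a.smooth_Q] smooth_on_diff[OF a.open_W b.smooth_R a.smooth_R] W by simp_all
  have "b.Q (u, v') - a.Q (u, v') = b.Q (u, v) - a.Q (u, v)"
    by (rule constant_on_rectangle(1)[OF s(1) uv(1,1,4,2)]) (use D(1) W in auto)
  then have "b.R (u, v') = a.R (u, v')"
    using x(2) xy(1) QR[of "(u, v')"] uv W by auto
  moreover have "b.R (u, v') - a.R (u, v') = b.R (u', v') - a.R (u', v')"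
    by (rule constant_on_rectangle(2)[OF s(2) uv(1,3,4,4)]) (use D(2) W in auto)
  ultimately show ?thesis
    using QR[OF y] xy(2) by simp
qed

lemma (in isothermic_patch) deformation_harmonic:
  assumes f2: "null_surface W f2 n2"
    and h: "\<And>x. x \<in> W \<Longrightarrow> null_surface.h f2 x = h x"
    and k: "\<And>x. x \<in> W \<Longrightarrow> null_surface.k f2 n2 x = k x"
    and q: "\<And>x. x \<in> W \<Longrightarrow> q x \<noteq> 0"
    and ne: "\<And>x. x \<in> W \<Longrightarrow> Q_coeff f2 n2 x \<noteq> Q x \<or> R_coeff f2 n2 x \<noteq> R x"
    and x: "x \<in> W"
  shows "D2 (D1 (\<lambda>y. 1 / q y)) x = 0"
proof -
  interpret b: null_surface W f2 n2 by (rule f2)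
  define a where "a x = b.Q x - Q x" for x
  define b where "b x = b.R x - R x" for x
  note D = hopf_differences[OF null_surface_axioms f2 h k]
  have sab: "smooth_on a W" "smooth_on b W"
    unfolding a_def b_def by (intro smooth_on_diff open_W b.smooth_Q smooth_Q b.smooth_R smooth_R)+
  have eq: "a y * b y + a y * R y + b y * Q y = 0" if "y \<in> W" for y
    using D(3)[OF _ _ that] by (simp add: a_def b_def algebra_simps)
  have QR0: "Q y \<noteq> 0" "R y \<noteq> 0" if "y \<in> W" for y
    using q[OF that] pos[OF that] s by (auto simp: Q_eq[OF that] R_eq[OF that])
  \<comment> \<open>If one of them vanished, the quadratic relation with \<open>Q\<close> and
    \<open>R\<close> nonzero would make the other vanish too, against \<open>ne\<close>.\<close>
  have ab0: "a y \<noteq> 0" "b y \<noteq> 0" if "y \<in> W" for y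
    using eq[OF that] QR0[OF that] ne[OF that] by (auto simp: a_def b_def)
  define \<alpha> where "\<alpha> y = - (\<rho> (fst y) / (2 * a y))" for y
  define \<beta> where "\<beta> y = - (s * \<sigma> (snd y) / (2 * b y))" for y
  have s\<alpha>: "smooth_on \<alpha> W" and s\<beta>: "smooth_on \<beta> W"
    unfolding \<alpha>_def \<beta>_def using open_W smooth_\<rho>_fst smooth_\<sigma>_snd sab ab0 by (auto intro!: smooth_intros)
  \<comment> \<open>The region need not be a rectangle, so \<open>\<alpha>\<close> and
    \<open>a\<close> are handled through vanishing derivatives instead of as functions of one
    variable.\<close>
  have D\<alpha>: "D2 \<alpha> y = 0" if y: "y \<in> W" for y
  proof -
    have "D2 (\<lambda>y. \<alpha> y * a y) y = 0"
      by (rule D2_of_fst[OF open_W smooth_on_mult[OF open_W s\<alpha> sab(1)] y, where G = "\<lambda>u. - \<rho> u / 2"])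
         (use ab0 in \<open>simp add: \<alpha>_def\<close>)
    moreover have "D2 a y = 0" unfolding a_def using D(1)[OF _ _ y] by simp
    ultimately show ?thesis using D_mult(2)[OF s\<alpha> sab(1) y] ab0[OF y] by simp
  qed
  have D\<beta>: "D1 \<beta> y = 0" if y: "y \<in> W" for y
  proof -
    have "D1 (\<lambda>y. \<beta> y * b y) y = 0"
      by (rule D1_of_snd[OF open_W smooth_on_mult[OF open_W s\<beta> sab(2)] y, where G = "\<lambda>v. - (s * \<sigma> v) / 2"])
         (use ab0 in \<open>simp add: \<beta>_def\<close>)
    moreover have "D1 b y = 0" unfolding b_def using D(2)[OF _ _ y] by simp
    ultimately show ?thesis using D_mult(1)[OF s\<beta> sab(2) y] ab0[OF y] by simp
  qed
  have p: "1 / q y = \<alpha> y + \<beta> y" if y: "y \<in> W" for y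
  proof -
    have "2 * (a y * b y) + q y * (s * (a y * \<sigma> (snd y)) + b y * \<rho> (fst y)) = 0"
      using eq[OF y] unfolding Q_eq[OF y] R_eq[OF y] by (simp add: algebra_simps)
    then show ?thesis
      using ab0[OF y] q[OF y] by (simp add: \<alpha>_def \<beta>_def field_simps add_eq_0_iff)
  qed
  have "D1 (\<lambda>y. 1 / q y) y = D1 \<alpha> y" if y: "y \<in> W" for y
    using D_cong(1)[OF open_W y p] D_add(1)[OF s\<alpha> s\<beta> y] D\<beta>[OF y] by simp
  then have "D2 (D1 (\<lambda>y. 1 / q y)) x = D2 (D1 \<alpha>) x"
    by (rule D_cong(2)[OF open_W x])
  also have "\<dots> = D1 (D2 \<alpha>) x"
    using D1_D2_commute[OF open_W s\<alpha> x] by simp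
  also have "\<dots> = 0"
    using D_cong(1)[OF open_W x D\<alpha>] by simp
  finally show ?thesis .
qed

text \<open>A congruence relates the immersions only. The second normal is orthogonal to the
  transformed tangent plane, hence plus or minus the transformed first normal; this sign is why
  absolute values appear.\<close>

lemma congruent_Hopf:
  assumes f1: "null_surface W f1 n1" and f2: "null_surface W f2 n2"
    and L: "linear L" "\<And>x y. mink (L x) (L y) = mink x y"
    and eq: "\<And>x. x \<in> W \<Longrightarrow> f2 x = L (f1 x) + b" and x: "x \<in> W"
  shows "\<bar>Q_coeff f2 n2 x\<bar> = \<bar>Q_coeff f1 n1 x\<bar>"
proof -
  interpret a: null_surface W f1 n1 by (rule f1)
  interpret b: null_surface W f2 n2 by (rule f2)
  have bl: "bounded_linear L" using L(1) by (simp add: linear_conv_bounded_linear)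
  note LL = smooth_on_bounded_linear[OF bl a.open_W]
  have D: "D1 f2 y = L (D1 f1 y)" "D2 f2 y = L (D2 f1 y)" if "y \<in> W" for y
    using D_cong[OF a.open_W that eq] D_add[OF LL[OF a.sm(1)] smooth_on_const that] D_linear[OF bl a.sm(1) that] by auto
  have DD: "D1 (D1 f2) x = L (D1 (D1 f1) x)"
    using D_cong(1)[OF a.open_W x D(1)] D_linear(1)[OF bl a.sm(3) x] by simp
  define m where "m = mink (n2 x) (L (n1 x))"
  have "n2 x = m *\<^sub>R L (n1 x)"
    using null_frame_expansion[of "L (D1 f1 x)" "L (D2 f1 x)" "L (n1 x)" "n2 x"]
      a.null[OF x] a.nondegenerate[OF x] a.unit[OF x] a.orth[OF x] b.orth[OF x] D[OF x] L(2)
    by (simp add: m_def mink_commute[of "n2 x" "L (D1 f1 x)"] mink_commute[of "n2 x" "L (D2 f1 x)"])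
  moreover from this have "m * m = 1"
    using b.unit[OF x] L(2) a.unit[OF x] by simp
  ultimately have "Q_coeff f2 n2 x = m * Q_coeff f1 n1 x"
    unfolding Q_coeff_def DD using L(2) by simp
  moreover have "\<bar>m\<bar> = 1"
    using \<open>m * m = 1\<close> abs_square_eq_1[of m] by (simp add: power2_eq_square)
  ultimately show ?thesis by (simp add: abs_mult)
qed

subsection \<open>Changes of null coordinates\<close>

lemma D_chain:
  fixes p :: "real \<times> real \<Rightarrow> 'b::real_normed_vector"
  assumes "smooth_on \<phi> U" "smooth_on p V" "x \<in> U" "\<phi> x \<in> V"
  shows "D1 (\<lambda>x. p (\<phi> x)) x = fst (D1 \<phi> x) *\<^sub>R D1 p (\<phi> x) + snd (D1 \<phi> x) *\<^sub>R D2 p (\<phi> x)"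
    "D2 (\<lambda>x. p (\<phi> x)) x = fst (D2 \<phi> x) *\<^sub>R D1 p (\<phi> x) + snd (D2 \<phi> x) *\<^sub>R D2 p (\<phi> x)"
  using has_derivative_D1[OF has_derivative_compose[OF smooth_on_has_derivative[OF assms(1,3)] smooth_on_has_derivative_partials[OF assms(2,4)]]]
    has_derivative_D2[OF has_derivative_compose[OF smooth_on_has_derivative[OF assms(1,3)] smooth_on_has_derivative_partials[OF assms(2,4)]]]
  by (simp_all only: D1_def[symmetric] D2_def[symmetric])

text \<open>A map that preserves the null directions has, near each point, the form (f(u), g(v)) or
  (f(v), g(u)). In both cases the mixed derivative of the composite is a multiple of the mixed
  derivative of \<open>p\<close>.\<close>

lemma harmonic_null_change:
  fixes p :: "real \<times> real \<Rightarrow> real" and \<phi> :: "real \<times> real \<Rightarrow> real \<times> real"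
  assumes U: "open U" and V: "open V" and \<phi>: "smooth_on \<phi> U" "\<phi> ` U \<subseteq> V" and p: "smooth_on p V"
    and harmonic: "\<And>y. y \<in> V \<Longrightarrow> D2 (D1 p) y = 0"
    and null: "\<And>x. x \<in> U \<Longrightarrow> fst (D1 \<phi> x) * snd (D1 \<phi> x) = 0" "\<And>x. x \<in> U \<Longrightarrow> fst (D2 \<phi> x) * snd (D2 \<phi> x) = 0"
    and det: "\<And>x. x \<in> U \<Longrightarrow> fst (D1 \<phi> x) * snd (D2 \<phi> x) - fst (D2 \<phi> x) * snd (D1 \<phi> x) \<noteq> 0"
    and x: "x \<in> U"
  shows "D2 (D1 (\<lambda>x. p (\<phi> x))) x = 0"
proof -
  define f where "f x = fst (\<phi> x)" for x
  define g where "g x = snd (\<phi> x)" for x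
  have sf: "smooth_on f U" and sg: "smooth_on g U"
    unfolding f_def g_def using U \<phi>(1) by (auto intro!: smooth_intros)
  have fg: "fst (D1 \<phi> y) = D1 f y" "fst (D2 \<phi> y) = D2 f y" "snd (D1 \<phi> y) = D1 g y" "snd (D2 \<phi> y) = D2 g y" if "y \<in> U" for y
    unfolding f_def g_def using D_linear[OF bounded_linear_fst \<phi>(1) that] D_linear[OF bounded_linear_snd \<phi>(1) that] by simp_all
  have \<phi>V: "\<phi> y \<in> V" if "y \<in> U" for y using \<phi>(2) that by blast
  have chain: "D1 (\<lambda>x. p (\<phi> x)) y = D1 f y * D1 p (\<phi> y) + D1 g y * D2 p (\<phi> y)" if "y \<in> U" for y
    using D_chain(1)[OF \<phi>(1) p that \<phi>V[OF that]] fg[OF that] by simp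
  have sp: "smooth_on (\<lambda>x. D1 p (\<phi> x)) U" "smooth_on (\<lambda>x. D2 p (\<phi> x)) U"
    using smooth_on_compose[OF U V \<phi>(2,1) smooth_on_D1[OF p]] smooth_on_compose[OF U V \<phi>(2,1) smooth_on_D2[OF p]] .
  have chain2: "D2 (\<lambda>x. D1 p (\<phi> x)) y = D2 f y * D1 (D1 p) (\<phi> y)" "D2 (\<lambda>x. D2 p (\<phi> x)) y = D2 g y * D2 (D2 p) (\<phi> y)"
    if y: "y \<in> U" for y
    using D_chain(2)[OF \<phi>(1) smooth_on_D1[OF p] y \<phi>V[OF y]] D_chain(2)[OF \<phi>(1) smooth_on_D2[OF p] y \<phi>V[OF y]]
      harmonic[OF \<phi>V[OF y]] D1_D2_commute[OF V p \<phi>V[OF y]] fg[OF y] by simp_all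
  note n = null[unfolded fg] and dt = det[unfolded fg]
  have n1: "D1 f y * D1 g y = 0" "D2 f y * D2 g y = 0" "D1 f y * D2 g y - D2 f y * D1 g y \<noteq> 0" if "y \<in> U" for y
    using null[OF that] det[OF that] fg[OF that] by simp_all
  have open_ne: "open {y \<in> U. D y \<noteq> 0}" if "smooth_on D U" for D :: "real \<times> real \<Rightarrow> real"
  proof -
    have "{y \<in> U. D y \<noteq> 0} = U \<inter> D -` (- {0})" by auto
    then show ?thesis
      using continuous_open_preimage[OF smooth_on_continuous[OF that] U, of "- {0}"] by (simp add: open_Compl)
  qed
  show ?thesis
  proof (cases "D1 f x = 0")
    case False
    \<comment> \<open>The Jacobian is diagonal wherever this entry is nonzero; that is an open
      condition, so the vanishing entries may be differentiated at \<open>x\<close>.\<close>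
    define O' where "O' = {y \<in> U. D1 f y \<noteq> 0}"
    have O: "open O'" "x \<in> O'" "O' \<subseteq> U"
      using open_ne[OF smooth_on_D1[OF sf]] x False by (auto simp: O'_def)
    have z: "D1 g y = 0" "D2 f y = 0" if "y \<in> O'" for y
    proof -
      have y: "y \<in> U" "D1 f y \<noteq> 0" using that by (auto simp: O'_def)
      show 1: "D1 g y = 0" using n1(1)[OF y(1)] y(2) by simp
      then have "D2 g y \<noteq> 0" using n1(3)[OF y(1)] by auto
      then show "D2 f y = 0" using n1(2)[OF y(1)] by simp
    qed
    have "D2 (D1 (\<lambda>x. p (\<phi> x))) x = D2 (\<lambda>y. D1 f y * D1 p (\<phi> y)) x"
      by (rule D_cong(2)[OF O(1,2)]) (use chain z O(3) in auto)
    also have "\<dots> = D1 f x * D2 (\<lambda>y. D1 p (\<phi> y)) x + D2 (D1 f) x * D1 p (\<phi> x)"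
      by (rule D_mult(2)[OF smooth_on_D1[OF sf] sp(1) x])
    also have "D2 (D1 f) x = D1 (D2 f) x"
      using D1_D2_commute[OF U sf x] by simp
    also have "D1 (D2 f) x = 0"
      using D_cong(1)[OF O(1,2) z(2)] by simp
    finally show ?thesis
      using chain2(1)[OF x] z(2)[OF O(2)] by simp
  next
    case True
    define O' where "O' = {y \<in> U. D1 g y \<noteq> 0}"
    have "D1 g x \<noteq> 0" using n1(3)[OF x] True by auto
    then have O: "open O'" "x \<in> O'" "O' \<subseteq> U"
      using open_ne[OF smooth_on_D1[OF sg]] x by (auto simp: O'_def)
    have z: "D1 f y = 0" "D2 g y = 0" if "y \<in> O'" for y
    proof -
      have y: "y \<in> U" "D1 g y \<noteq> 0" using that by (auto simp: O'_def)
      show 1: "D1 f y = 0" using n1(1)[OF y(1)] y(2) by simp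
      then have "D2 f y \<noteq> 0" using n1(3)[OF y(1)] by auto
      then show "D2 g y = 0" using n1(2)[OF y(1)] by simp
    qed
    have "D2 (D1 (\<lambda>x. p (\<phi> x))) x = D2 (\<lambda>y. D1 g y * D2 p (\<phi> y)) x"
      by (rule D_cong(2)[OF O(1,2)]) (use chain z O(3) in auto)
    also have "\<dots> = D1 g x * D2 (\<lambda>y. D2 p (\<phi> y)) x + D2 (D1 g) x * D2 p (\<phi> x)"
      by (rule D_mult(2)[OF smooth_on_D1[OF sg] sp(2) x])
    also have "D2 (D1 g) x = D1 (D2 g) x"
      using D1_D2_commute[OF U sg x] by simp
    also have "D1 (D2 g) x = 0"
      using D_cong(1)[OF O(1,2) z(2)] by simp
    finally show ?thesis
      using chain2(2)[OF x] z(2)[OF O(2)] by simp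
  qed
qed

subsection \<open>Charts\<close>

text \<open>The condition that \<open>timelike_surface\<close> imposes in a chart, on an arbitrary
  set, so that it can be restricted to overlaps and pulled back.\<close>

definition surface_patch where
  "surface_patch f n W \<longleftrightarrow> smooth_on f W \<and> smooth_on n W \<and> (\<forall>x\<in>W. inj (frechet_derivative f (at x)) \<and>
     lorentzian (first_form f x) \<and> mink (n x) (n x) = 1 \<and> (\<forall>X. mink (frechet_derivative f (at x) X) (n x) = 0))"

lemma timelike_surface_iff:
  "timelike_surface M A F N \<longleftrightarrow> smooth_2manifold M A \<and>
     (\<forall>c\<in>A. surface_patch (F \<circ> param c) (N \<circ> param c) (coord_dom c))"
  unfolding timelike_surface_def surface_patch_def ..

lemma (in null_surface) patch: "surface_patch f n W"
  unfolding surface_patch_def using smooth_f smooth_n inj_df lorentzian_first_form unit by (simp add: df_eq orth)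

lemma (in null_surface) first_form_eq:
  "x \<in> W \<Longrightarrow> first_form f x X Y = (fst X * snd Y + snd X * fst Y) * h x"
  by (simp add: first_form_def df_eq h_def null mink_commute[of "D2 f x" "D1 f x"] algebra_simps)

lemma surface_cong:
  assumes "open S" "x \<in> S" "\<And>y. y \<in> S \<Longrightarrow> f y = f' y" "\<And>y. y \<in> S \<Longrightarrow> n y = n' y"
  shows "D1 f x = D1 f' x" "D2 f x = D2 f' x" "first_form f x = first_form f' x"
    "mean_curvature f n x = mean_curvature f' n' x"
    "Q_coeff f n x = Q_coeff f' n' x" "R_coeff f n x = R_coeff f' n' x"
proof -
  have D: "D1 f y = D1 f' y" "D2 f y = D2 f' y" if "y \<in> S" for y
    using D_cong[OF assms(1) that assms(3)] by auto
  have DD: "D1 (D1 f) x = D1 (D1 f') x" "D2 (D2 f) x = D2 (D2 f') x"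
    using D_cong(1)[OF assms(1,2) D(1)] D_cong(2)[OF assms(1,2) D(2)] by auto
  have fd: "frechet_derivative f (at x) = frechet_derivative f' (at x)" "frechet_derivative n (at x) = frechet_derivative n' (at x)"
    using frechet_derivative_cong_open[OF assms(1-3)] frechet_derivative_cong_open[OF assms(1,2,4)] by auto
  show "D1 f x = D1 f' x" "D2 f x = D2 f' x" using D assms(2) by auto
  show "first_form f x = first_form f' x" by (simp add: first_form_def fun_eq_iff fd)
  have "shape_operator f n x = shape_operator f' n' x" by (simp add: shape_operator_def fd)
  then show "mean_curvature f n x = mean_curvature f' n' x" by (simp add: mean_curvature_def)
  show "Q_coeff f n x = Q_coeff f' n' x" "R_coeff f n x = R_coeff f' n' x"
    using assms(4)[OF assms(2)] by (simp_all add: Q_coeff_def R_coeff_def DD)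
qed

section \<open>Transition maps and transfer of curvature between charts\<close>

lemma is_chartD:
  assumes "is_chart M c"
  shows "fst c \<subseteq> M" "open (coord_dom c)" "p \<in> fst c \<Longrightarrow> snd c p \<in> coord_dom c"
    "p \<in> fst c \<Longrightarrow> param c (snd c p) = p" "x \<in> coord_dom c \<Longrightarrow> param c x \<in> fst c"
    "x \<in> coord_dom c \<Longrightarrow> snd c (param c x) = x"
    "continuous_on (coord_dom c) (param c)" "continuous_on (fst c) (snd c)"
  using assms unfolding is_chart_def homeomorphism_def by (auto dest: openin_imp_subset)

lemma chart_open_image:
  assumes "is_chart M c" "openin (top_of_set M) T" "T \<subseteq> fst c"
  shows "open (snd c ` T)"
proof -
  have "openin (top_of_set (fst c)) T"
    using assms(2,3) is_chartD(1)[OF assms(1)] by (rule openin_subset_trans)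
  then have "openin (top_of_set (coord_dom c)) (snd c ` T)"
    using homeomorphism_imp_open_map assms(1) unfolding is_chart_def by blast
  then show ?thesis
    using is_chartD(2)[OF assms(1)] openin_open_trans by blast
qed

lemma chart_open_param:
  assumes "is_chart M c" "open B" "B \<subseteq> coord_dom c"
  shows "openin (top_of_set (fst c)) (param c ` B)" "openin (top_of_set M) (param c ` B)"
proof -
  have "homeomorphism (coord_dom c) (fst c) (param c) (snd c)"
    using assms(1) homeomorphism_symD unfolding is_chart_def by blast
  then show 1: "openin (top_of_set (fst c)) (param c ` B)"
    using assms(2,3) by (intro homeomorphism_imp_open_map open_subset)
  have "openin (top_of_set M) (fst c)" using assms(1) by (simp add: is_chart_def)
  then show "openin (top_of_set M) (param c ` B)"
    using 1 openin_trans by blast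
qed

locale chart_pair =
  fixes M :: "'m::t2_space set" and c d :: "'m chart"
  assumes c: "is_chart M c" and d: "is_chart M d" and compat: "compatible c d"
begin

definition U where "U = snd c ` (fst c \<inter> fst d)"
definition V where "V = snd d ` (fst c \<inter> fst d)"
definition \<phi> where "\<phi> = snd d \<circ> param c"
definition \<psi> where "\<psi> = snd c \<circ> param d"
definition \<phi>' where "\<phi>' x = frechet_derivative \<phi> (at x)"
definition \<psi>' where "\<psi>' y = frechet_derivative \<psi> (at y)"

lemma open_overlap: "open U" "open V"
proof -
  have "openin (top_of_set M) (fst c \<inter> fst d)"
    using c d by (auto simp: is_chart_def)
  then show "open U" "open V"
    unfolding U_def V_def using chart_open_image[OF c] chart_open_image[OF d] by auto
qed

lemma smooth_transition: "smooth_on \<phi> U" "smooth_on \<psi> V"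
  using compat by (auto simp: compatible_def U_def V_def \<phi>_def \<psi>_def)

lemma overlap_subset: "U \<subseteq> coord_dom c" "V \<subseteq> coord_dom d"
  by (auto simp: U_def V_def coord_dom_def)

lemma transition_inverse:
  "x \<in> U \<Longrightarrow> \<phi> x \<in> V" "x \<in> U \<Longrightarrow> \<psi> (\<phi> x) = x" "y \<in> V \<Longrightarrow> \<psi> y \<in> U" "y \<in> V \<Longrightarrow> \<phi> (\<psi> y) = y"
  "x \<in> U \<Longrightarrow> param d (\<phi> x) = param c x" "y \<in> V \<Longrightarrow> param c (\<psi> y) = param d y"
  using is_chartD(4)[OF c] is_chartD(4)[OF d] by (auto simp: U_def V_def \<phi>_def \<psi>_def)

lemma overlap_point: "p \<in> fst c \<Longrightarrow> p \<in> fst d \<Longrightarrow> snd c p \<in> U \<and> \<phi> (snd c p) = snd d p \<and> snd d p \<in> V \<and> \<psi> (snd d p) = snd c p"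
  using is_chartD(4)[OF c] is_chartD(4)[OF d] by (auto simp: U_def V_def \<phi>_def \<psi>_def)

lemma transition_derivative:
  assumes x: "x \<in> U"
  shows "(\<phi> has_derivative \<phi>' x) (at x)" "(\<psi> has_derivative \<psi>' (\<phi> x)) (at (\<phi> x))"
    "linear (\<phi>' x)" "linear (\<psi>' (\<phi> x))" "\<psi>' (\<phi> x) (\<phi>' x X) = X" "\<phi>' x (\<psi>' (\<phi> x) X) = X"
proof -
  note y = transition_inverse(1)[OF x]
  show 1: "(\<phi> has_derivative \<phi>' x) (at x)" and 2: "(\<psi> has_derivative \<psi>' (\<phi> x)) (at (\<phi> x))"
    unfolding \<phi>'_def \<psi>'_def using smooth_on_has_derivative[OF smooth_transition(1) x]
      smooth_on_has_derivative[OF smooth_transition(2) y] by auto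
  show "linear (\<phi>' x)" "linear (\<psi>' (\<phi> x))"
    using 1 2 has_derivative_linear by auto
  have "((\<lambda>x. \<psi> (\<phi> x)) has_derivative (\<lambda>X. X)) (at x)"
    by (rule has_derivative_transform_within_open[OF has_derivative_ident open_overlap(1) x]) (simp add: transition_inverse)
  from has_derivative_unique[OF this has_derivative_compose[OF 1 2]]
  show "\<psi>' (\<phi> x) (\<phi>' x X) = X" by metis
  have D1': "(\<phi> has_derivative \<phi>' x) (at (\<psi> (\<phi> x)))" using 1 transition_inverse(2)[OF x] by simp
  have "((\<lambda>x. \<phi> (\<psi> x)) has_derivative (\<lambda>X. X)) (at (\<phi> x))"
    by (rule has_derivative_transform_within_open[OF has_derivative_ident open_overlap(2) y]) (simp add: transition_inverse)
  from has_derivative_unique[OF this has_derivative_compose[OF 2 D1']]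
  show "\<phi>' x (\<psi>' (\<phi> x) X) = X" by metis
qed

lemma derivative_pull:
  fixes F :: "'m \<Rightarrow> real^3"
  assumes F: "smooth_on (F \<circ> param d) (coord_dom d)" and x: "x \<in> U"
  shows "frechet_derivative (F \<circ> param c) (at x) X = frechet_derivative (F \<circ> param d) (at (\<phi> x)) (\<phi>' x X)"
    and "first_form (F \<circ> param c) x X Y = first_form (F \<circ> param d) (\<phi> x) (\<phi>' x X) (\<phi>' x Y)"
proof -
  have "\<phi> x \<in> coord_dom d" using transition_inverse(1)[OF x] overlap_subset by blast
  then have "((\<lambda>x. (F \<circ> param d) (\<phi> x)) has_derivative (\<lambda>X. frechet_derivative (F \<circ> param d) (at (\<phi> x)) (\<phi>' x X))) (at x)"
    by (intro has_derivative_compose[OF transition_derivative(1)[OF x]] smooth_on_has_derivative[OF F])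
  then have "((F \<circ> param c) has_derivative (\<lambda>X. frechet_derivative (F \<circ> param d) (at (\<phi> x)) (\<phi>' x X))) (at x)"
    by (rule has_derivative_transform_within_open[OF _ open_overlap(1) x]) (simp add: transition_inverse)
  from frechet_derivative_at[OF this]
  show e: "frechet_derivative (F \<circ> param c) (at x) X = frechet_derivative (F \<circ> param d) (at (\<phi> x)) (\<phi>' x X)" for X by metis
  show "first_form (F \<circ> param c) x X Y = first_form (F \<circ> param d) (\<phi> x) (\<phi>' x X) (\<phi>' x Y)"
    by (simp add: first_form_def e)
qed

lemma patch_pull:
  assumes "surface_patch (F \<circ> param d) (N \<circ> param d) (coord_dom d)"
  shows "surface_patch (F \<circ> param c) (N \<circ> param c) U"
proof -
  have sm: "smooth_on (G \<circ> param c) U" if "smooth_on (G \<circ> param d) (coord_dom d)" for G :: "'m \<Rightarrow> real^3"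
  proof (rule smooth_on_cong[OF open_overlap(1)])
    show "smooth_on (\<lambda>x. (G \<circ> param d) (\<phi> x)) U"
      using transition_inverse(1) overlap_subset(2)
      by (intro smooth_on_compose[OF open_overlap(1) is_chartD(2)[OF d] _ smooth_transition(1) that]) auto
  qed (simp add: transition_inverse)
  have F: "smooth_on (F \<circ> param d) (coord_dom d)" and N: "smooth_on (N \<circ> param d) (coord_dom d)"
    and pt: "\<And>y. y \<in> coord_dom d \<Longrightarrow> inj (frechet_derivative (F \<circ> param d) (at y)) \<and>
     lorentzian (first_form (F \<circ> param d) y) \<and> mink ((N \<circ> param d) y) ((N \<circ> param d) y) = 1 \<and>
     (\<forall>X. mink (frechet_derivative (F \<circ> param d) (at y) X) ((N \<circ> param d) y) = 0)"
    using assms unfolding surface_patch_def by auto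
  show ?thesis
    unfolding surface_patch_def
  proof (intro conjI ballI allI sm F N)
    fix x assume x: "x \<in> U"
    have y: "\<phi> x \<in> coord_dom d" using transition_inverse(1)[OF x] overlap_subset by blast
    note e = derivative_pull[OF F x] and t = transition_derivative[OF x]
    have n: "(N \<circ> param c) x = (N \<circ> param d) (\<phi> x)" using transition_inverse(5)[OF x] by simp
    show "inj (frechet_derivative (F \<circ> param c) (at x))"
    proof (rule injI)
      fix X Y assume "frechet_derivative (F \<circ> param c) (at x) X = frechet_derivative (F \<circ> param c) (at x) Y"
      then have "\<phi>' x X = \<phi>' x Y" unfolding e using pt[OF y] by (auto dest: injD)
      then show "X = Y" using t(5) by metis
    qed
    show "lorentzian (first_form (F \<circ> param c) x)"
    proof -
      obtain e1 e2 where "first_form (F \<circ> param d) (\<phi> x) e1 e1 = -1" "first_form (F \<circ> param d) (\<phi> x) e2 e2 = 1"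
        "first_form (F \<circ> param d) (\<phi> x) e1 e2 = 0"
        using pt[OF y] unfolding lorentzian_def by blast
      then show ?thesis
        unfolding lorentzian_def e t(6)
        by (intro exI[of _ "\<psi>' (\<phi> x) e1"] exI[of _ "\<psi>' (\<phi> x) e2"]) (simp add: t(6))
    qed
    show "mink ((N \<circ> param c) x) ((N \<circ> param c) x) = 1"
      "mink (frechet_derivative (F \<circ> param c) (at x) X) ((N \<circ> param c) x) = 0" for X
      unfolding n e using pt[OF y] by blast+
  qed
qed

text \<open>Mean curvature and umbilics are given in atlas charts while the computations take place
  in null coordinates; this is the passage between them.\<close>

lemma curvature_transfer:
  fixes F N :: "'m \<Rightarrow> real^3"
  assumes ns: "null_surface (coord_dom c) (F \<circ> param c) (N \<circ> param c)" and p: "p \<in> fst c" "p \<in> fst d"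
  shows "shape_operator (F \<circ> param d) (N \<circ> param d) (snd d p) =
      (\<lambda>X. \<phi>' (snd c p) (shape_operator (F \<circ> param c) (N \<circ> param c) (snd c p) (\<psi>' (snd d p) X)))"
    and "mean_curvature (F \<circ> param d) (N \<circ> param d) (snd d p) = mean_curvature (F \<circ> param c) (N \<circ> param c) (snd c p)"
proof -
  interpret null_surface "coord_dom c" "F \<circ> param c" "N \<circ> param c" by (rule ns)
  define x where "x = snd c p"
  have x: "x \<in> U" "\<phi> x = snd d p" "\<psi> (snd d p) = x" "snd d p \<in> V"
    using overlap_point[OF p] by (simp_all add: x_def)
  have xW: "\<psi> (snd d p) \<in> coord_dom c" using x(1,3) overlap_subset by auto
  note t = transition_derivative[OF x(1), unfolded x(2)]
  note pb = shape_operator_pullback[of "F \<circ> param c" \<psi> "snd d p" "N \<circ> param c" "\<psi>' (snd d p)" "\<phi>' x" "S x" V "F \<circ> param d" "N \<circ> param d",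
      OF differentiableI[OF smooth_on_has_derivative[OF smooth_f xW]] differentiableI[OF smooth_on_has_derivative[OF smooth_n xW]]
        t(2,3,5,6) inj_df[OF xW] linear_S]
  have SP: "frechet_derivative (F \<circ> param c) (at (\<psi> (snd d p))) (S x X) = - frechet_derivative (N \<circ> param c) (at (\<psi> (snd d p))) X" for X
    using S_property[OF xW] x(3) by simp
  note pb = pb[OF SP open_overlap(2) x(4)]
  show "shape_operator (F \<circ> param d) (N \<circ> param d) (snd d p) =
      (\<lambda>X. \<phi>' (snd c p) (shape_operator (F \<circ> param c) (N \<circ> param c) (snd c p) (\<psi>' (snd d p) X)))"
    using pb(1) shape_operator_eq[OF xW] x(3) transition_inverse(6) by (simp add: x_def)
  show "mean_curvature (F \<circ> param d) (N \<circ> param d) (snd d p) = mean_curvature (F \<circ> param c) (N \<circ> param c) (snd c p)"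
    using pb(2) x(3) transition_inverse(6) by (simp add: x_def)
qed

end

text \<open>The definition of a surface speaks only about charts of \<open>A\<close>. For another
  chart of the maximal atlas the condition is pulled back on overlaps, which suffices because it is
  local.\<close>

lemma coordinate_system_patch:
  assumes "timelike_surface M A F N" "coordinate_system M A c"
  shows "surface_patch (F \<circ> param c) (N \<circ> param c) (coord_dom c)"
proof -
  have A: "\<Union> (fst ` A) = M" "\<And>d. d \<in> A \<Longrightarrow> is_chart M d" "\<And>d. d \<in> A \<Longrightarrow> surface_patch (F \<circ> param d) (N \<circ> param d) (coord_dom d)"
    using assms(1) by (auto simp: timelike_surface_iff smooth_2manifold_def)
  have c: "is_chart M c" "\<And>d. d \<in> A \<Longrightarrow> compatible c d"
    using assms(2) by (auto simp: coordinate_system_def)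
  have loc: "\<exists>T. open T \<and> x \<in> T \<and> surface_patch (F \<circ> param c) (N \<circ> param c) T" if x: "x \<in> coord_dom c" for x
  proof -
    have p: "param c x \<in> fst c" using is_chartD(5)[OF c(1) x] .
    then obtain d where dA: "d \<in> A" "param c x \<in> fst d"
      using A(1) is_chartD(1)[OF c(1)] by blast
    interpret pair: chart_pair M c d
      by unfold_locales (use c A dA in auto)
    show ?thesis
      using pair.open_overlap(1) pair.overlap_point[OF p dA(2)] is_chartD(6)[OF c(1) x] pair.patch_pull[OF A(3)[OF dA(1)]]
      by metis
  qed
  show ?thesis
    unfolding surface_patch_def[of _ _ "coord_dom c"]
  proof (intro conjI smooth_on_local ballI)
    fix x assume "x \<in> coord_dom c"
    then obtain T where T: "open T" "x \<in> T" "surface_patch (F \<circ> param c) (N \<circ> param c) T"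
      using loc by blast
    show "\<exists>T. open T \<and> x \<in> T \<and> smooth_on (F \<circ> param c) T" "\<exists>T. open T \<and> x \<in> T \<and> smooth_on (N \<circ> param c) T"
      by (intro exI[of _ T] conjI; use T in \<open>simp add: surface_patch_def\<close>)+
    show "inj (frechet_derivative (F \<circ> param c) (at x))" "lorentzian (first_form (F \<circ> param c) x)"
      "mink ((N \<circ> param c) x) ((N \<circ> param c) x) = 1"
      "\<forall>X. mink (frechet_derivative (F \<circ> param c) (at x) X) ((N \<circ> param c) x) = 0"
      using T(3)[unfolded surface_patch_def] T(2) by blast+
  qed
qed

lemma null_coordinates_surface:
  assumes "timelike_surface M A F N" "null_coordinates M A F c"
  shows "null_surface (coord_dom c) (F \<circ> param c) (N \<circ> param c)"
    and "x \<in> coord_dom c \<Longrightarrow> null_surface.h (F \<circ> param c) x > 0"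
proof -
  have c: "coordinate_system M A c" and
    n: "\<And>x. x \<in> coord_dom c \<Longrightarrow> first_form (F \<circ> param c) x (1, 0) (1, 0) = 0 \<and>
        first_form (F \<circ> param c) x (0, 1) (0, 1) = 0 \<and> first_form (F \<circ> param c) x (1, 0) (0, 1) > 0"
    using assms(2) by (auto simp: null_coordinates_def)
  have P: "surface_patch (F \<circ> param c) (N \<circ> param c) (coord_dom c)"
    by (rule coordinate_system_patch[OF assms(1) c])
  have "is_chart M c" using c by (simp add: coordinate_system_def)
  note o = is_chartD(2)[OF this]
  show ns: "null_surface (coord_dom c) (F \<circ> param c) (N \<circ> param c)"
    by unfold_locales
       (use o P n in \<open>auto simp: surface_patch_def first_form_def D1_def[symmetric] D2_def[symmetric] less_imp_neq[symmetric]
          simp del: o_apply, auto simp: D1_def D2_def\<close>)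
  show "x \<in> coord_dom c \<Longrightarrow> null_surface.h (F \<circ> param c) x > 0"
    using n unfolding null_surface.h_def[OF ns] first_form_def D1_def D2_def by blast
qed

lemma coordinate_system_pair:
  assumes "smooth_2manifold M A" "coordinate_system M A c" "d \<in> A"
  shows "chart_pair M c d"
  using assms by unfold_locales (auto simp: smooth_2manifold_def coordinate_system_def)

lemma chart_cover:
  assumes "smooth_2manifold M A" "coordinate_system M A c" "p \<in> fst c"
  obtains d where "d \<in> A" "p \<in> fst d"
  using assms is_chartD(1)[of M c] unfolding smooth_2manifold_def coordinate_system_def by blast

lemma isothermic_coordinates_patch:
  assumes "s = 1 \<or> s = -1" "timelike_surface M A F N" "isothermic_coordinates s M A F N c q \<rho> \<sigma>"
  shows "isothermic_patch (coord_dom c) (F \<circ> param c) (N \<circ> param c) s q \<rho> \<sigma>"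
proof -
  have n: "null_coordinates M A F c" using assms(3) by (simp add: isothermic_coordinates_def)
  interpret null_surface "coord_dom c" "F \<circ> param c" "N \<circ> param c"
    by (rule null_coordinates_surface[OF assms(2) n])
  show ?thesis
    by unfold_locales (use assms(1,3) in \<open>auto simp: isothermic_coordinates_def\<close>)
qed

text \<open>At a zero of \<open>q\<close> both \<open>Q\<close> and \<open>R\<close> vanish, so the
  shape operator is \<open>H\<close> times the identity. Conjugation by a transition map preserves
  this, giving an umbilic in an atlas chart.\<close>

lemma umbilic_free_isothermic:
  assumes s: "s = 1 \<or> s = -1" and tl: "timelike_surface M A F N" and u: "umbilic_free A F N"
    and iso: "isothermic_coordinates s M A F N c q \<rho> \<sigma>" and x: "x \<in> coord_dom c"
  shows "q x \<noteq> 0"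
proof
  assume q0: "q x = 0"
  interpret isothermic_patch "coord_dom c" "F \<circ> param c" "N \<circ> param c" s q \<rho> \<sigma>
    by (rule isothermic_coordinates_patch[OF s tl iso])
  have M: "smooth_2manifold M A" and cs: "coordinate_system M A c"
    using tl iso by (auto simp: timelike_surface_def isothermic_coordinates_def null_coordinates_def)
  have ch: "is_chart M c" using cs by (simp add: coordinate_system_def)
  define p where "p = param c x"
  have p: "p \<in> fst c" "snd c p = x" using is_chartD(5,6)[OF ch x] by (simp_all add: p_def)
  obtain d where d: "d \<in> A" "p \<in> fst d" by (rule chart_cover[OF M cs p(1)])
  interpret pair: chart_pair M c d by (rule coordinate_system_pair[OF M cs d(1)])
  have xU: "x \<in> pair.U" "pair.\<phi> x = snd d p" using pair.overlap_point[OF p(1) d(2)] p(2) by auto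
  have "S x X = H x *\<^sub>R X" for X
    using q0 by (simp add: S_def Q_eq[OF x] R_eq[OF x] prod_eq_iff)
  then have "shape_operator (F \<circ> param d) (N \<circ> param d) (snd d p) X = H x *\<^sub>R X" for X
    unfolding pair.curvature_transfer(1)[OF null_surface_axioms p(1) d(2)] p(2) shape_operator_eq[OF x]
    using linear_cmul[OF pair.transition_derivative(3)[OF xU(1)]] pair.transition_derivative(6)[OF xU(1)] xU(2) by simp
  moreover have "snd d p \<in> coord_dom d" using is_chartD(3)[OF pair.d d(2)] .
  ultimately show False using u d(1) unfolding umbilic_free_def by blast
qed

subsection \<open>Isometric surfaces with the same mean curvature\<close>

locale isometric_pair =
  fixes M :: "'m::t2_space set" and A :: "'m chart set" and F N Ft Nt :: "'m \<Rightarrow> real^3"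
  assumes tl: "timelike_surface M A F N" and tl': "timelike_surface M A Ft Nt"
    and metric: "c \<in> A \<Longrightarrow> x \<in> coord_dom c \<Longrightarrow> first_form (Ft \<circ> param c) x = first_form (F \<circ> param c) x"
    and curvature: "c \<in> A \<Longrightarrow> x \<in> coord_dom c \<Longrightarrow>
      mean_curvature (Ft \<circ> param c) (Nt \<circ> param c) x = mean_curvature (F \<circ> param c) (N \<circ> param c) x"
begin

lemma manifold: "smooth_2manifold M A"
  using tl by (simp add: timelike_surface_def)

text \<open>The assumptions \<open>metric\<close> and \<open>curvature\<close> concern atlas charts
  only; at each point they are transferred to the null chart through an atlas chart that covers
  it.\<close>

lemma null_pair:
  assumes n: "null_coordinates M A F c"
  shows "null_surface (coord_dom c) (F \<circ> param c) (N \<circ> param c)"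
    "null_surface (coord_dom c) (Ft \<circ> param c) (Nt \<circ> param c)"
    "x \<in> coord_dom c \<Longrightarrow> null_surface.h (Ft \<circ> param c) x = null_surface.h (F \<circ> param c) x"
    "x \<in> coord_dom c \<Longrightarrow> null_surface.k (Ft \<circ> param c) (Nt \<circ> param c) x = null_surface.k (F \<circ> param c) (N \<circ> param c) x"
    "x \<in> coord_dom c \<Longrightarrow> null_surface.H (Ft \<circ> param c) (Nt \<circ> param c) x = null_surface.H (F \<circ> param c) (N \<circ> param c) x"
proof -
  have cs: "coordinate_system M A c" using n by (simp add: null_coordinates_def)
  have ch: "is_chart M c" using cs by (simp add: coordinate_system_def)
  have ff: "first_form (Ft \<circ> param c) x X Y = first_form (F \<circ> param c) x X Y" if x: "x \<in> coord_dom c" for x X Y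
  proof -
    have p: "param c x \<in> fst c" "snd c (param c x) = x" using is_chartD(5,6)[OF ch x] .
    obtain d where d: "d \<in> A" "param c x \<in> fst d" by (rule chart_cover[OF manifold cs p(1)])
    interpret pair: chart_pair M c d by (rule coordinate_system_pair[OF manifold cs d(1)])
    have xU: "x \<in> pair.U" using pair.overlap_point[OF p(1) d(2)] p(2) by auto
    have y: "pair.\<phi> x \<in> coord_dom d" using pair.transition_inverse(1)[OF xU] pair.overlap_subset by blast
    have "smooth_on (F \<circ> param d) (coord_dom d)" "smooth_on (Ft \<circ> param d) (coord_dom d)"
      using tl tl' d(1) by (auto simp: timelike_surface_def)
    then show ?thesis
      using pair.derivative_pull(2)[OF _ xU] metric[OF d(1) y] by simp
  qed
  show ns: "null_surface (coord_dom c) (F \<circ> param c) (N \<circ> param c)"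
    by (rule null_coordinates_surface[OF tl n])
  have n': "null_coordinates M A Ft c"
    using n ff by (simp add: null_coordinates_def)
  show ns': "null_surface (coord_dom c) (Ft \<circ> param c) (Nt \<circ> param c)"
    by (rule null_coordinates_surface[OF tl' n'])
  interpret a: null_surface "coord_dom c" "F \<circ> param c" "N \<circ> param c" by (rule ns)
  interpret b: null_surface "coord_dom c" "Ft \<circ> param c" "Nt \<circ> param c" by (rule ns')
  have h: "b.h x = a.h x" if "x \<in> coord_dom c" for x
    using ff[OF that, of "(1, 0)" "(0, 1)"] a.first_form_eq[OF that] b.first_form_eq[OF that] by simp
  have H: "b.H x = a.H x" if x: "x \<in> coord_dom c" for x
  proof -
    have p: "param c x \<in> fst c" "snd c (param c x) = x" using is_chartD(5,6)[OF ch x] .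
    obtain d where d: "d \<in> A" "param c x \<in> fst d" by (rule chart_cover[OF manifold cs p(1)])
    interpret pair: chart_pair M c d by (rule coordinate_system_pair[OF manifold cs d(1)])
    have y: "snd d (param c x) \<in> coord_dom d" using is_chartD(3)[OF pair.d d(2)] .
    show ?thesis
      using curvature[OF d(1) y] pair.curvature_transfer(2)[OF ns p(1) d(2)] pair.curvature_transfer(2)[OF ns' p(1) d(2)]
        a.mean_curvature_eq[OF x] b.mean_curvature_eq[OF x] p(2) by simp
  qed
  show "x \<in> coord_dom c \<Longrightarrow> b.h x = a.h x" "x \<in> coord_dom c \<Longrightarrow> b.H x = a.H x" using h H by auto
  show "x \<in> coord_dom c \<Longrightarrow> b.k x = a.k x" using h H a.k_eq b.k_eq by simp
qed

text \<open>Isometric surfaces with equal mean curvature have the same Hopf differentials where their shape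
  operators agree, and this condition does not depend on coordinates.\<close>

definition agree where
  "agree p \<longleftrightarrow> (\<forall>d\<in>A. p \<in> fst d \<longrightarrow> shape_operator (Ft \<circ> param d) (Nt \<circ> param d) (snd d p) =
     shape_operator (F \<circ> param d) (N \<circ> param d) (snd d p))"

lemma agree_iff:
  assumes n: "null_coordinates M A F c" and p: "p \<in> fst c"
  shows "agree p \<longleftrightarrow> Q_coeff (Ft \<circ> param c) (Nt \<circ> param c) (snd c p) = Q_coeff (F \<circ> param c) (N \<circ> param c) (snd c p) \<and>
    R_coeff (Ft \<circ> param c) (Nt \<circ> param c) (snd c p) = R_coeff (F \<circ> param c) (N \<circ> param c) (snd c p)"
proof -
  have cs: "coordinate_system M A c" using n by (simp add: null_coordinates_def)
  have ch: "is_chart M c" using cs by (simp add: coordinate_system_def)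
  note ns = null_pair(1,2)[OF n]
  interpret a: null_surface "coord_dom c" "F \<circ> param c" "N \<circ> param c" by (rule ns)
  interpret b: null_surface "coord_dom c" "Ft \<circ> param c" "Nt \<circ> param c" by (rule ns)
  define x where "x = snd c p"
  have x: "x \<in> coord_dom c" using is_chartD(3)[OF ch p] by (simp add: x_def)
  have hH: "b.h x = a.h x" "b.H x = a.H x" using null_pair(3,5)[OF n x] .
  have h0: "a.h x \<noteq> 0" by (rule a.h_nonzero[OF x])
  have "agree p \<longleftrightarrow> b.S x = a.S x"
  proof
    assume ag: "agree p"
    obtain d where d: "d \<in> A" "p \<in> fst d" by (rule chart_cover[OF manifold cs p])
    interpret pair: chart_pair M c d by (rule coordinate_system_pair[OF manifold cs d(1)])
    have xU: "x \<in> pair.U" "pair.\<phi> x = snd d p" using pair.overlap_point[OF p d(2)] by (auto simp: x_def)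
    note t = pair.transition_derivative(5)[OF xU(1)]
    have "pair.\<phi>' x (b.S x (pair.\<psi>' (snd d p) X)) = pair.\<phi>' x (a.S x (pair.\<psi>' (snd d p) X))" for X
      using ag d pair.curvature_transfer(1)[OF ns(1) p d(2)] pair.curvature_transfer(1)[OF ns(2) p d(2)]
        a.shape_operator_eq[OF x] b.shape_operator_eq[OF x] unfolding agree_def x_def[symmetric] by metis
    then have "b.S x X = a.S x X" for X
      using t xU(2) by metis
    then show "b.S x = a.S x" by (rule ext)
  next
    assume e: "b.S x = a.S x"
    show "agree p"
      unfolding agree_def
    proof (intro ballI impI)
      fix d assume d: "d \<in> A" "p \<in> fst d"
      interpret pair: chart_pair M c d by (rule coordinate_system_pair[OF manifold cs d(1)])
      show "shape_operator (Ft \<circ> param d) (Nt \<circ> param d) (snd d p) = shape_operator (F \<circ> param d) (N \<circ> param d) (snd d p)"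
        unfolding pair.curvature_transfer(1)[OF ns(1) p d(2)] pair.curvature_transfer(1)[OF ns(2) p d(2)]
          x_def[symmetric] a.shape_operator_eq[OF x] b.shape_operator_eq[OF x] e ..
    qed
  qed
  also have "\<dots> \<longleftrightarrow> b.Q x = a.Q x \<and> b.R x = a.R x"
  proof
    assume "b.S x = a.S x"
    then have "b.S x (1, 0) = a.S x (1, 0)" "b.S x (0, 1) = a.S x (0, 1)" by simp_all
    then show "b.Q x = a.Q x \<and> b.R x = a.R x" using hH h0 by (simp add: a.S_def b.S_def)
  next
    assume "b.Q x = a.Q x \<and> b.R x = a.R x"
    then show "b.S x = a.S x" using hH by (simp add: fun_eq_iff a.S_def b.S_def)
  qed
  finally show ?thesis by (simp add: x_def)
qed

lemma coordinate_rectangle: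
  assumes n: "null_coordinates M A F c" and p: "p \<in> fst c"
  obtains u0 v0 e where "e > 0" "snd c p = (u0, v0)" "ball u0 e \<times> ball v0 e \<subseteq> coord_dom c"
    "openin (top_of_set M) (param c ` (ball u0 e \<times> ball v0 e))" "p \<in> param c ` (ball u0 e \<times> ball v0 e)"
proof -
  have ch: "is_chart M c" using n by (simp add: null_coordinates_def coordinate_system_def)
  obtain u0 v0 where x: "snd c p = (u0, v0)" by (cases "snd c p")
  obtain e where e: "e > 0" "{u0-e..u0+e} \<times> {v0-e..v0+e} \<subseteq> coord_dom c"
    using open_contains_rectangle[OF is_chartD(2)[OF ch]] is_chartD(3)[OF ch p] x by metis
  have "ball u0 e \<times> ball v0 e \<subseteq> {u0-e..u0+e} \<times> {v0-e..v0+e}" by (auto simp: dist_real_def)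
  then have B: "ball u0 e \<times> ball v0 e \<subseteq> coord_dom c" using e(2) by (rule order_trans)
  show ?thesis
  proof (rule that[OF e(1) x B])
    show "openin (top_of_set M) (param c ` (ball u0 e \<times> ball v0 e))"
      by (rule chart_open_param(2)[OF ch _ B]) (intro open_Times open_ball)
    show "p \<in> param c ` (ball u0 e \<times> ball v0 e)"
      using is_chartD(4)[OF ch p] x e(1) by (intro image_eqI[of _ _ "(u0, v0)"]) auto
  qed
qed

text \<open>The congruence is fixed by matching frames at one point. \<open>rigidity\<close> extends
  it over coordinate rectangles, and connectedness of \<open>M\<close> over the whole
  surface.\<close>

lemma agree_everywhere_congruent:
  assumes cover: "\<And>p. p \<in> M \<Longrightarrow> \<exists>c. p \<in> fst c \<and> null_coordinates M A F c" and ag: "\<And>p. p \<in> M \<Longrightarrow> agree p"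
  shows "congruent_on M F Ft"
proof (cases "M = {}")
  case True
  then show ?thesis
    unfolding congruent_on_def by (intro exI[of _ "\<lambda>x. x"]) (auto intro: bounded_linear.linear)
next
  case False
  then obtain p0 where p0: "p0 \<in> M" by blast
  obtain c0 where c0: "p0 \<in> fst c0" "null_coordinates M A F c0" using cover[OF p0] by blast
  have ch0: "is_chart M c0" using c0 by (simp add: null_coordinates_def coordinate_system_def)
  define x0 where "x0 = snd c0 p0"
  have x0: "x0 \<in> coord_dom c0" "param c0 x0 = p0" using is_chartD(3,4)[OF ch0 c0(1)] by (simp_all add: x0_def)
  interpret a: null_surface "coord_dom c0" "F \<circ> param c0" "N \<circ> param c0" by (rule null_pair(1)[OF c0(2)])
  interpret b: null_surface "coord_dom c0" "Ft \<circ> param c0" "Nt \<circ> param c0" by (rule null_pair(2)[OF c0(2)])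
  have hh: "b.h x0 = a.h x0" by (rule null_pair(3)[OF c0(2) x0(1)])
  have h0: "a.h x0 \<noteq> 0" by (rule a.h_nonzero[OF x0(1)])
  define e1 e2 e3 where "e1 = D1 (F \<circ> param c0) x0" and "e2 = D2 (F \<circ> param c0) x0" and "e3 = (N \<circ> param c0) x0"
  define g1 g2 g3 where "g1 = D1 (Ft \<circ> param c0) x0" and "g2 = D2 (Ft \<circ> param c0) x0" and "g3 = (Nt \<circ> param c0) x0"
  have ge: "mink e1 e1 = 0" "mink e2 e2 = 0" "mink e1 e2 = a.h x0" "mink e2 e1 = a.h x0" "mink e3 e3 = 1"
    "mink e1 e3 = 0" "mink e2 e3 = 0" "mink e3 e1 = 0" "mink e3 e2 = 0"
    using a.null[OF x0(1)] a.unit[OF x0(1)] a.orth[OF x0(1)] by (simp_all add: e1_def e2_def e3_def a.h_def mink_commute)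
  have gg: "mink g1 g1 = 0" "mink g2 g2 = 0" "mink g1 g2 = a.h x0" "mink g2 g1 = a.h x0" "mink g3 g3 = 1"
    "mink g1 g3 = 0" "mink g2 g3 = 0" "mink g3 g1 = 0" "mink g3 g2 = 0"
    using b.null[OF x0(1)] b.unit[OF x0(1)] b.orth[OF x0(1)]
    by (simp_all add: g1_def g2_def g3_def hh[symmetric] b.h_def mink_commute)
  \<comment> \<open>The linear map that carries the frame of the given surface at \<open>p0\<close>
    to that of the other; it preserves \<open>mink\<close> because the two frames have the same
    scalar products.\<close>
  define L where "L w = (mink w e2 / a.h x0) *\<^sub>R g1 + (mink w e1 / a.h x0) *\<^sub>R g2 + mink w e3 *\<^sub>R g3" for w
  have L: "linear L"
    by (rule linearI) (simp_all add: L_def algebra_simps add_divide_distrib)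
  have Le: "L e1 = g1" "L e2 = g2" "L e3 = g3" using ge h0 by (simp_all add: L_def)
  have Lm: "mink (L w) (L w') = mink w w'" for w w'
  proof -
    have ex: "w = (mink w e2 / a.h x0) *\<^sub>R e1 + (mink w e1 / a.h x0) *\<^sub>R e2 + mink w e3 *\<^sub>R e3" for w
      using a.expansion[OF x0(1)] by (simp add: e1_def e2_def e3_def)
    have "mink w w' = mink ((mink w e2 / a.h x0) *\<^sub>R e1 + (mink w e1 / a.h x0) *\<^sub>R e2 + mink w e3 *\<^sub>R e3)
       ((mink w' e2 / a.h x0) *\<^sub>R e1 + (mink w' e1 / a.h x0) *\<^sub>R e2 + mink w' e3 *\<^sub>R e3)"
      using ex[of w] ex[of w'] by simp
    then show ?thesis unfolding L_def by (simp only: mink_simps ge gg)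
  qed
  define b0 where "b0 = Ft p0 - L (F p0)"
  \<comment> \<open>The identity is demanded on a neighbourhood, not only at a point, so that it can
    be differentiated; this supplies the whole initial frame for \<open>rigidity\<close> in the next
    rectangle.\<close>
  define P where "P q \<longleftrightarrow> (\<exists>T. openin (top_of_set M) T \<and> q \<in> T \<and> (\<forall>y\<in>T. Ft y = L (F y) + b0 \<and> Nt y = L (N y)))" for q
  have rect: "Ft y = L (F y) + b0 \<and> Nt y = L (N y)"
    if n: "null_coordinates M A F c" and B: "B = ball u0 e \<times> ball v0 e" "B \<subseteq> coord_dom c" and z: "z \<in> B"
      and init: "(Ft \<circ> param c) z = L ((F \<circ> param c) z) + b0" "D1 (Ft \<circ> param c) z = L (D1 (F \<circ> param c) z)"
        "D2 (Ft \<circ> param c) z = L (D2 (F \<circ> param c) z)" "(Nt \<circ> param c) z = L ((N \<circ> param c) z)"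
      and y: "y \<in> param c ` B" for c B u0 e v0 z y
  proof -
    have ch: "is_chart M c" using n by (simp add: null_coordinates_def coordinate_system_def)
    have oB: "open B" unfolding B(1) by (intro open_Times open_ball)
    have cB: "connected B" unfolding B(1) by (rule connected_rectangle)
    obtain y' where y': "y' \<in> B" "y = param c y'" using y by blast
    have eq: "Q_coeff (F \<circ> param c) (N \<circ> param c) x = Q_coeff (Ft \<circ> param c) (Nt \<circ> param c) x"
      "R_coeff (F \<circ> param c) (N \<circ> param c) x = R_coeff (Ft \<circ> param c) (Nt \<circ> param c) x" if "x \<in> B" for x
    proof -
      have x: "x \<in> coord_dom c" using B(2) that by blast
      have p: "param c x \<in> fst c" "snd c (param c x) = x" using is_chartD(5,6)[OF ch x] .
      then have "agree (param c x)" using ag is_chartD(1)[OF ch] by blast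
      then show "Q_coeff (F \<circ> param c) (N \<circ> param c) x = Q_coeff (Ft \<circ> param c) (Nt \<circ> param c) x"
        "R_coeff (F \<circ> param c) (N \<circ> param c) x = R_coeff (Ft \<circ> param c) (Nt \<circ> param c) x"
        using agree_iff[OF n p(1)] p(2) by auto
    qed
    have hk: "null_surface.h (F \<circ> param c) x = null_surface.h (Ft \<circ> param c) x"
      "null_surface.k (F \<circ> param c) (N \<circ> param c) x = null_surface.k (Ft \<circ> param c) (Nt \<circ> param c) x" if "x \<in> B" for x
      using null_pair(3,4)[OF n] subsetD[OF B(2) that] by simp_all
    note r = rigidity[OF null_surface_subset[OF null_pair(1)[OF n] B(2) oB] null_surface_subset[OF null_pair(2)[OF n] B(2) oB]
        cB z y'(1) hk eq L init]
    show ?thesis using r y'(2) by simp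
  qed
  have "P p" if p: "p \<in> M" for p
  proof (rule connected_induction_simple[where P = P and S = M and a = p0 and b = p])
    show "connected M" using manifold by (simp add: smooth_2manifold_def)
    show "p0 \<in> M" "p \<in> M" by fact+
    show "P p0"
    proof -
      obtain u0 v0 e where B: "e > 0" "snd c0 p0 = (u0, v0)" "ball u0 e \<times> ball v0 e \<subseteq> coord_dom c0"
        "openin (top_of_set M) (param c0 ` (ball u0 e \<times> ball v0 e))" "p0 \<in> param c0 ` (ball u0 e \<times> ball v0 e)"
        by (rule coordinate_rectangle[OF c0(2,1)])
      have x0B: "x0 \<in> ball u0 e \<times> ball v0 e" using B(1,2) by (simp add: x0_def)
      have "Ft y = L (F y) + b0 \<and> Nt y = L (N y)" if "y \<in> param c0 ` (ball u0 e \<times> ball v0 e)" for y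
        by (rule rect[OF c0(2) refl B(3) x0B _ _ _ _ that])
           (use x0(2) Le in \<open>simp_all add: b0_def e1_def e2_def e3_def g1_def g2_def g3_def\<close>)
      then show ?thesis unfolding P_def using B(4,5) by blast
    qed
    fix p1 assume p1: "p1 \<in> M"
    then obtain c where c: "p1 \<in> fst c" "null_coordinates M A F c" using cover by blast
    have ch: "is_chart M c" using c by (simp add: null_coordinates_def coordinate_system_def)
    obtain u0 v0 e where B: "e > 0" "snd c p1 = (u0, v0)" "ball u0 e \<times> ball v0 e \<subseteq> coord_dom c"
      "openin (top_of_set M) (param c ` (ball u0 e \<times> ball v0 e))" "p1 \<in> param c ` (ball u0 e \<times> ball v0 e)"
      by (rule coordinate_rectangle[OF c(2,1)])
    let ?T = "param c ` (ball u0 e \<times> ball v0 e)"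
    have "P y" if xy: "x \<in> ?T" "y \<in> ?T" "P x" for x y
    proof -
      obtain T' where T': "openin (top_of_set M) T'" "x \<in> T'" "\<And>y. y \<in> T' \<Longrightarrow> Ft y = L (F y) + b0 \<and> Nt y = L (N y)"
        using xy(3) unfolding P_def by blast
      obtain z where z: "z \<in> ball u0 e \<times> ball v0 e" "x = param c z" using xy(1) by blast
      have zW: "z \<in> coord_dom c" using z(1) B(3) by blast
      have Tc: "?T \<subseteq> fst c" using is_chartD(5)[OF ch] B(3) by blast
      define O' where "O' = snd c ` (T' \<inter> ?T)"
      have O: "open O'" unfolding O'_def
        by (rule chart_open_image[OF ch openin_Int[OF T'(1) B(4)]]) (use Tc in blast)
      have zO: "z \<in> O'"
        unfolding O'_def using T'(2) xy(1) z(2) is_chartD(6)[OF ch zW] by (intro image_eqI[of _ _ x]) auto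
      have eqO: "(Ft \<circ> param c) w = L ((F \<circ> param c) w) + b0" "(Nt \<circ> param c) w = L ((N \<circ> param c) w)" if "w \<in> O'" for w
      proof -
        obtain q where q: "q \<in> T'" "q \<in> ?T" "w = snd c q" using \<open>w \<in> O'\<close> by (auto simp: O'_def)
        have "param c w = q" using is_chartD(4)[OF ch] Tc q(2,3) by blast
        then show "(Ft \<circ> param c) w = L ((F \<circ> param c) w) + b0" "(Nt \<circ> param c) w = L ((N \<circ> param c) w)"
          using T'(3)[OF q(1)] by simp_all
      qed
      have bl: "bounded_linear L" using L by (simp add: linear_conv_bounded_linear)
      interpret ca: null_surface "coord_dom c" "F \<circ> param c" "N \<circ> param c" by (rule null_pair(1)[OF c(2)])
      have D: "D1 (Ft \<circ> param c) z = L (D1 (F \<circ> param c) z)" "D2 (Ft \<circ> param c) z = L (D2 (F \<circ> param c) z)"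
        using D_cong[OF O zO, of "Ft \<circ> param c" "\<lambda>x. L ((F \<circ> param c) x) + b0"] eqO(1)
          D_add[OF smooth_on_bounded_linear[OF bl ca.open_W ca.smooth_f] smooth_on_const zW, of b0]
          D_linear[OF bl ca.smooth_f zW] by (simp_all del: o_apply)
      have "Ft y = L (F y) + b0 \<and> Nt y = L (N y)" if "y \<in> ?T" for y
        by (rule rect[OF c(2) refl B(3) z(1) eqO(1)[OF zO] D eqO(2)[OF zO] that])
      then show ?thesis unfolding P_def using B(4) xy(2) by blast
    qed
    then show "\<exists>T. openin (top_of_set M) T \<and> p1 \<in> T \<and> (\<forall>x\<in>T. \<forall>y\<in>T. P x \<longrightarrow> P y)"
      using B(4,5) by blast
  qed
  then have "\<forall>p\<in>M. Ft p = L (F p) + b0" unfolding P_def by blast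
  then show ?thesis unfolding congruent_on_def using L Lm by blast
qed

text \<open>Within an isothermic rectangle \<open>hopf_agreement_spreads\<close> applies, since
  without umbilics \<open>Q\<close> and \<open>R\<close> have no zeros there. Such rectangles cover
  the connected surface, and \<open>agree\<close> has the same meaning in all of them.\<close>

lemma agree_spreads:
  assumes s: "s = 1 \<or> s = -1" and iso: "isothermic_surface s M A F N" and u: "umbilic_free A F N"
    and p: "p \<in> M" "p' \<in> M" "agree p"
  shows "agree p'"
proof (rule connected_induction_simple[where P = agree and S = M and a = p and b = p'])
  show "connected M" using manifold by (simp add: smooth_2manifold_def)
  fix p1 assume p1: "p1 \<in> M"
  then obtain c q \<rho> \<sigma> where c: "p1 \<in> fst c" "isothermic_coordinates s M A F N c q \<rho> \<sigma>"
    using iso unfolding isothermic_surface_def by blast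
  have n: "null_coordinates M A F c" using c(2) by (simp add: isothermic_coordinates_def)
  have ch: "is_chart M c" using n by (simp add: null_coordinates_def coordinate_system_def)
  obtain u0 v0 e where B: "e > 0" "snd c p1 = (u0, v0)" "ball u0 e \<times> ball v0 e \<subseteq> coord_dom c"
    "openin (top_of_set M) (param c ` (ball u0 e \<times> ball v0 e))" "p1 \<in> param c ` (ball u0 e \<times> ball v0 e)"
    by (rule coordinate_rectangle[OF n c(1)])
  let ?B = "ball u0 e \<times> ball v0 e"
  have oB: "open ?B" by (intro open_Times open_ball)
  interpret isothermic_patch "coord_dom c" "F \<circ> param c" "N \<circ> param c" s q \<rho> \<sigma>
    by (rule isothermic_coordinates_patch[OF s tl c(2)])
  have nz: "Q x \<noteq> 0" "R x \<noteq> 0" if "x \<in> ?B" for x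
  proof -
    have x: "x \<in> coord_dom c" using B(3) that by blast
    show "Q x \<noteq> 0" "R x \<noteq> 0"
      using umbilic_free_isothermic[OF s tl u c(2) x] pos[OF x] s by (auto simp: Q_eq[OF x] R_eq[OF x])
  qed
  have "agree y" if xy: "x \<in> param c ` ?B" "y \<in> param c ` ?B" "agree x" for x y
  proof -
    obtain x' y' where z: "x' \<in> ?B" "x = param c x'" "y' \<in> ?B" "y = param c y'" using xy(1,2) by blast
    have W: "x' \<in> coord_dom c" "y' \<in> coord_dom c" using z B(3) by blast+
    note sx = is_chartD(5,6)[OF ch W(1), folded z(2)] and sy = is_chartD(5,6)[OF ch W(2), folded z(4)]
    have "Q_coeff (Ft \<circ> param c) (Nt \<circ> param c) x' = Q x'"
      using xy(3) agree_iff[OF n sx(1)] sx(2) by simp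
    then have "Q_coeff (Ft \<circ> param c) (Nt \<circ> param c) y' = Q y' \<and> R_coeff (Ft \<circ> param c) (Nt \<circ> param c) y' = R y'"
      using null_pair(3,4)[OF n] B(3)
      by (intro hopf_agreement_spreads[OF null_surface_subset[OF null_surface_axioms B(3) oB]
            null_surface_subset[OF null_pair(2)[OF n] B(3) oB] refl _ _ nz z(1) _ z(3)]) auto
    then show ?thesis using agree_iff[OF n sy(1)] sy(2) by simp
  qed
  then show "\<exists>T. openin (top_of_set M) T \<and> p1 \<in> T \<and> (\<forall>x\<in>T. \<forall>y\<in>T. agree x \<longrightarrow> agree y)"
    using B(4,5) by blast
qed (use p in auto)

end

lemma bonnet_harmonic:
  assumes s: "s = 1 \<or> s = -1" and iso: "isothermic_surface s M A F N" and bonnet: "timelike_bonnet M A F N"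
    and u: "umbilic_free A F N" and c: "isothermic_coordinates s M A F N c q \<rho> \<sigma>" and x: "x \<in> coord_dom c"
  shows "D2 (D1 (\<lambda>y. 1 / q y)) x = 0"
proof -
  have tl: "timelike_surface M A F N" using iso by (simp add: isothermic_surface_def)
  obtain \<epsilon> :: real and Ft Nt where
    def: "\<forall>t\<in>{-\<epsilon><..<\<epsilon>}. timelike_surface M A (Ft t) (Nt t) \<and>
           (\<forall>c\<in>A. \<forall>x\<in>coord_dom c. first_form (Ft t \<circ> param c) x = first_form (F \<circ> param c) x \<and>
              mean_curvature (Ft t \<circ> param c) (Nt t \<circ> param c) x = mean_curvature (F \<circ> param c) (N \<circ> param c) x)"
    and ex: "\<exists>t\<in>{-\<epsilon><..<\<epsilon>}. \<not> congruent_on M F (Ft t)"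
    using bonnet unfolding timelike_bonnet_def by (elim conjE exE) (rule that; assumption)
  obtain t where t: "t \<in> {-\<epsilon><..<\<epsilon>}" "\<not> congruent_on M F (Ft t)"
    using ex by blast
  interpret isometric_pair M A F N "Ft t" "Nt t"
    by unfold_locales (use tl bspec[OF def t(1)] in auto)
  have cover: "\<exists>c. p \<in> fst c \<and> null_coordinates M A F c" if "p \<in> M" for p
    using iso that unfolding isothermic_surface_def isothermic_coordinates_def by blast
  \<comment> \<open>Agreement at one point would spread to all of \<open>M\<close> and make this
    member of the deformation congruent to the surface.\<close>
  have not_agree: "\<not> agree p" if "p \<in> M" for p
    using agree_everywhere_congruent[OF cover] agree_spreads[OF s iso u that] t(2) by blast
  have n: "null_coordinates M A F c" using c by (simp add: isothermic_coordinates_def)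
  have ch: "is_chart M c" using n by (simp add: null_coordinates_def coordinate_system_def)
  interpret isothermic_patch "coord_dom c" "F \<circ> param c" "N \<circ> param c" s q \<rho> \<sigma>
    by (rule isothermic_coordinates_patch[OF s tl c])
  show ?thesis
  proof (rule deformation_harmonic[OF null_pair(2)[OF n] null_pair(3)[OF n] null_pair(4)[OF n] _ _ x])
    show "q y \<noteq> 0" if "y \<in> coord_dom c" for y by (rule umbilic_free_isothermic[OF s tl u c that])
    show "Q_coeff (Ft t \<circ> param c) (Nt t \<circ> param c) y \<noteq> Q y \<or> R_coeff (Ft t \<circ> param c) (Nt t \<circ> param c) y \<noteq> R y"
      if y: "y \<in> coord_dom c" for y
    proof -
      have "param c y \<in> M" using is_chartD(1)[OF ch] is_chartD(5)[OF ch y] by blast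
      then have "\<not> agree (param c y)" by (rule not_agree)
      then show ?thesis using agree_iff[OF n is_chartD(5)[OF ch y]] is_chartD(6)[OF ch y] by simp
    qed
  qed
qed

subsection \<open>The dual surface\<close>

lemma is_chart_self: "is_chart M c \<Longrightarrow> is_chart (fst c) c"
  by (simp add: is_chart_def)

lemma compatible_self:
  assumes "is_chart M c" shows "compatible c c"
proof -
  have "smooth_on (snd c \<circ> param c) (coord_dom c)"
    by (rule smooth_on_cong[OF is_chartD(2)[OF assms] _ smooth_on_ident[OF is_chartD(2)[OF assms]]])
       (simp add: is_chartD(6)[OF assms])
  then show ?thesis by (simp add: compatible_def coord_dom_def)
qed

lemma single_chart_surface:
  assumes ch: "is_chart M c" and con: "connected (coord_dom c)"
    and P: "null_surface (coord_dom c) (F \<circ> param c) (N \<circ> param c)"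
  shows "timelike_surface (fst c) {c} F N"
proof -
  have "param c ` coord_dom c = fst c"
    using ch by (simp add: is_chart_def homeomorphism_def)
  then have "connected (fst c)"
    using connected_continuous_image[OF is_chartD(7)[OF ch] con] by simp
  then show ?thesis
    using is_chart_self[OF ch] compatible_self[OF ch] null_surface.patch[OF P]
    by (simp add: timelike_surface_iff smooth_2manifold_def)
qed

lemma subchart:
  assumes ch: "is_chart M c" and B: "open B" "B \<subseteq> coord_dom c"
  defines "V \<equiv> param c ` B"
  shows "is_chart V (V, snd c)" "coord_dom (V, snd c) = B" "x \<in> B \<Longrightarrow> param (V, snd c) x = param c x"
    "snd c ` V = B" "V \<subseteq> fst c"
proof -
  note C = is_chartD[OF ch]
  show V: "V \<subseteq> fst c" using C(5) B(2) by (auto simp: V_def)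
  show img: "snd c ` V = B" using C(6) B(2) by (force simp: V_def)
  then show cd: "coord_dom (V, snd c) = B" by (simp add: coord_dom_def)
  have inj: "inj_on (snd c) V" using C(4) V by (metis inj_onI subsetD)
  have pc: "param (V, snd c) x = param c x" if "x \<in> B" for x
    unfolding param_def[of "(V, snd c)"] fst_conv snd_conv
    by (rule inv_into_f_eq[OF inj], use that in \<open>simp add: V_def\<close>, use that C(6) B(2) in blast)
  then show "x \<in> B \<Longrightarrow> param (V, snd c) x = param c x" .
  have "continuous_on B (param c)" using C(7) B(2) by (rule continuous_on_subset)
  then have "continuous_on B (param (V, snd c))" by (rule continuous_on_eq) (simp add: pc)
  moreover have "continuous_on V (snd c)" using C(8) V by (rule continuous_on_subset)
  ultimately have "homeomorphism V B (snd c) (param (V, snd c))"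
  proof (intro homeomorphismI)
    show "param (V, snd c) (snd c p) = p" if "p \<in> V" for p
      using that img pc C(4) V by (metis imageI subsetD)
    show "snd c (param (V, snd c) x) = x" if "x \<in> B" for x
      using that pc C(6) B(2) by (metis subsetD)
  qed (use img pc in \<open>auto simp: V_def\<close>)
  then show "is_chart V (V, snd c)"
    unfolding is_chart_def cd using B(1) by simp
qed

text \<open>For \<open>s = -1\<close> this reverses the first null coordinate, which makes the metric coefficient of the
  dual surface positive.\<close>

lemma flipped_chart:
  fixes c :: "'m::t2_space chart" and s :: real and \<iota> :: "real \<times> real \<Rightarrow> real \<times> real"
  assumes s: "s = 1 \<or> s = -1" and ch: "is_chart M c"
    and \<iota>_def: "\<iota> = (\<lambda>x. (s * fst x, snd x))" and e_def: "e = (fst c, \<lambda>p. \<iota> (snd c p))"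
  shows "coordinate_system (fst c) {c} e" "coord_dom e = \<iota> ` coord_dom c"
    "x \<in> coord_dom e \<Longrightarrow> \<iota> x \<in> coord_dom c" "x \<in> coord_dom e \<Longrightarrow> param e x = param c (\<iota> x)"
proof -
  note C = is_chartD[OF ch]
  have ii: "\<iota> (\<iota> x) = x" for x using s by (auto simp: \<iota>_def prod_eq_iff)
  have bl: "bounded_linear \<iota>"
    unfolding \<iota>_def linear_conv_bounded_linear[symmetric] by (rule linearI) (auto simp: algebra_simps)
  show cd: "coord_dom e = \<iota> ` coord_dom c" by (auto simp: coord_dom_def e_def)
  show ic: "\<iota> x \<in> coord_dom c" if x: "x \<in> coord_dom e" for x
  proof -
    obtain y where "y \<in> coord_dom c" "x = \<iota> y" using x unfolding cd by (rule imageE) blast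
    then show ?thesis by (simp only: ii)
  qed
  have inj: "inj_on (\<lambda>p. \<iota> (snd c p)) (fst c)"
  proof (rule inj_onI)
    fix p p' assume p: "p \<in> fst c" "p' \<in> fst c" "\<iota> (snd c p) = \<iota> (snd c p')"
    have "snd c p = snd c p'" using arg_cong[OF p(3), of \<iota>] by (simp only: ii)
    then have "param c (snd c p) = param c (snd c p')" by (rule arg_cong)
    then show "p = p'" by (simp only: C(4)[OF p(1)] C(4)[OF p(2)])
  qed
  show pe: "param e x = param c (\<iota> x)" if "x \<in> coord_dom e" for x
    unfolding param_def[of e] unfolding e_def fst_conv snd_conv
    by (rule inv_into_f_eq[OF inj]) (simp_all only: C(5,6)[OF ic[OF that]] ii)
  have "coord_dom e = \<iota> -` coord_dom c"
  proof (intro subset_antisym subsetI vimageI2)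
    show "\<iota> x \<in> coord_dom c" if "x \<in> coord_dom e" for x using that by (rule ic)
    show "x \<in> coord_dom e" if "x \<in> \<iota> -` coord_dom c" for x
    proof -
      have "\<iota> (\<iota> x) \<in> coord_dom e" unfolding cd using that by (intro imageI) (rule vimageD)
      then show ?thesis by (simp only: ii)
    qed
  qed
  then have oe: "open (coord_dom e)"
    using C(2) by (simp add: continuous_open_vimage linear_continuous_at[OF bl])
  have "homeomorphism (fst c) (coord_dom e) (snd e) (param e)"
  proof (rule homeomorphismI)
    show "continuous_on (fst c) (snd e)"
      unfolding e_def snd_conv by (rule continuous_on_compose2[OF linear_continuous_on[OF bl] C(8) subset_UNIV])
    have "continuous_on (coord_dom e) (\<lambda>x. param c (\<iota> x))"
      using ic by (intro continuous_on_compose2[OF C(7) linear_continuous_on[OF bl]]) auto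
    then show "continuous_on (coord_dom e) (param e)"
      by (rule continuous_on_eq) (simp add: pe)
    show "snd e ` fst c \<subseteq> coord_dom e" by (auto simp: coord_dom_def e_def)
    show "param e ` coord_dom e \<subseteq> fst c" by (rule image_subsetI) (simp only: pe C(5) ic)
    show "param e (snd e p) = p" if p: "p \<in> fst c" for p
    proof -
      have "snd e p \<in> coord_dom e" using p by (simp add: coord_dom_def e_def)
      then show ?thesis using pe ii C(4)[OF p] by (simp add: e_def)
    qed
    show "snd e (param e x) = x" if "x \<in> coord_dom e" for x
      using pe[OF that] C(6)[OF ic[OF that]] ii by (simp add: e_def)
  qed
  then have ce: "is_chart (fst c) e" unfolding is_chart_def using oe by (simp add: e_def)
  have "smooth_on (snd c \<circ> param e) (coord_dom e)"
    by (rule smooth_on_cong[OF oe _ smooth_on_linear[OF bl oe]]) (use pe ic C(6) in simp)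
  moreover have "smooth_on (snd e \<circ> param c) (coord_dom c)"
    by (rule smooth_on_cong[OF C(2) _ smooth_on_linear[OF bl C(2)]]) (use C(6) in \<open>simp add: e_def\<close>)
  ultimately have "compatible e c"
    unfolding compatible_def coord_dom_def by (simp add: e_def)
  then show "coordinate_system (fst c) {c} e"
    using ce by (simp add: coordinate_system_def)
qed

lemma D_flip:
  fixes g :: "real \<times> real \<Rightarrow> real^3" and s :: real and \<iota> :: "real \<times> real \<Rightarrow> real \<times> real"
  assumes \<iota>_def: "\<iota> = (\<lambda>x. (s * fst x, snd x))" and "open W" "open W'" "\<And>x. x \<in> W' \<Longrightarrow> \<iota> x \<in> W" "smooth_on g W" "x \<in> W'"
  shows "D1 (\<lambda>x. g (\<iota> x)) x = s *\<^sub>R D1 g (\<iota> x)" "D2 (\<lambda>x. g (\<iota> x)) x = D2 g (\<iota> x)"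
    "D1 (D1 (\<lambda>x. g (\<iota> x))) x = (s * s) *\<^sub>R D1 (D1 g) (\<iota> x)" "D2 (D2 (\<lambda>x. g (\<iota> x))) x = D2 (D2 g) (\<iota> x)"
proof -
  have bl: "bounded_linear \<iota>"
    unfolding \<iota>_def linear_conv_bounded_linear[symmetric] by (rule linearI) (auto simp: algebra_simps)
  have sm: "smooth_on \<iota> W'" by (rule smooth_on_linear[OF bl assms(3)])
  have D\<iota>: "D1 \<iota> x = (s, 0)" "D2 \<iota> x = (0, 1)" for x
    using has_derivative_D1[OF bounded_linear_imp_has_derivative[OF bl]]
      has_derivative_D2[OF bounded_linear_imp_has_derivative[OF bl]] by (simp_all add: \<iota>_def)
  have ch: "D1 (\<lambda>x. k (\<iota> x)) y = s *\<^sub>R D1 k (\<iota> y)" "D2 (\<lambda>x. k (\<iota> x)) y = D2 k (\<iota> y)"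
    if "smooth_on k W" "y \<in> W'" for k :: "real \<times> real \<Rightarrow> real^3" and y
    using D_chain[OF sm that(1,2) assms(4)[OF that(2)]] by (simp_all add: D\<iota>)
  show "D1 (\<lambda>x. g (\<iota> x)) x = s *\<^sub>R D1 g (\<iota> x)" "D2 (\<lambda>x. g (\<iota> x)) x = D2 g (\<iota> x)"
    using ch[OF assms(5,6)] .
  have sc: "smooth_on (\<lambda>x. D1 g (\<iota> x)) W'"
    by (rule smooth_on_compose[OF assms(3,2) _ sm smooth_on_D1[OF assms(5)]]) (use assms(4) in auto)
  have "D1 (D1 (\<lambda>x. g (\<iota> x))) x = D1 (\<lambda>x. s *\<^sub>R D1 g (\<iota> x)) x"
    by (rule D_cong(1)[OF assms(3,6) ch(1)[OF assms(5)]])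
  also have "\<dots> = s *\<^sub>R D1 (\<lambda>x. D1 g (\<iota> x)) x"
    by (rule D_linear(1)[OF bounded_linear_scaleR_right sc assms(6)])
  finally show "D1 (D1 (\<lambda>x. g (\<iota> x))) x = (s * s) *\<^sub>R D1 (D1 g) (\<iota> x)"
    using ch(1)[OF smooth_on_D1[OF assms(5)] assms(6)] by simp
  show "D2 (D2 (\<lambda>x. g (\<iota> x))) x = D2 (D2 g) (\<iota> x)"
    using D_cong(2)[OF assms(3,6) ch(2)[OF assms(5)]] ch(2)[OF smooth_on_D2[OF assms(5)] assms(6)] by simp
qed

text \<open>Two descriptions of the dual are provided. The \<open>isothermic_patch\<close> keeps the
  coordinates \<open>c\<close> and is suited to computation; \<open>isothermic_surface\<close> asks
  for a positive metric coefficient and therefore uses the flipped chart.\<close>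

lemma dual_construction:
  fixes M :: "'m::t2_space set" and F N :: "'m \<Rightarrow> real^3"
  assumes s: "s = 1 \<or> s = -1" and tl: "timelike_surface M A F N"
    and iso: "isothermic_coordinates s M A F N c q \<rho> \<sigma>" and sc: "simply_connected (coord_dom c)"
  obtains G where "christoffel_dual s c \<rho> \<sigma> F N G" "isothermic_surface s (fst c) {c} G N"
    "isothermic_patch (coord_dom c) (G \<circ> param c) (N \<circ> param c) s (mean_curvature (F \<circ> param c) (N \<circ> param c)) \<rho> \<sigma>"
    "\<And>x. x \<in> coord_dom c \<Longrightarrow> mean_curvature (G \<circ> param c) (N \<circ> param c) x = q x"
proof -
  let ?W = "coord_dom c"
  have n: "null_coordinates M A F c" using iso by (simp add: isothermic_coordinates_def)
  have ch: "is_chart M c" using n by (simp add: null_coordinates_def coordinate_system_def)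
  have ss: "s * s = 1" using s by auto
  interpret isothermic_patch ?W "F \<circ> param c" "N \<circ> param c" s q \<rho> \<sigma>
    by (rule isothermic_coordinates_patch[OF s tl iso])
  have hpos: "h x > 0" if "x \<in> ?W" for x by (rule null_coordinates_surface(2)[OF tl n that])
  obtain g where g: "null_surface ?W g (N \<circ> param c)"
    "\<And>x. x \<in> ?W \<Longrightarrow> D1 g x = (\<rho> (fst x) / (2 * h x)) *\<^sub>R D2 (F \<circ> param c) x"
    "\<And>x. x \<in> ?W \<Longrightarrow> D2 g x = (s * \<sigma> (snd x) / (2 * h x)) *\<^sub>R D1 (F \<circ> param c) x"
    "\<And>x. x \<in> ?W \<Longrightarrow> null_surface.h g x = s * (\<rho> (fst x) * \<sigma> (snd x) / (4 * h x))"
    "\<And>x. x \<in> ?W \<Longrightarrow> null_surface.H g (N \<circ> param c) x = q x"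
    "\<And>x. x \<in> ?W \<Longrightarrow> Q_coeff g (N \<circ> param c) x = 1/2 * H x * \<rho> (fst x)"
    "\<And>x. x \<in> ?W \<Longrightarrow> R_coeff g (N \<circ> param c) x = s * (1/2 * H x * \<sigma> (snd x))"
    proof (rule dual_exists[OF sc], goal_cases)
    case (1 g)
    show ?thesis by (rule 1(1)[of g]) (fact 1)+
  qed
  \<comment> \<open>Defined at all points, but meaningful on the region of \<open>c\<close>
    only.\<close>
  define G where "G p = g (snd c p)" for p
  have Gg: "g x = (G \<circ> param c) x" if "x \<in> ?W" for x using is_chartD(6)[OF ch that] by (simp add: G_def)
  have cong: "D1 g x = D1 (G \<circ> param c) x" "D2 g x = D2 (G \<circ> param c) x"
    "mean_curvature g (N \<circ> param c) x = mean_curvature (G \<circ> param c) (N \<circ> param c) x"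
    "Q_coeff g (N \<circ> param c) x = Q_coeff (G \<circ> param c) (N \<circ> param c) x"
    "R_coeff g (N \<circ> param c) x = R_coeff (G \<circ> param c) (N \<circ> param c) x" if "x \<in> ?W" for x
    by (rule surface_cong[OF open_W that Gg refl], assumption)+
  have nsG: "null_surface ?W (G \<circ> param c) (N \<circ> param c)"
    by (rule null_surface_cong[OF g(1) Gg refl])
  interpret g: null_surface ?W g "N \<circ> param c" by (rule g(1))
  interpret G: null_surface ?W "G \<circ> param c" "N \<circ> param c" by (rule nsG)
  have Hm: "mean_curvature (F \<circ> param c) (N \<circ> param c) x = H x" if "x \<in> ?W" for x by (rule mean_curvature_eq[OF that])
  have con: "connected ?W" using sc by (rule simply_connected_imp_connected)
  have tG: "timelike_surface (fst c) {c} G N" by (rule single_chart_surface[OF ch con nsG])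
  have ex: "exp (- omega (F \<circ> param c) x) = 1 / (2 * h x)" if "x \<in> ?W" for x
    using hpos[OF that] first_form_eq[OF that] by (simp add: omega_def exp_minus inverse_eq_divide)
  have "christoffel_dual s c \<rho> \<sigma> F N G"
    unfolding christoffel_dual_def
  proof (intro conjI tG ballI, clarify)
    fix u v assume x: "(u, v) \<in> ?W"
    show "D1 (G \<circ> param c) (u, v) = (exp (- omega (F \<circ> param c) (u, v)) * \<rho> u) *\<^sub>R D2 (F \<circ> param c) (u, v) \<and>
      D2 (G \<circ> param c) (u, v) = (s * exp (- omega (F \<circ> param c) (u, v)) * \<sigma> v) *\<^sub>R D1 (F \<circ> param c) (u, v)"
      using g(2,3)[OF x] by (simp add: ex[OF x] cong(1,2)[OF x, symmetric] del: o_apply)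
  qed
  moreover have mq: "mean_curvature (G \<circ> param c) (N \<circ> param c) x = q x" if "x \<in> ?W" for x
    using g.mean_curvature_eq[OF that] g(5)[OF that] cong(3)[OF that] by simp
  moreover have patch: "isothermic_patch ?W (G \<circ> param c) (N \<circ> param c) s (mean_curvature (F \<circ> param c) (N \<circ> param c)) \<rho> \<sigma>"
    by unfold_locales (use s smooth_\<rho> smooth_\<sigma> pos g(6,7) cong(4,5) Hm in \<open>simp_all del: o_apply\<close>)
  moreover have "isothermic_surface s (fst c) {c} G N"
    unfolding isothermic_surface_def
  proof (intro conjI tG ballI)
    fix p assume p: "p \<in> fst c"
    \<comment> \<open>The identity for s = 1 and the reflection of u for s = -1. It multiplies the
      metric coefficient by s but leaves both Hopf coefficients alone, since \<open>Q\<close>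
      contains two derivatives in u.\<close>
    define \<iota> where "\<iota> = (\<lambda>x :: real \<times> real. (s * fst x, snd x))"
    define e where "e = (fst c, \<lambda>p. \<iota> (snd c p))"
    note fl = flipped_chart[OF s ch \<iota>_def e_def]
    have ii: "\<iota> (\<iota> x) = x" for x using ss by (auto simp: \<iota>_def prod_eq_iff)
    have bl: "bounded_linear \<iota>"
      unfolding \<iota>_def linear_conv_bounded_linear[symmetric] by (rule linearI) (auto simp: algebra_simps)
    have oe: "open (coord_dom e)" using fl(1) is_chartD(2) unfolding coordinate_system_def by blast
    have pe: "(K \<circ> param e) x = (\<lambda>x. (K \<circ> param c) (\<iota> x)) x" if "x \<in> coord_dom e" for x and K :: "'m \<Rightarrow> real^3"
      using fl(4)[OF that] by simp
    have De: "D1 (G \<circ> param e) x = s *\<^sub>R D1 (G \<circ> param c) (\<iota> x)" "D2 (G \<circ> param e) x = D2 (G \<circ> param c) (\<iota> x)"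
      "D1 (D1 (G \<circ> param e)) x = D1 (D1 (G \<circ> param c)) (\<iota> x)" "D2 (D2 (G \<circ> param e)) x = D2 (D2 (G \<circ> param c)) (\<iota> x)"
      if x: "x \<in> coord_dom e" for x
    proof -
      note F = D_flip[OF \<iota>_def open_W oe fl(3) G.smooth_f]
      have c12: "D1 (G \<circ> param e) y = D1 (\<lambda>x. (G \<circ> param c) (\<iota> x)) y" "D2 (G \<circ> param e) y = D2 (\<lambda>x. (G \<circ> param c) (\<iota> x)) y"
        if "y \<in> coord_dom e" for y
        by (rule D_cong[OF oe that], erule pe)+
      show "D1 (G \<circ> param e) x = s *\<^sub>R D1 (G \<circ> param c) (\<iota> x)" "D2 (G \<circ> param e) x = D2 (G \<circ> param c) (\<iota> x)"
        using c12[OF x] F(1,2)[OF _ x] by auto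
      show "D1 (D1 (G \<circ> param e)) x = D1 (D1 (G \<circ> param c)) (\<iota> x)" "D2 (D2 (G \<circ> param e)) x = D2 (D2 (G \<circ> param c)) (\<iota> x)"
        using D_cong(1)[OF oe x c12(1)] D_cong(2)[OF oe x c12(2)] F(3,4)[OF _ x] ss by auto
    qed
    have null_e: "null_coordinates (fst c) {c} G e"
      unfolding null_coordinates_def
    proof (intro conjI ballI fl(1))
      fix x assume x: "x \<in> coord_dom e"
      note y = fl(3)[OF x]
      show "first_form (G \<circ> param e) x (1, 0) (1, 0) = 0" "first_form (G \<circ> param e) x (0, 1) (0, 1) = 0"
        unfolding first_form_def D1_def[symmetric] D2_def[symmetric] De[OF x] using G.null[OF y] by simp_all
      have "first_form (G \<circ> param e) x (1, 0) (0, 1) = s * G.h (\<iota> x)"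
        unfolding first_form_def D1_def[symmetric] D2_def[symmetric] De[OF x] by (simp add: G.h_def)
      also have "G.h (\<iota> x) = g.h (\<iota> x)" using cong(1,2)[OF y] by (simp add: G.h_def g.h_def)
      finally have "first_form (G \<circ> param e) x (1, 0) (0, 1) = \<rho> (fst (\<iota> x)) * \<sigma> (snd (\<iota> x)) / (4 * h (\<iota> x))"
        by (simp only: g(4)[OF y] mult.assoc[symmetric] ss mult_1_left)
      then show "first_form (G \<circ> param e) x (1, 0) (0, 1) > 0"
        using pos[OF y] hpos[OF y] by simp
    qed
    have img: "\<iota> ` coord_dom e \<subseteq> ?W" using fl(3) by blast
    have "isothermic_coordinates s (fst c) {c} G N e (\<lambda>x. H (\<iota> x)) (\<lambda>u. \<rho> (s * u)) \<sigma>"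
      unfolding isothermic_coordinates_def
    proof (intro conjI null_e)
      show "smooth_on (\<lambda>x. H (\<iota> x)) (coord_dom e)"
        by (rule smooth_on_compose[OF oe open_W img smooth_on_linear[OF bl oe] smooth_H])
      have f1: "(\<lambda>u. s * u) ` (fst ` coord_dom e) \<subseteq> fst ` ?W"
      proof (clarify)
        fix u v assume "(u, v) \<in> coord_dom e"
        then have "\<iota> (u, v) \<in> ?W" by (rule fl(3))
        then show "s * fst (u, v) \<in> fst ` ?W" by (intro image_eqI[of _ fst "\<iota> (u, v)"]) (auto simp: \<iota>_def)
      qed
      show "smooth_on (\<lambda>u. \<rho> (s * u)) (fst ` coord_dom e)"
        by (rule smooth_on_compose[OF open_image_fst[OF oe] open_image_fst[OF open_W] f1
              smooth_on_linear[OF bounded_linear_mult_right open_image_fst[OF oe]] smooth_\<rho>])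
      have "snd ` coord_dom e \<subseteq> snd ` ?W"
        unfolding fl(2) by (auto simp: \<iota>_def image_iff) (metis snd_conv)
      then show "smooth_on \<sigma> (snd ` coord_dom e)" by (rule smooth_on_subset[OF smooth_\<sigma>])
      show "\<forall>(u, v)\<in>coord_dom e. \<rho> (s * u) > 0 \<and> \<sigma> v > 0 \<and>
        Q_coeff (G \<circ> param e) (N \<circ> param e) (u, v) = 1 / 2 * H (\<iota> (u, v)) * \<rho> (s * u) \<and>
        R_coeff (G \<circ> param e) (N \<circ> param e) (u, v) = s * (1 / 2 * H (\<iota> (u, v)) * \<sigma> v)"
      proof (clarify)
        fix u v assume x: "(u, v) \<in> coord_dom e"
        note y = fl(3)[OF x]
        have N: "(N \<circ> param e) (u, v) = (N \<circ> param c) (\<iota> (u, v))" using pe[OF x] .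
        have "Q_coeff (G \<circ> param e) (N \<circ> param e) (u, v) = G.Q (\<iota> (u, v))"
          "R_coeff (G \<circ> param e) (N \<circ> param e) (u, v) = G.R (\<iota> (u, v))"
          unfolding Q_coeff_def R_coeff_def N De[OF x] by simp_all
        then show "\<rho> (s * u) > 0 \<and> \<sigma> v > 0 \<and>
          Q_coeff (G \<circ> param e) (N \<circ> param e) (u, v) = 1 / 2 * H (\<iota> (u, v)) * \<rho> (s * u) \<and>
          R_coeff (G \<circ> param e) (N \<circ> param e) (u, v) = s * (1 / 2 * H (\<iota> (u, v)) * \<sigma> v)"
          using pos[OF y] g(6,7)[OF y] cong(4,5)[OF y] by (simp add: \<iota>_def)
      qed
    qed
    moreover have "p \<in> fst e" using p by (simp add: e_def)
    ultimately show "\<exists>c' q \<rho> \<sigma>. p \<in> fst c' \<and> isothermic_coordinates s (fst c) {c} G N c' q \<rho> \<sigma>" by blast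
  qed
  ultimately show ?thesis using that by blast
qed

text \<open>In the coordinates \<open>c\<close> the mean curvature is \<open>q\<close>, whose
  inverse is harmonic by hypothesis. The definition quantifies over all null coordinates of the
  dual, which may exclude \<open>c\<close> itself because of the sign;
  \<open>harmonic_null_change\<close> reaches each of them from \<open>c\<close>.\<close>

lemma dual_harmonic:
  assumes ch: "is_chart M c" and tG: "timelike_surface (fst c) {c} G N"
    and ns: "null_surface (coord_dom c) (G \<circ> param c) (N \<circ> param c)"
    and mq: "\<And>x. x \<in> coord_dom c \<Longrightarrow> mean_curvature (G \<circ> param c) (N \<circ> param c) x = q x"
    and q: "smooth_on q (coord_dom c)" "\<And>x. x \<in> coord_dom c \<Longrightarrow> q x \<noteq> 0"
    and harmonic: "\<And>x. x \<in> coord_dom c \<Longrightarrow> D2 (D1 (\<lambda>y. 1 / q y)) x = 0"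
  shows "harmonic_inverse_mean_curvature (fst c) {c} G N"
  unfolding harmonic_inverse_mean_curvature_def
proof (intro conjI tG ballI allI impI)
  fix c' x assume n': "null_coordinates (fst c) {c} G c'" and x: "x \<in> coord_dom c'"
  have cs: "is_chart (fst c) c'" "compatible c' c"
    using n' by (auto simp: null_coordinates_def coordinate_system_def)
  interpret G: null_surface "coord_dom c" "G \<circ> param c" "N \<circ> param c" by (rule ns)
  interpret pair: chart_pair "fst c" c c'
    by unfold_locales (use is_chart_self[OF ch] cs in \<open>auto simp: compatible_def Int_commute\<close>)
  have sub: "fst c' \<subseteq> fst c" by (rule is_chartD(1)[OF cs(1)])
  have V: "pair.V = coord_dom c'" using sub by (auto simp: pair.V_def coord_dom_def)
  define p where "p y = 1 / q y" for y
  have sp: "smooth_on p (coord_dom c)" unfolding p_def using G.open_W q by (intro smooth_intros)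
  have eq: "1 / mean_curvature (G \<circ> param c') (N \<circ> param c') y = p (pair.\<psi> y)" if y: "y \<in> coord_dom c'" for y
  proof -
    have k: "param c' y \<in> fst c'" "snd c' (param c' y) = y" using is_chartD(5,6)[OF cs(1) y] .
    have kc: "param c' y \<in> fst c" using k(1) sub by blast
    have "mean_curvature (G \<circ> param c') (N \<circ> param c') y = mean_curvature (G \<circ> param c) (N \<circ> param c) (pair.\<psi> y)"
      using pair.curvature_transfer(2)[OF ns kc k(1)] k(2) pair.overlap_point[OF kc k(1)] by simp
    moreover have "pair.\<psi> y \<in> coord_dom c" using pair.transition_inverse(3) pair.overlap_subset y V by blast
    ultimately show ?thesis using mq by (simp add: p_def)
  qed
  have sG: "smooth_on (G \<circ> param c) (coord_dom c)" by (rule G.smooth_f)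
  interpret rev: chart_pair "fst c" c' c
    by unfold_locales (use is_chart_self[OF ch] cs in auto)
  have rU: "rev.U = coord_dom c'" and r\<phi>: "rev.\<phi> = pair.\<psi>"
    using sub by (auto simp: rev.U_def coord_dom_def rev.\<phi>_def pair.\<psi>_def)
  have smr: "smooth_on rev.\<phi> (coord_dom c')" using rev.smooth_transition(1) rU by simp
  have im: "rev.\<phi> ` coord_dom c' \<subseteq> coord_dom c"
    using rev.transition_inverse(1) rev.overlap_subset(2) rU by auto
  \<comment> \<open>The metric in \<open>c'\<close> pulled back from \<open>c\<close>. Evaluated on
    the null coordinate fields of \<open>c'\<close> it yields the pattern of zeros of the
    Jacobian.\<close>
  have ff: "first_form (G \<circ> param c') y X Y = (fst (rev.\<phi>' y X) * snd (rev.\<phi>' y Y) + snd (rev.\<phi>' y X) * fst (rev.\<phi>' y Y)) * G.h (rev.\<phi> y)"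
    if y: "y \<in> coord_dom c'" for y X Y
  proof -
    have "rev.\<phi> y \<in> coord_dom c" using im y by blast
    then show ?thesis using rev.derivative_pull(2)[OF sG, of y X Y] G.first_form_eq y rU by simp
  qed
  have D\<phi>: "rev.\<phi>' y (1, 0) = D1 rev.\<phi> y" "rev.\<phi>' y (0, 1) = D2 rev.\<phi> y" for y
    by (simp_all add: rev.\<phi>'_def D1_def D2_def)
  have nl: "fst (D1 rev.\<phi> y) * snd (D1 rev.\<phi> y) = 0" "fst (D2 rev.\<phi> y) * snd (D2 rev.\<phi> y) = 0"
    "fst (D1 rev.\<phi> y) * snd (D2 rev.\<phi> y) + snd (D1 rev.\<phi> y) * fst (D2 rev.\<phi> y) \<noteq> 0" if y: "y \<in> coord_dom c'" for y
  proof -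
    have "first_form (G \<circ> param c') y (1, 0) (1, 0) = 0" "first_form (G \<circ> param c') y (0, 1) (0, 1) = 0"
      "first_form (G \<circ> param c') y (1, 0) (0, 1) \<noteq> 0"
      using n' y unfolding null_coordinates_def by force+
    moreover have "G.h (rev.\<phi> y) \<noteq> 0" using G.h_nonzero im y by blast
    ultimately show "fst (D1 rev.\<phi> y) * snd (D1 rev.\<phi> y) = 0" "fst (D2 rev.\<phi> y) * snd (D2 rev.\<phi> y) = 0"
      "fst (D1 rev.\<phi> y) * snd (D2 rev.\<phi> y) + snd (D1 rev.\<phi> y) * fst (D2 rev.\<phi> y) \<noteq> 0"
      unfolding ff[OF y] D\<phi> by auto
  qed
  have oc': "open (coord_dom c')" by (rule is_chartD(2)[OF cs(1)])
  have "D2 (D1 (\<lambda>y. p (rev.\<phi> y))) x = 0"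
  proof (rule harmonic_null_change[OF oc' G.open_W smr im sp])
    show "D2 (D1 p) y = 0" if "y \<in> coord_dom c" for y using harmonic[OF that] by (simp add: p_def[abs_def])
    \<comment> \<open>By the two null relations at most one of these products is nonzero, so a
      nonzero sum forces a nonzero difference.\<close>
    show "fst (D1 rev.\<phi> y) * snd (D2 rev.\<phi> y) - fst (D2 rev.\<phi> y) * snd (D1 rev.\<phi> y) \<noteq> 0" if "y \<in> coord_dom c'" for y
      using nl[OF that] by auto
  qed (use nl x in auto)
  moreover have "D1 (\<lambda>y. 1 / mean_curvature (G \<circ> param c') (N \<circ> param c') y) y = D1 (\<lambda>y. p (rev.\<phi> y)) y"
    if "y \<in> coord_dom c'" for y
    by (rule D_cong(1)[OF oc' that]) (simp add: eq r\<phi>)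
  ultimately show "D2 (D1 (\<lambda>y. 1 / mean_curvature (G \<circ> param c') (N \<circ> param c') y)) x = 0"
    using D_cong(2)[OF oc' x] by metis
qed (use mq q(2) in auto)

text \<open>The deformation exists on a coordinate rectangle around \<open>p\<close>. Its image
  \<open>V\<close> with the restricted chart is a surface of its own, and the rectangle is convex,
  hence simply connected.\<close>

lemma dual_locally_bonnet:
  assumes ch: "is_chart M c" and patch: "isothermic_patch (coord_dom c) (G \<circ> param c) (N \<circ> param c) s q \<rho> \<sigma>"
    and q: "smooth_on q (coord_dom c)" "\<And>x. x \<in> coord_dom c \<Longrightarrow> q x \<noteq> 0"
    and harmonic: "\<And>x. x \<in> coord_dom c \<Longrightarrow> D2 (D1 (\<lambda>y. 1 / q y)) x = 0" and p: "p \<in> fst c"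
  shows "\<exists>V. p \<in> V \<and> openin (top_of_set (fst c)) V \<and> simply_connected (snd c ` V) \<and> timelike_bonnet V {(V, snd c)} G N"
proof -
  interpret isothermic_patch "coord_dom c" "G \<circ> param c" "N \<circ> param c" s q \<rho> \<sigma> by (rule patch)
  obtain u0 v0 where x0: "snd c p = (u0, v0)" by (cases "snd c p")
  have x0W: "(u0, v0) \<in> coord_dom c" using is_chartD(3)[OF ch p] x0 by simp
  obtain d \<delta> Fd Nd where D: "d > 0" "\<delta> > 0" "ball u0 d \<times> ball v0 d \<subseteq> coord_dom c"
    "smooth_on Fd (ball (0::real) \<delta> \<times> ball u0 d \<times> ball v0 d)" "smooth_on Nd (ball 0 \<delta> \<times> ball u0 d \<times> ball v0 d)"
    "\<And>t. t \<in> ball 0 \<delta> \<Longrightarrow> null_surface (ball u0 d \<times> ball v0 d) (\<lambda>x. Fd (t, x)) (\<lambda>x. Nd (t, x))"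
    "\<And>t x. t \<in> ball 0 \<delta> \<Longrightarrow> x \<in> ball u0 d \<times> ball v0 d \<Longrightarrow> null_surface.h (\<lambda>x. Fd (t, x)) x = h x"
    "\<And>t x. t \<in> ball 0 \<delta> \<Longrightarrow> x \<in> ball u0 d \<times> ball v0 d \<Longrightarrow> null_surface.k (\<lambda>x. Fd (t, x)) (\<lambda>x. Nd (t, x)) x = k x"
    "\<And>x. x \<in> ball u0 d \<times> ball v0 d \<Longrightarrow> Fd (0, x) = (G \<circ> param c) x" "\<And>x. x \<in> ball u0 d \<times> ball v0 d \<Longrightarrow> Nd (0, x) = (N \<circ> param c) x"
    "\<exists>t\<in>ball 0 \<delta>. \<bar>Q_coeff (\<lambda>x. Fd (t, x)) (\<lambda>x. Nd (t, x)) (u0, v0)\<bar> \<noteq> \<bar>Q (u0, v0)\<bar>"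
    proof (rule bonnet_deformation[OF x0W q harmonic], goal_cases)
      case (3 d \<delta> Fd Nd)
      show ?thesis by (rule 3(1)[of d \<delta> Fd Nd]) (fact 3)+
    qed
  let ?B = "ball u0 d \<times> ball v0 d"
  have oB: "open ?B" by (intro open_Times open_ball)
  have x0B: "(u0, v0) \<in> ?B" using D(1) by simp
  define V where "V = param c ` ?B"
  note sub = subchart[OF ch oB D(3), folded V_def]
  have inB: "snd c (param c x) = x" if "x \<in> ?B" for x using is_chartD(6)[OF ch] D(3) that by blast
  let ?c = "(V, snd c)"
  define Ft where "Ft t p = Fd (t, snd c p)" for t p
  define Nt where "Nt t p = Nd (t, snd c p)" for t p
  have loc: "(G \<circ> param c) x = (G \<circ> param ?c) x" "(N \<circ> param c) x = (N \<circ> param ?c) x"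
    "Fd (t, x) = (Ft t \<circ> param ?c) x" "Nd (t, x) = (Nt t \<circ> param ?c) x" if "x \<in> ?B" for t x
    using sub(3)[OF that] inB[OF that] by (simp_all add: Ft_def Nt_def)
  have nsB: "null_surface ?B (G \<circ> param c) (N \<circ> param c)"
    by (rule null_surface_subset[OF null_surface_axioms D(3) oB])
  have con: "connected (coord_dom ?c)" unfolding sub(2) by (rule connected_rectangle)
  have ns_c: "null_surface (coord_dom ?c) (G \<circ> param ?c) (N \<circ> param ?c)"
    unfolding sub(2) by (rule null_surface_cong[OF nsB loc(1,2)])
  have ns_t: "null_surface (coord_dom ?c) (Ft t \<circ> param ?c) (Nt t \<circ> param ?c)" if "t \<in> ball 0 \<delta>" for t
    unfolding sub(2) by (rule null_surface_cong[OF D(6)[OF that] loc(3,4)])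
  have surf: "timelike_surface V {?c} G N"
    using single_chart_surface[OF sub(1) con ns_c] by simp
  have surf_t: "timelike_surface V {?c} (Ft t) (Nt t)" if "t \<in> ball 0 \<delta>" for t
    using single_chart_surface[OF sub(1) con ns_t[OF that]] by simp
  have iv: "{-\<delta><..<\<delta>} = ball (0::real) \<delta>" by (auto simp: dist_real_def)
  interpret B: null_surface ?B "G \<circ> param c" "N \<circ> param c" by (rule nsB)
  have same: "first_form (Ft t \<circ> param ?c) x = first_form (G \<circ> param ?c) x"
    "mean_curvature (Ft t \<circ> param ?c) (Nt t \<circ> param ?c) x = mean_curvature (G \<circ> param ?c) (N \<circ> param ?c) x"
    if t: "t \<in> ball 0 \<delta>" and x: "x \<in> ?B" for t x
  proof -
    interpret t: null_surface ?B "\<lambda>x. Fd (t, x)" "\<lambda>x. Nd (t, x)" by (rule D(6)[OF t])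
    have hk: "t.h x = h x" "t.k x = k x" using D(7,8)[OF t x] .
    have "first_form (\<lambda>x. Fd (t, x)) x = first_form (G \<circ> param c) x"
      using t.first_form_eq[OF x] B.first_form_eq[OF x] hk by (simp add: fun_eq_iff)
    moreover have "mean_curvature (\<lambda>x. Fd (t, x)) (\<lambda>x. Nd (t, x)) x = mean_curvature (G \<circ> param c) (N \<circ> param c) x"
      using t.mean_curvature_eq[OF x] B.mean_curvature_eq[OF x] hk by (simp add: t.H_def B.H_def)
    moreover have "first_form (G \<circ> param c) x = first_form (G \<circ> param ?c) x"
      "mean_curvature (G \<circ> param c) (N \<circ> param c) x = mean_curvature (G \<circ> param ?c) (N \<circ> param ?c) x"
      "first_form (\<lambda>x. Fd (t, x)) x = first_form (Ft t \<circ> param ?c) x"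
      "mean_curvature (\<lambda>x. Fd (t, x)) (\<lambda>x. Nd (t, x)) x = mean_curvature (Ft t \<circ> param ?c) (Nt t \<circ> param ?c) x"
      by (rule surface_cong[OF oB x], erule loc, erule loc)+
    ultimately show "first_form (Ft t \<circ> param ?c) x = first_form (G \<circ> param ?c) x"
      "mean_curvature (Ft t \<circ> param ?c) (Nt t \<circ> param ?c) x = mean_curvature (G \<circ> param ?c) (N \<circ> param ?c) x"
      by simp_all
  qed
  have "\<exists>t\<in>ball 0 \<delta>. \<not> congruent_on V G (Ft t)"
  proof -
    obtain t where t: "t \<in> ball 0 \<delta>" "\<bar>Q_coeff (\<lambda>x. Fd (t, x)) (\<lambda>x. Nd (t, x)) (u0, v0)\<bar> \<noteq> \<bar>Q (u0, v0)\<bar>"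
      using D(11) by blast
    have "\<not> congruent_on V G (Ft t)"
    proof
      assume "congruent_on V G (Ft t)"
      then obtain L b where L: "linear L" "\<And>x y. mink (L x) (L y) = mink x y" "\<And>p. p \<in> V \<Longrightarrow> Ft t p = L (G p) + b"
        unfolding congruent_on_def by blast
      have "Fd (t, x) = L ((G \<circ> param c) x) + b" if "x \<in> ?B" for x
        using L(3)[of "param c x"] that inB[OF that] by (simp add: V_def Ft_def)
      from congruent_Hopf[OF nsB D(6)[OF t(1)] L(1,2) this x0B] t(2) show False by (simp del: o_apply)
    qed
    then show ?thesis using t(1) by blast
  qed
  moreover have "smooth_on (\<lambda>(t, x). (Ft t \<circ> param ?c) x) (ball 0 \<delta> \<times> ?B)" "smooth_on (\<lambda>(t, x). (Nt t \<circ> param ?c) x) (ball 0 \<delta> \<times> ?B)"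
  proof -
    have o: "open (ball (0::real) \<delta> \<times> ?B)" using oB by (intro open_Times open_ball)
    show "smooth_on (\<lambda>(t, x). (Ft t \<circ> param ?c) x) (ball 0 \<delta> \<times> ?B)" "smooth_on (\<lambda>(t, x). (Nt t \<circ> param ?c) x) (ball 0 \<delta> \<times> ?B)"
      by (rule smooth_on_cong[OF o _ D(4)], use loc(3) in fastforce, rule smooth_on_cong[OF o _ D(5)], use loc(4) in fastforce)
  qed
  moreover have "Ft 0 p = G p \<and> Nt 0 p = N p" if "p \<in> V" for p
    using that D(9,10) inB unfolding V_def Ft_def Nt_def by force
  ultimately have "timelike_bonnet V {?c} G N"
    unfolding timelike_bonnet_def
    using surf surf_t same D(2)
    by (intro conjI exI[of _ \<delta>] exI[of _ Ft] exI[of _ Nt]) (auto simp: sub(2) iv simp del: o_apply)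
  moreover have "p \<in> V"
    unfolding V_def using is_chartD(4)[OF ch p] x0 x0B by (intro image_eqI[of _ _ "(u0, v0)"]) auto
  moreover have "openin (top_of_set (fst c)) V"
    unfolding V_def by (rule chart_open_param(1)[OF ch oB D(3)])
  moreover have "simply_connected (snd c ` V)"
    unfolding sub(4) by (intro convex_imp_simply_connected convex_Times convex_ball)
  ultimately show ?thesis by blast
qed

theorem corollary4p15:
  fixes M :: "'m::t2_space set" and A :: "'m chart set"
    and F N :: "'m \<Rightarrow> real^3" and s :: real
  assumes "s = 1 \<or> s = -1"
    and "isothermic_surface s M A F N"
  shows "(harmonic_inverse_mean_curvature M A F N \<longrightarrow>
           (\<forall>c q \<rho> \<sigma>. isothermic_coordinates s M A F N c q \<rho> \<sigma> \<and> simply_connected (coord_dom c) \<longrightarrow>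
             (\<exists>G. christoffel_dual s c \<rho> \<sigma> F N G \<and>
                isothermic_surface s (fst c) {c} G N \<and>
                (\<forall>p\<in>fst c. \<exists>V. p \<in> V \<and> openin (top_of_set (fst c)) V \<and>
                   simply_connected (snd c ` V) \<and>
                   timelike_bonnet V {(V, snd c)} G N))))
       \<and> (timelike_bonnet M A F N \<and> umbilic_free A F N \<longrightarrow>
           (\<forall>c q \<rho> \<sigma>. isothermic_coordinates s M A F N c q \<rho> \<sigma> \<and> simply_connected (coord_dom c) \<longrightarrow>
             (\<exists>G. christoffel_dual s c \<rho> \<sigma> F N G \<and>
                isothermic_surface s (fst c) {c} G N \<and>
                harmonic_inverse_mean_curvature (fst c) {c} G N)))"
proof (intro conjI impI allI; elim conjE)
  fix c q \<rho> \<sigma>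
  assume himc: "harmonic_inverse_mean_curvature M A F N"
    and iso: "isothermic_coordinates s M A F N c q \<rho> \<sigma>" and sc: "simply_connected (coord_dom c)"
  have tl: "timelike_surface M A F N" using assms(2) by (simp add: isothermic_surface_def)
  have n: "null_coordinates M A F c" using iso by (simp add: isothermic_coordinates_def)
  have cs: "coordinate_system M A c" and ch: "is_chart M c" using n by (auto simp: null_coordinates_def coordinate_system_def)
  have M: "smooth_2manifold M A" using tl by (simp add: timelike_surface_def)
  obtain G where G: "christoffel_dual s c \<rho> \<sigma> F N G" "isothermic_surface s (fst c) {c} G N"
    "isothermic_patch (coord_dom c) (G \<circ> param c) (N \<circ> param c) s (mean_curvature (F \<circ> param c) (N \<circ> param c)) \<rho> \<sigma>"
    "\<And>x. x \<in> coord_dom c \<Longrightarrow> mean_curvature (G \<circ> param c) (N \<circ> param c) x = q x"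
    proof (rule dual_construction[OF assms(1) tl iso sc], goal_cases)
      case (1 G)
      show ?thesis by (rule 1(1)[of G]) (fact 1)+
    qed
  interpret null_surface "coord_dom c" "F \<circ> param c" "N \<circ> param c" by (rule null_coordinates_surface(1)[OF tl n])
  \<comment> \<open>In the patch of the dual the role of \<open>q\<close> is played by the mean
    curvature of the given surface, so the harmonicity required there is the hypothesis
    \<open>himc\<close>.\<close>
  have "\<exists>V. p \<in> V \<and> openin (top_of_set (fst c)) V \<and> simply_connected (snd c ` V) \<and> timelike_bonnet V {(V, snd c)} G N"
    if p: "p \<in> fst c" for p
  proof (rule dual_locally_bonnet[OF ch G(3) _ _ _ p])
    show "smooth_on (mean_curvature (F \<circ> param c) (N \<circ> param c)) (coord_dom c)"
      by (rule smooth_on_cong[OF open_W _ smooth_H]) (simp add: mean_curvature_eq)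
    fix x assume x: "x \<in> coord_dom c"
    show "D2 (D1 (\<lambda>y. 1 / mean_curvature (F \<circ> param c) (N \<circ> param c) y)) x = 0"
      using himc n x unfolding harmonic_inverse_mean_curvature_def by blast
    have px: "param c x \<in> fst c" "snd c (param c x) = x" using is_chartD(5,6)[OF ch x] .
    \<comment> \<open>That the mean curvature has no zeros is known in charts of \<open>A\<close>
      only, and is transferred to \<open>c\<close>.\<close>
    obtain d where d: "d \<in> A" "param c x \<in> fst d" by (rule chart_cover[OF M cs px(1)])
    interpret pair: chart_pair M c d by (rule coordinate_system_pair[OF M cs d(1)])
    have "snd d (param c x) \<in> coord_dom d" using is_chartD(3)[OF pair.d d(2)] .
    then show "mean_curvature (F \<circ> param c) (N \<circ> param c) x \<noteq> 0"
      using himc d(1) pair.curvature_transfer(2)[OF null_surface_axioms px(1) d(2)] px(2)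
      unfolding harmonic_inverse_mean_curvature_def by force
  qed
  then show "\<exists>G. christoffel_dual s c \<rho> \<sigma> F N G \<and> isothermic_surface s (fst c) {c} G N \<and>
      (\<forall>p\<in>fst c. \<exists>V. p \<in> V \<and> openin (top_of_set (fst c)) V \<and> simply_connected (snd c ` V) \<and>
         timelike_bonnet V {(V, snd c)} G N)"
    using G(1,2) by blast
next
  fix c q \<rho> \<sigma>
  assume bonnet: "timelike_bonnet M A F N" and u: "umbilic_free A F N"
    and iso: "isothermic_coordinates s M A F N c q \<rho> \<sigma>" and sc: "simply_connected (coord_dom c)"
  have tl: "timelike_surface M A F N" using assms(2) by (simp add: isothermic_surface_def)
  have ch: "is_chart M c" and q: "smooth_on q (coord_dom c)"
    using iso by (auto simp: isothermic_coordinates_def null_coordinates_def coordinate_system_def)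
  obtain G where G: "christoffel_dual s c \<rho> \<sigma> F N G" "isothermic_surface s (fst c) {c} G N"
    "isothermic_patch (coord_dom c) (G \<circ> param c) (N \<circ> param c) s (mean_curvature (F \<circ> param c) (N \<circ> param c)) \<rho> \<sigma>"
    "\<And>x. x \<in> coord_dom c \<Longrightarrow> mean_curvature (G \<circ> param c) (N \<circ> param c) x = q x"
    proof (rule dual_construction[OF assms(1) tl iso sc], goal_cases)
      case (1 G)
      show ?thesis by (rule 1(1)[of G]) (fact 1)+
    qed
  interpret isothermic_patch "coord_dom c" "G \<circ> param c" "N \<circ> param c" s "mean_curvature (F \<circ> param c) (N \<circ> param c)" \<rho> \<sigma>
    by (rule G(3))
  have "timelike_surface (fst c) {c} G N" using G(2) by (simp add: isothermic_surface_def)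
  \<comment> \<open>The mean curvature of the dual is \<open>q\<close>: it has no zeros because
    there are no umbilics, and its inverse is harmonic because of the Bonnet deformation.\<close>
  then have "harmonic_inverse_mean_curvature (fst c) {c} G N"
    by (rule dual_harmonic[OF ch _ null_surface_axioms G(4) q umbilic_free_isothermic[OF assms(1) tl u iso]
          bonnet_harmonic[OF assms bonnet u iso]])
  then show "\<exists>G. christoffel_dual s c \<rho> \<sigma> F N G \<and> isothermic_surface s (fst c) {c} G N \<and>
      harmonic_inverse_mean_curvature (fst c) {c} G N"
    using G(1,2) by blast
qed

end
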